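(* Let $k=k(n)=c_n n^{1/3}$ where $c_n\to c$ for a constant $c>0$. Run the random intersecting family process on $\binom{[n]}{k}$: $E_1$ is a uniformly random $k$-subset of $[n]$, and for $i\ge 1$, $E_{i+1}$ is chosen uniformly at random from the $k$-subsets of $[n]$ that are not among $E_1,\dots,E_i$ and that intersect each of $E_1,\dots,E_i$; the process stops when no such set exists, and ${\cal I}_k$ denotes the final family $\{E_1,\dots,E_m\}$. Let ${\mathcal H}_r=\{E_1,\dots,E_r\}$. Let $r_0$ be the first $r$ such that ${\mathcal H}_r$ has a vertex of degree three, and let $J$ be the set of vertices of degree two in ${\mathcal H}_{r_0-1}$. Call $S\subseteq J$ independent if no edge of ${\mathcal H}_{r_0-1}$ contains more than one element of $S$. For $r\ge r_0$ let ${\mathcal S}_r$ be the family of all independent $S\subseteq J$ that meet every one of $E_{r_0},\dots,E_r$; let $r_1$ be the first $r\ge r_0$ such that ${\mathcal S}_r$ is an intersecting family, and put ${\mathcal S}={\mathcal S}_{r_1}$. Then: (a) For every $b=b(n)\to\infty$, with high probability $r_0\le r_1\le b$. (b) With high probability ${\cal I}^*\subseteq {\cal I}_k\subseteq {\cal I}^{**}$, where ${\cal I}^*={\mathcal H}_{r_0-1}\cup\{E\in\binom{[n]}{k}: E \text{ contains some } S\in{\mathcal S} \text{ and intersects every edge of } {\mathcal H}_{r_0-1}\}$ and ${\cal I}^{**}={\mathcal H}_{r_0-1}\cup\{E\in\binom{[n]}{k}: E \text{ intersects every } S\in{\mathcal S} \text{ and intersects every edge of } {\mathcal H}_{r_0-1}\}$.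 (c) With high probability $|{\cal I}^{**}\setminus{\cal I}^*|=o(|{\cal I}^*|)$ and \[\frac{|{\cal I}_k|}{\binom nk}=(1+o(1))\frac{\sum_{S\in{\mathcal S}}c^{3(r_0-1-|S|)}}{k^{r_0-1}}\quad\text{as } n\to\infty.\] (d) The sequence $\left\{\lim_{n\to\infty}\frac{\mathbb P(r_0=i+1)}{\mathbb P(r_0>i+1)}\right\}_{i\ge 0}$ has exponential generating function $e^x\left(e^{x^2/(2c^3)}-1\right)$.
   Context: "With high probability" (w.h.p.) means with probability tending to $1$ as $n\to\infty$. A family of sets is intersecting if every two of its members have nonempty intersection. The degree of a vertex $x\in[n]$ in ${\mathcal H}_r$ is the number of edges $E_i$, $i\le r$, containing $x$. *)

theory Defs
  imports
    "HOL-Probability.Probability"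
    "HOL-Computational_Algebra.Formal_Power_Series"
begin

definition ksubsets :: "nat \<Rightarrow> nat \<Rightarrow> nat set set" where
  "ksubsets n k = {A. A \<subseteq> {1..n} \<and> card A = k}"

definition intersecting :: "'a set set \<Rightarrow> bool" where
  "intersecting F \<longleftrightarrow> (\<forall>A\<in>F. \<forall>B\<in>F. A \<inter> B \<noteq> {})"


subsection \<open>The random intersecting family process\<close>

text \<open>A state of the process is the list \<open>[E\<^sub>1, \<dots>, E\<^sub>i]\<close> of the edges chosen so far.\<close>

definition candidates :: "nat \<Rightarrow> nat \<Rightarrow> nat set list \<Rightarrow> nat set set" where
  "candidates n k Es = {A \<in> ksubsets n k. A \<notin> set Es \<and> (\<forall>E\<in>set Es. A \<inter> E \<noteq> {})}"

definition next_edge :: "nat \<Rightarrow> nat \<Rightarrow> nat set list \<Rightarrow> nat set list pmf" where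
  "next_edge n k Es =
     (if candidates n k Es = {} then return_pmf Es
      else map_pmf (\<lambda>A. Es @ [A]) (pmf_of_set (candidates n k Es)))"

text \<open>
  A stopped state is a fixed point of \<^const>\<open>next_edge\<close>. The edges are distinct, so the process
  has stopped after at most \<open>n choose k\<close> rounds (see \<open>candidates_final\<close> below), and the
  law obtained after that many rounds is the law of the whole history \<open>[E\<^sub>1, \<dots>, E\<^sub>m]\<close>;
  the final family is the set of members of this list.
\<close>

definition intersecting_process :: "nat \<Rightarrow> nat \<Rightarrow> nat set list pmf" where
  "intersecting_process n k =
     ((\<lambda>M. bind_pmf M (next_edge n k)) ^^ (n choose k)) (return_pmf [])"

lemma finite_ksubsets: "finite (ksubsets n k)"
  by (rule finite_subset[of _ "Pow {1..n}"]) (auto simp: ksubsets_def)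

lemma card_ksubsets: "card (ksubsets n k) = n choose k"
  using n_subsets[of "{1..n}" k] by (simp add: ksubsets_def)

lemma finite_candidates: "finite (candidates n k Es)"
  using finite_ksubsets by (simp add: candidates_def)

lemma process_invariant:
  assumes "Es \<in> set_pmf (((\<lambda>M. bind_pmf M (next_edge n k)) ^^ i) (return_pmf []))"
  shows "distinct Es \<and> set Es \<subseteq> ksubsets n k \<and> (candidates n k Es = {} \<or> length Es = i)"
  using assms
proof (induction i arbitrary: Es)
  case 0
  then show ?case by simp
next
  case (Suc i)
  then obtain Fs where Fs: "Fs \<in> set_pmf (((\<lambda>M. bind_pmf M (next_edge n k)) ^^ i) (return_pmf []))"
    and Es: "Es \<in> set_pmf (next_edge n k Fs)"
    by auto
  note IH = Suc.IH[OF Fs]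
  show ?case
  proof (cases "candidates n k Fs = {}")
    case True
    then show ?thesis using Es IH by (simp add: next_edge_def)
  next
    case False
    then obtain A where "A \<in> candidates n k Fs" "Es = Fs @ [A]"
      using Es finite_candidates by (auto simp: next_edge_def)
    then show ?thesis using IH False by (auto simp: candidates_def)
  qed
qed

lemma candidates_final:
  assumes "Es \<in> set_pmf (intersecting_process n k)"
  shows "candidates n k Es = {}"
proof -
  have *: "distinct Es" "set Es \<subseteq> ksubsets n k" "candidates n k Es = {} \<or> length Es = n choose k"
    using process_invariant assms unfolding intersecting_process_def by blast+
  show ?thesis
  proof (cases "length Es = n choose k")
    case True
    then have "set Es = ksubsets n k"
      using *(1,2) card_subset_eq[OF finite_ksubsets *(2)]
      by (simp add: card_ksubsets distinct_card)
    then show ?thesis by (auto simp: candidates_def)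
  qed (use *(3) in auto)
qed


subsection \<open>Quantities read off from a history \<open>Es = [E\<^sub>1, \<dots>, E\<^sub>m]\<close>\<close>

text \<open>List positions start at 0, the numbering of the edges at 1.\<close>

definition edge :: "nat set list \<Rightarrow> nat \<Rightarrow> nat set" where
  "edge Es i = Es ! (i - 1)"

definition prefix_family :: "nat set list \<Rightarrow> nat \<Rightarrow> nat set set" where
  "prefix_family Es r = edge Es ` {1..r}"

definition vertex_degree :: "nat set list \<Rightarrow> nat \<Rightarrow> nat \<Rightarrow> nat" where
  "vertex_degree Es r x = card {i \<in> {1..r}. x \<in> edge Es i}"

text \<open>
  The times \<open>r\<^sub>0\<close> and \<open>r\<^sub>1\<close> take the value \<open>\<infinity>\<close> (the infimum of the empty set)
  if the process stops before the respective condition is met.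
\<close>

definition time0 :: "nat set list \<Rightarrow> enat" where
  "time0 Es = Inf {enat r | r. r \<le> length Es \<and> (\<exists>x. vertex_degree Es r x = 3)}"

text \<open>
  \<open>before0 Es\<close> is the number \<open>r\<^sub>0 - 1\<close>. It and everything built from it below is
  meaningful only if \<open>time0 Es\<close> is finite.
\<close>

definition before0 :: "nat set list \<Rightarrow> nat" where
  "before0 Es = the_enat (time0 Es) - 1"

definition early_family :: "nat set list \<Rightarrow> nat set set" where
  "early_family Es = prefix_family Es (before0 Es)"

definition degree_two :: "nat set list \<Rightarrow> nat set" where
  "degree_two Es = {x. vertex_degree Es (before0 Es) x = 2}"

definition independent_set :: "nat set list \<Rightarrow> nat set \<Rightarrow> bool" where
  "independent_set Es S \<longleftrightarrow>
     S \<subseteq> degree_two Es \<and> (\<forall>E\<in>early_family Es. card (E \<inter> S) \<le> 1)"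

definition transversals :: "nat set list \<Rightarrow> nat \<Rightarrow> nat set set" where
  "transversals Es r =
     {S. independent_set Es S \<and> (\<forall>i\<in>{the_enat (time0 Es)..r}. S \<inter> edge Es i \<noteq> {})}"

definition time1 :: "nat set list \<Rightarrow> enat" where
  "time1 Es =
     Inf {enat r | r. r \<le> length Es \<and> time0 Es \<le> enat r \<and> intersecting (transversals Es r)}"

definition final_transversals :: "nat set list \<Rightarrow> nat set set" where
  "final_transversals Es = transversals Es (the_enat (time1 Es))"

definition lower_family :: "nat \<Rightarrow> nat \<Rightarrow> nat set list \<Rightarrow> nat set set" where
  "lower_family n k Es = early_family Es \<union>
     {E \<in> ksubsets n k. (\<exists>S\<in>final_transversals Es. S \<subseteq> E) \<and> (\<forall>F\<in>early_family Es. E \<inter> F \<noteq> {})}"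

definition upper_family :: "nat \<Rightarrow> nat \<Rightarrow> nat set list \<Rightarrow> nat set set" where
  "upper_family n k Es = early_family Es \<union>
     {E \<in> ksubsets n k. (\<forall>S\<in>final_transversals Es. E \<inter> S \<noteq> {}) \<and> (\<forall>F\<in>early_family Es. E \<inter> F \<noteq> {})}"


subsection \<open>Probabilistic and generating-function vocabulary\<close>

definition whp :: "(nat \<Rightarrow> 'a pmf) \<Rightarrow> (nat \<Rightarrow> 'a \<Rightarrow> bool) \<Rightarrow> bool" where
  "whp M P \<longleftrightarrow> (\<lambda>n. measure_pmf.prob (M n) {x. P n x}) \<longlonglongrightarrow> 1"

definition egf :: "(nat \<Rightarrow> real) \<Rightarrow> real fps" where
  "egf a = Abs_fps (\<lambda>i. a i / fact i)"

end

theory Submission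
  imports Defs
begin

text \<open>
  Since \<open>n\<close> is of order \<open>k ^ 3\<close>, meeting a given edge in a point of degree one costs a factor of order
  \<open>1 / k\<close>, and meeting two edges in a common point costs \<open>1 / k ^ 2\<close>. Hence, given \<open>h\<close> early edges
  \<open>H\<close> that pairwise share one point and have no point in common three at a time, almost all candidates
  meet every early edge in exactly one point, and those with a given set \<open>S\<close> of points of degree two
  number about \<open>c ^ (3 (h - |S|)) (n choose k) / k ^ h\<close>. The sets \<open>S\<close> are the matchings of the complete
  graph on the early edges, which gives the generating function in (d). After \<open>r\<^sub>0\<close>, as long as the
  transversals are not an intersecting family, their number drops with probability bounded below in
  each step, so \<open>r\<^sub>1\<close> is tight.

  After \<open>r\<^sub>1\<close>, a candidate outside the upper family can only be chosen if it is chosen before every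
  member of the lower family that is disjoint from it. As the choices are uniform, this has probability
  at most \<open>1 / (1 + d)\<close> if there are \<open>d\<close> such members, and the sum of these
  probabilities over all such candidates tends to 0. If no such candidate is ever chosen, the final family
  lies between the lower and the upper family, which differ only in inexact sets.
\<close>

section \<open>Counting k-sets\<close>

text \<open>The implied constants grow with the length of the history, so no estimate is uniform up
  to the random time \<open>r_1\<close>. Every estimate is therefore made for all histories
  \<open>H @ Ls\<close> of a fixed shape, and tightness of \<open>r_1\<close> allows the cut at a
  time \<open>K\<close> that depends on the tolerance only.

  Why deviations cost a factor \<open>1 / k\<close>: a prescribed point costs order
  \<open>1 / k ^ 2\<close>. A generic point of an edge can be chosen in \<open>k\<close> ways, so it
  loses \<open>1 / k\<close> net and serves one edge; a joint loses \<open>1 / k ^ 2\<close> and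
  serves two.

  After time \<open>K\<close> there may be as many rounds as there are candidates, so adding up
  one-step errors is hopeless there. The bound on leaving the upper family holds for every number of
  rounds instead. Its difficulty is a bad set that swallows much of the early edges and is disjoint
  from few members of the lower family; this forces separate treatment of bad sets with few and with
  many points on early edges.\<close>

lemma card_ksubsets_trace:
  assumes "U \<subseteq> {1..n}" "T \<subseteq> U" "card T \<le> k"
  shows "card {A \<in> ksubsets n k. A \<inter> U = T} = (n - card U) choose (k - card T)"
proof -
  have fU: "finite U" using assms(1) finite_subset by blast
  have fT: "finite T" using assms(2) fU finite_subset by blast
  have "{A \<in> ksubsets n k. A \<inter> U = T} = (\<lambda>R. T \<union> R) ` {R. R \<subseteq> {1..n} - U \<and> card R = k - card T}"
    (is "?L = ?f ` ?R")
  proof (intro set_eqI iffI)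
    fix A assume A: "A \<in> ?L"
    have fA: "finite A" using A finite_subset by (auto simp: ksubsets_def)
    have "card (A - U) = card A - card (A \<inter> U)"
      using card_Diff_subset_Int[of A U] fA by simp
    then have "A - U \<in> ?R" using A by (auto simp: ksubsets_def)
    moreover have "A = T \<union> (A - U)" using A by auto
    ultimately show "A \<in> ?f ` ?R" by blast
  next
    fix A assume "A \<in> ?f ` ?R"
    then obtain R where R: "R \<subseteq> {1..n} - U" "card R = k - card T" "A = T \<union> R" by auto
    have "finite R" using R(1) finite_subset by blast
    then have "card (T \<union> R) = card T + card R"
      using fT R assms(2) by (intro card_Un_disjoint) auto
    then show "A \<in> ?L" using R assms by (auto simp: ksubsets_def)
  qed
  moreover have "inj_on ?f ?R" using assms(2) by (auto simp: inj_on_def)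
  ultimately have "card {A \<in> ksubsets n k. A \<inter> U = T} = card ?R" by (simp add: card_image)
  also have "\<dots> = card ({1..n} - U) choose (k - card T)" by (rule n_subsets) simp
  also have "card ({1..n} - U) = n - card U" using assms(1) fU by (simp add: card_Diff_subset)
  finally show ?thesis .
qed

lemma rearrange_product:
  "a * x = b * y \<Longrightarrow> (a * n) * (x * p) = b * (y * (n * p))" for a b n p x y :: real
  by algebra

text \<open>The quotient of the two binomial coefficients is the product of
  \<open>(k - i) / (n - i)\<close> for \<open>i < m\<close>, and each factor is at most
  \<open>k / n\<close>.\<close>

lemma binomial_remove_upper:
  assumes "m \<le> k" "k \<le> n"
  shows "real ((n - m) choose (k - m)) * real n ^ m \<le> real (n choose k) * real k ^ m"
  using assms
proof (induction m)
  case (Suc m)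
  define N K where "N = n - Suc m" and "K = k - Suc m"
  have NK: "n - m = Suc N" "k - m = Suc K" using Suc.prems by (auto simp: N_def K_def)
  have ab: "real (Suc K) * real (Suc N choose Suc K) = real (Suc N) * real (N choose K)"
    using Suc_times_binomial[of K N] by (metis of_nat_mult)
  have le: "real (Suc K) * real n \<le> real (Suc N) * real k"
  proof -
    have "(k - m) * n \<le> (n - m) * k"
      using Suc.prems mult_le_mono2[of k n m]
      by (simp add: diff_mult_distrib mult.commute[of n k] mult.commute[of k m] diff_le_mono2)
    from of_nat_mono[OF this, where 'a = real] show ?thesis unfolding NK by (simp only: of_nat_mult)
  qed
  have IH: "real (Suc N choose Suc K) * real n ^ m \<le> real (n choose k) * real k ^ m"
    using Suc.IH Suc.prems unfolding NK by simp
  have "real (Suc N) * (real (N choose K) * real n ^ Suc m)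
      = (real (Suc K) * real n) * (real (Suc N choose Suc K) * real n ^ m)"
    unfolding power_Suc by (rule rearrange_product[OF ab, symmetric])
  also have "\<dots> \<le> (real (Suc N) * real k) * (real (n choose k) * real k ^ m)"
    by (intro mult_mono[OF le IH]) auto
  finally have "real (Suc N) * (real (N choose K) * real n ^ Suc m)
     \<le> real (Suc N) * (real (n choose k) * real k ^ Suc m)" by (simp add: algebra_simps)
  then show ?case unfolding N_def[symmetric] K_def[symmetric]
    by (subst (asm) mult_le_cancel_left_pos) auto
qed simp

text \<open>Here the factors \<open>(k - i) / (n - i)\<close> are bounded below by
  \<open>(k - m) / n\<close>. The separate bound \<open>m\<close> keeps \<open>k - m\<close> fixed
  while \<open>j\<close> runs through the induction.\<close>

lemma binomial_remove_lower:
  assumes "j \<le> m" "m \<le> k" "k \<le> n"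
  shows "real (n choose k) * real (k - m) ^ j \<le> real ((n - j) choose (k - j)) * real n ^ j"
  using assms
proof (induction j)
  case (Suc j)
  define N K where "N = n - Suc j" and "K = k - Suc j"
  have NK: "n - j = Suc N" "k - j = Suc K" using Suc.prems by (auto simp: N_def K_def)
  have ab: "real (Suc K) * real (Suc N choose Suc K) = real (Suc N) * real (N choose K)"
    using Suc_times_binomial[of K N] by (metis of_nat_mult)
  have le: "real (Suc N) * real (k - m) \<le> real (Suc K) * real n"
    using Suc.prems unfolding NK[symmetric]
    by (subst mult.commute, intro mult_mono of_nat_mono) auto
  have IH: "real (n choose k) * real (k - m) ^ j \<le> real (Suc N choose Suc K) * real n ^ j"
    using Suc.IH Suc.prems unfolding NK by simp
  have "real (Suc N) * (real (n choose k) * real (k - m) ^ Suc j)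
     = (real (Suc N) * real (k - m)) * (real (n choose k) * real (k - m) ^ j)"
    by (simp add: algebra_simps)
  also have "\<dots> \<le> (real (Suc K) * real n) * (real (Suc N choose Suc K) * real n ^ j)"
    by (intro mult_mono[OF le IH]) auto
  also have "\<dots> = real (Suc N) * (real (N choose K) * real n ^ Suc j)"
    unfolding power_Suc by (rule rearrange_product[OF ab])
  finally show ?case unfolding N_def[symmetric] K_def[symmetric]
    by (subst (asm) mult_le_cancel_left_pos) auto
qed simp

text \<open>Each point of an \<open>N\<close>-set lies in a fraction \<open>j / N\<close> of its
  \<open>j\<close>-subsets, so deleting one point costs at most a fraction \<open>j / d\<close>.
  Losses are measured against the initial \<open>N choose j\<close> and therefore add up
  linearly.\<close>

lemma binomial_shrink_lower:
  assumes "v + d \<le> N" "d > 0"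
  shows "real ((N - v) choose j) \<ge> real (N choose j) * (1 - real v * real j / real d)"
  using assms
proof (induction v)
  case (Suc v)
  define Q where "Q = N - Suc v"
  have Q: "N - v = Suc Q" "d \<le> Q" "Q > 0" using Suc.prems by (auto simp: Q_def)
  have mono: "real (Suc Q choose j) \<le> real (N choose j)"
    using Q(1) by (metis binomial_right_mono diff_le_self of_nat_mono)
  have step: "real (Q choose j) \<ge> real (Suc Q choose j) * (1 - real j / real d)"
  proof (cases j)
    case (Suc i)
    have "real (Suc Q choose Suc i) = real (Q choose i) + real (Q choose Suc i)" by simp
    moreover have "real (Q choose i) * real d \<le> real (Suc i) * real (Suc Q choose Suc i)"
    proof -
      have "real (Suc i) * real (Suc Q choose Suc i) = real (Suc Q) * real (Q choose i)"
        using Suc_times_binomial[of i Q] by (metis of_nat_mult)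
      moreover have "real d \<le> real (Suc Q)" using Q by simp
      ultimately show ?thesis by (simp add: mult.commute mult_right_mono)
    qed
    then have "real (Q choose i) \<le> real (Suc i) * real (Suc Q choose Suc i) / real d"
      using assms(2) by (simp add: pos_le_divide_eq del: of_nat_Suc binomial_Suc_Suc)
    moreover have "real (Suc Q choose Suc i) * (1 - real (Suc i) / real d)
        = real (Suc Q choose Suc i) - real (Suc i) * real (Suc Q choose Suc i) / real d"
      by (simp only: right_diff_distrib mult_1_right times_divide_eq_right mult.commute)
    ultimately show ?thesis unfolding Suc by (simp only:)
  qed simp
  have "real (N choose j) * (1 - real (Suc v) * real j / real d)
     = real (N choose j) * (1 - real v * real j / real d) - real (N choose j) * (real j / real d)"
    by (simp add: algebra_simps add_divide_distrib)
  also have "\<dots> \<le> real (Suc Q choose j) - real (Suc Q choose j) * (real j / real d)"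
    using Suc.IH Suc.prems mono unfolding Q(1) by (intro diff_mono mult_right_mono) auto
  also have "\<dots> \<le> real (Q choose j)" using step by (simp add: algebra_simps)
  finally show ?case unfolding Q_def .
qed simp

text \<open>Of \<open>u\<close> points deleted in the worst case, \<open>m\<close> are paid for by
  \<open>binomial_remove_lower\<close> and \<open>u - m\<close> by
  \<open>binomial_shrink_lower\<close>. The last hypothesis keeps the correction factor nonnegative,
  so that the estimates can be multiplied.\<close>

lemma binomial_lower:
  assumes "m \<le> k" "k \<le> n" "v \<le> u" "m \<le> u" "u + d \<le> n" "d > 0"
    and "real u * real k \<le> real d"
  shows "real ((n - v) choose (k - m)) * real n ^ m
     \<ge> real (n choose k) * real (k - m) ^ m * (1 - real u * real k / real d)"
proof -
  have "real (n choose k) * real (k - m) ^ m * (1 - real u * real k / real d)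
      \<le> (real ((n - m) choose (k - m)) * real n ^ m) * (1 - real u * real k / real d)"
    using binomial_remove_lower[of m m k n] assms by (intro mult_right_mono) (auto simp: field_simps)
  also have "\<dots> \<le> (real ((n - m) choose (k - m)) * real n ^ m)
      * (1 - real (u - m) * real (k - m) / real d)"
  proof -
    have "real (u - m) * real (k - m) \<le> real u * real k" by (intro mult_mono) auto
    then show ?thesis by (intro mult_left_mono diff_left_mono divide_right_mono) auto
  qed
  also have "\<dots> \<le> real ((n - m - (u - m)) choose (k - m)) * real n ^ m"
    using binomial_shrink_lower[of "u - m" d "n - m" "k - m"] assms
    by (subst mult.commute, subst mult.assoc[symmetric], intro mult_right_mono) (auto simp: mult.commute)
  also have "\<dots> \<le> real ((n - v) choose (k - m)) * real n ^ m"
    using assms by (intro mult_right_mono of_nat_mono binomial_right_mono) auto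
  finally show ?thesis .
qed

lemma card_ksubsets_superset:
  assumes "X \<subseteq> {1..n}" "k \<le> n"
  shows "real (card {A \<in> ksubsets n k. X \<subseteq> A}) * real n ^ card X \<le> real (n choose k) * real k ^ card X"
proof (cases "card X \<le> k")
  case True
  have "{A \<in> ksubsets n k. X \<subseteq> A} = {A \<in> ksubsets n k. A \<inter> X = X}" by auto
  then have "card {A \<in> ksubsets n k. X \<subseteq> A} = (n - card X) choose (k - card X)"
    using card_ksubsets_trace[of X n X k] assms True by simp
  then show ?thesis using binomial_remove_upper[OF True assms(2)] by simp
next
  case False
  have "{A \<in> ksubsets n k. X \<subseteq> A} = {}"
  proof safe
    fix A assume "A \<in> ksubsets n k" "X \<subseteq> A"
    then have "card X \<le> k" using card_mono[of A X] finite_subset[of A "{1..n}"] by (auto simp: ksubsets_def)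
    with False show "A \<in> {}" by simp
  qed
  then have "card {A \<in> ksubsets n k. X \<subseteq> A} = 0" by (metis card.empty)
  then show ?thesis by simp
qed

text \<open>
  Points of \<open>Y\<close> have weight 2 and points of \<open>Z\<close> have weight 1. When \<open>n\<close> is of order \<open>k ^ 3\<close>, the
  probability that a random \<open>k\<close>-set contains some set of weight \<open>w\<close> of the given
  shape is of order at most \<open>k ^ (- w)\<close>.
\<close>

lemma card_ksubsets_weight:
  fixes D :: real and n k z y m g :: nat
  assumes kn: "1 \<le> k" "k \<le> n" and D: "1 \<le> D" "real k ^ 3 \<le> D * real n"
    and Y: "Y \<subseteq> {1..n}" "card Y \<le> y" and Z: "Z \<subseteq> {1..n}" "card Z \<le> z * k" "1 \<le> z" "Y \<inter> Z = {}"
    and AA: "AA \<subseteq> ksubsets n k"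
      "\<And>A. A \<in> AA \<Longrightarrow> \<exists>X \<subseteq> A. X \<subseteq> Y \<union> Z \<and> card X \<le> m \<and> 2 * card (X \<inter> Y) + card (X \<inter> Z) \<ge> g"
  shows "real (card AA) \<le> 2 ^ y * (real m + 1) * real z ^ m * D ^ (y + m) * real (n choose k) / real k ^ g"
proof -
  have fin: "finite Y" "finite Z" using Y Z finite_subset by blast+
  define sup where "sup X = {A \<in> ksubsets n k. X \<subseteq> A}" for X
  have fsup: "finite (sup X)" for X using finite_ksubsets by (simp add: sup_def)
  \<comment> \<open>The union bound runs over the trace \<open>Y'\<close> of \<open>X\<close> on the
    few points of \<open>Y\<close> and over the size \<open>b\<close> of its trace on
    \<open>Z\<close>; \<open>b \<le> m\<close> keeps the number of such pairs bounded.\<close>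
  define I where "I = (SIGMA Y':Pow Y. {b \<in> {..m}. 2 * card Y' + b \<ge> g})"
  define ZZ where "ZZ b = {Z'. Z' \<subseteq> Z \<and> card Z' = b}" for b
  have fI: "finite I" using fin by (auto simp: I_def)
  have fZZ: "finite (ZZ b)" for b using fin by (auto simp: ZZ_def)
  have n0: "real n > 0" "real k > 0" using kn by auto
  have "AA \<subseteq> (\<Union>(Y', b)\<in>I. \<Union>Z'\<in>ZZ b. sup (Y' \<union> Z'))"
  proof
    fix A assume A: "A \<in> AA"
    then obtain X where X: "X \<subseteq> A" "X \<subseteq> Y \<union> Z" "card X \<le> m" "2 * card (X \<inter> Y) + card (X \<inter> Z) \<ge> g"
      using AA(2) by blast
    have "finite X" using X(2) fin finite_subset by blast
    then have "card (X \<inter> Z) \<le> m" using X(3) card_mono[of X "X \<inter> Z"] by simp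
    then have "(X \<inter> Y, card (X \<inter> Z)) \<in> I" using X(4) by (auto simp: I_def)
    moreover have "X \<inter> Z \<in> ZZ (card (X \<inter> Z))" by (auto simp: ZZ_def)
    moreover have "A \<in> sup ((X \<inter> Y) \<union> (X \<inter> Z))" using A AA(1) X(1) by (auto simp: sup_def)
    ultimately show "A \<in> (\<Union>(Y', b)\<in>I. \<Union>Z'\<in>ZZ b. sup (Y' \<union> Z'))" by blast
  qed
  then have "card AA \<le> card (\<Union>(Y', b)\<in>I. \<Union>Z'\<in>ZZ b. sup (Y' \<union> Z'))"
    using fI fZZ fsup by (intro card_mono) auto
  also have "\<dots> \<le> (\<Sum>(Y', b)\<in>I. card (\<Union>Z'\<in>ZZ b. sup (Y' \<union> Z')))"
    using card_UN_le[OF fI, of "\<lambda>(Y', b). \<Union>Z'\<in>ZZ b. sup (Y' \<union> Z')"] by (simp add: case_prod_unfold)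
  also have "\<dots> \<le> (\<Sum>(Y', b)\<in>I. \<Sum>Z'\<in>ZZ b. card (sup (Y' \<union> Z')))"
    unfolding case_prod_unfold by (intro sum_mono card_UN_le fZZ)
  finally have 1: "real (card AA) \<le> (\<Sum>(Y', b)\<in>I. \<Sum>Z'\<in>ZZ b. real (card (sup (Y' \<union> Z'))))"
    by (simp only: of_nat_sum[symmetric] of_nat_le_iff case_prod_unfold)
  define B where "B = real z ^ m * D ^ (y + m) * real (n choose k) / real k ^ g"
  have B0: "B \<ge> 0" using D n0 by (auto simp: B_def)
  have 2: "(\<Sum>Z'\<in>ZZ b. real (card (sup (Y' \<union> Z')))) \<le> B" if I: "(Y', b) \<in> I" for Y' b
  proof -
    define a where "a = card Y'"
    have Y': "Y' \<subseteq> Y" "b \<le> m" "2 * a + b \<ge> g" "a \<le> y"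
      using I Y fin card_mono[of Y Y'] by (auto simp: I_def a_def)
    have sup_le: "real (card (sup (Y' \<union> Z'))) \<le> real (n choose k) * (real k / real n) ^ (a + b)"
      if "Z' \<in> ZZ b" for Z'
    proof -
      have fin': "finite Y'" "finite Z'" using that Y' fin finite_subset by (auto simp: ZZ_def)
      have "card (Y' \<union> Z') = a + b" using that Y' Z fin' card_Un_disjoint[of Y' Z']
        by (auto simp: ZZ_def a_def)
      moreover have "Y' \<union> Z' \<subseteq> {1..n}" using that Y' Y Z by (auto simp: ZZ_def)
      ultimately have "real (card (sup (Y' \<union> Z'))) * real n ^ (a + b) \<le> real (n choose k) * real k ^ (a + b)"
        using card_ksubsets_superset[of "Y' \<union> Z'" n k] kn by (simp add: sup_def)
      then show ?thesis using n0 by (simp add: field_simps)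
    qed
    have zz: "real (card (ZZ b)) \<le> (real z * real k) ^ b"
    proof -
      have "card (ZZ b) = card Z choose b" unfolding ZZ_def using fin by (intro n_subsets)
      also have "\<dots> \<le> card Z ^ b"
        by (cases "b \<le> card Z") (auto simp: binomial_le_pow binomial_eq_0)
      also have "\<dots> \<le> (z * k) ^ b" using Z by (intro power_mono) auto
      finally show ?thesis by (metis of_nat_le_iff of_nat_mult of_nat_power)
    qed
    \<comment> \<open>Each prescribed point costs a factor of order \<open>1 / k ^ 2\<close>, but
      each of the \<open>b\<close> points of \<open>Z\<close> can be chosen in order
      \<open>k\<close> ways. This is the origin of the weights 2 and 1.\<close>
    have kk: "real k / real n \<le> D / real k ^ 2"
      using D n0 by (simp add: field_simps power3_eq_cube power2_eq_square)
    have "(\<Sum>Z'\<in>ZZ b. real (card (sup (Y' \<union> Z'))))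
       \<le> real (card (ZZ b)) * (real (n choose k) * (real k / real n) ^ (a + b))"
      using sum_bounded_above[of "ZZ b", OF sup_le] by simp
    also have "\<dots> \<le> (real z * real k) ^ b * (real (n choose k) * (D / real k ^ 2) ^ (a + b))"
      using zz kk n0 D by (intro mult_mono power_mono) auto
    also have "\<dots> = real z ^ b * D ^ (a + b) * real (n choose k) * (real k ^ b / real k ^ (2 * (a + b)))"
      unfolding power_mult_distrib power_divide power_mult by simp
    also have "real k ^ b / real k ^ (2 * (a + b)) = 1 / real k ^ (2 * a + b)"
      using n0 by (simp add: power_add power2_eq_square power_mult field_simps power_mult_distrib mult_2)
    also have "real z ^ b * D ^ (a + b) * real (n choose k) * (1 / real k ^ (2 * a + b))
       \<le> real z ^ m * D ^ (y + m) * real (n choose k) * (1 / real k ^ g)"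
      using Z D Y' kn by (intro mult_mono power_increasing divide_left_mono) auto
    finally show ?thesis by (simp add: B_def)
  qed
  have "(\<Sum>(Y', b)\<in>I. \<Sum>Z'\<in>ZZ b. real (card (sup (Y' \<union> Z')))) \<le> real (card I) * B"
    using sum_bounded_above[of I "\<lambda>(Y', b). \<Sum>Z'\<in>ZZ b. real (card (sup (Y' \<union> Z')))" B] 2 by auto
  also have "card I \<le> card (Pow Y \<times> {..m})" using fin by (intro card_mono) (auto simp: I_def)
  then have "card I \<le> 2 ^ card Y * (m + 1)" using fin by (simp add: card_cartesian_product card_Pow)
  then have "card I \<le> 2 ^ y * (m + 1)"
    using Y(2) by (meson dual_order.trans mult_le_mono1 one_le_numeral power_increasing)
  from of_nat_mono[OF this, where 'a = real] have "real (card I) \<le> 2 ^ y * (real m + 1)"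
    by (simp add: algebra_simps)
  then have "real (card I) * B \<le> 2 ^ y * (real m + 1) * B" using B0 by (intro mult_right_mono)
  finally show ?thesis using 1 by (simp add: B_def mult.assoc)
qed

section \<open>Nice families and exact sets\<close>

text \<open>Positions are compared, not edges, so an edge listed twice would consist of joints. For
  a nice \<open>H\<close> these are the points of degree two, which form the set J of the theorem
  once \<open>H\<close> is the early part of the history.\<close>

definition joints :: "nat set list \<Rightarrow> nat set" where
  "joints H = {x. \<exists>i<length H. \<exists>j<length H. i \<noteq> j \<and> x \<in> H ! i \<inter> H ! j}"

text \<open>The typical shape of the edges before the first vertex of degree three. It is that of a
  complete graph, with the members of \<open>H\<close> as vertices and the joints as edges.\<close>

definition nice :: "nat \<Rightarrow> nat \<Rightarrow> nat set list \<Rightarrow> bool" where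
  "nice n k H \<longleftrightarrow> set H \<subseteq> ksubsets n k
     \<and> (\<forall>i<length H. \<forall>j<length H. i \<noteq> j \<longrightarrow> card (H ! i \<inter> H ! j) = 1)
     \<and> (\<forall>i<length H. \<forall>j<length H. \<forall>l<length H. i \<noteq> j \<longrightarrow> j \<noteq> l \<longrightarrow> i \<noteq> l \<longrightarrow> H ! i \<inter> H ! j \<inter> H ! l = {})"

definition exact :: "nat set list \<Rightarrow> nat set \<Rightarrow> bool" where
  "exact H A \<longleftrightarrow> (\<forall>i<length H. card (A \<inter> H ! i) = 1)"

definition indep :: "nat set list \<Rightarrow> nat set set" where
  "indep H = {S. S \<subseteq> joints H \<and> (\<forall>i<length H. card (H ! i \<inter> S) \<le> 1)}"

definition exact_sets :: "nat \<Rightarrow> nat \<Rightarrow> nat set list \<Rightarrow> nat set \<Rightarrow> nat set set" where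
  "exact_sets n k H S = {A \<in> ksubsets n k. exact H A \<and> A \<inter> joints H = S}"

abbreviation points :: "nat set list \<Rightarrow> nat set" where
  "points H \<equiv> \<Union>(set H)"

definition unhit :: "nat set list \<Rightarrow> nat set \<Rightarrow> nat set" where
  "unhit H S = {i. i < length H \<and> H ! i \<inter> S = {}}"

definition deg :: "nat set list \<Rightarrow> nat \<Rightarrow> nat" where
  "deg H x = card {i. i < length H \<and> x \<in> H ! i}"

section \<open>Degrees and points of a family of k-sets\<close>

lemma ksubsetsD: "A \<in> ksubsets n k \<Longrightarrow> A \<subseteq> {1..n} \<and> card A = k \<and> finite A"
  using finite_subset[of A "{1..n}"] by (auto simp: ksubsets_def)

text \<open>Double counting of the incidences between \<open>X\<close> and the edges.\<close>

lemma sum_card_eq_sum_deg: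
  assumes "finite X"
  shows "(\<Sum>i<length H. card (X \<inter> H ! i)) = (\<Sum>x\<in>X. deg H x)"
proof -
  have "(\<Sum>i<length H. card (X \<inter> H ! i)) = (\<Sum>i<length H. \<Sum>x\<in>X. if x \<in> H ! i then 1 else 0)"
    using assms by (intro sum.cong) (auto simp: sum.If_cases Int_def)
  also have "\<dots> = (\<Sum>x\<in>X. \<Sum>i<length H. if x \<in> H ! i then 1 else 0)" by (rule sum.swap)
  also have "\<dots> = (\<Sum>x\<in>X. deg H x)"
    by (intro sum.cong) (auto simp: sum.If_cases Int_def deg_def intro!: arg_cong[where f=card])
  finally show ?thesis .
qed

lemma deg_eq_0: "x \<notin> points H \<Longrightarrow> deg H x = 0"
  by (auto simp: deg_def)

lemma deg_le_1: "x \<notin> joints H \<Longrightarrow> deg H x \<le> 1"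
proof -
  assume "x \<notin> joints H"
  then have "i = j" if "i \<in> {i. i < length H \<and> x \<in> H ! i}" "j \<in> {i. i < length H \<and> x \<in> H ! i}" for i j
    using that by (auto simp: joints_def)
  then show ?thesis unfolding deg_def
    by (metis (no_types, lifting) card_le_Suc0_iff_eq card.infinite le0 One_nat_def)
qed

lemma points_subset: "set H \<subseteq> ksubsets n k \<Longrightarrow> points H \<subseteq> {1..n}"
  by (auto simp: ksubsets_def)

lemma joints_subset: "joints H \<subseteq> points H"
  by (force simp: joints_def)

lemma card_points_le: "set H \<subseteq> ksubsets n k \<Longrightarrow> card (points H) \<le> length H * k"
proof -
  assume H: "set H \<subseteq> ksubsets n k"
  have "card (points H) \<le> (\<Sum>E\<in>set H. card E)" by (rule card_Union_le_sum_card)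
  also have "\<dots> \<le> (\<Sum>E\<in>set H. k)" using H by (intro sum_mono) (auto simp: ksubsets_def)
  also have "\<dots> \<le> length H * k" by (simp add: card_length)
  finally show ?thesis .
qed

context
  fixes n k :: nat and H :: "nat set list"
  assumes nice: "nice n k H"
begin

lemma nice_ksubsets: "set H \<subseteq> ksubsets n k"
  using nice unfolding nice_def by (rule conjunct1)

lemma nice_card_Int: "i < length H \<Longrightarrow> j < length H \<Longrightarrow> i \<noteq> j \<Longrightarrow> card (H ! i \<inter> H ! j) = 1"
  using nice unfolding nice_def by simp

lemma nice_triple:
  assumes "i < length H" "j < length H" "l < length H" "x \<in> H ! i" "x \<in> H ! j" "x \<in> H ! l"
  shows "i = j \<or> j = l \<or> i = l"
proof (rule ccontr)
  assume "\<not> ?thesis"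
  then have "H ! i \<inter> H ! j \<inter> H ! l = {}" using nice assms(1-3) unfolding nice_def by simp
  then show False using assms(4-6) by blast
qed

lemma nice_nth: "i < length H \<Longrightarrow> H ! i \<in> ksubsets n k"
  using nice_ksubsets nth_mem by blast

lemma nice_finite: "i < length H \<Longrightarrow> finite (H ! i)" "i < length H \<Longrightarrow> card (H ! i) = k"
  using ksubsetsD[OF nice_nth] by simp_all

lemma finite_points: "finite (points H)"
  by (rule finite_subset[OF points_subset[OF nice_ksubsets]]) simp

lemma finite_joints: "finite (joints H)"
  by (rule finite_subset[OF joints_subset finite_points])

lemma finite_indep: "finite (indep H)"
  by (rule finite_subset[of _ "Pow (joints H)"]) (auto simp: indep_def finite_joints)

text \<open>The intersections with the other edges are singletons, and they are disjoint because no
  point lies in three edges.\<close>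

lemma card_joints_Int:
  assumes i: "i < length H"
  shows "card (joints H \<inter> H ! i) = length H - 1"
proof -
  have "joints H \<inter> H ! i = (\<Union>j\<in>{..<length H} - {i}. H ! i \<inter> H ! j)"
    using i unfolding joints_def by auto
  also have "card \<dots> = (\<Sum>j\<in>{..<length H} - {i}. card (H ! i \<inter> H ! j))"
    using nice_finite(1) i nice_triple by (intro card_UN_disjoint) blast+
  also have "\<dots> = (\<Sum>j\<in>{..<length H} - {i}. 1)"
    using nice_card_Int i by (intro sum.cong) auto
  finally show ?thesis using i by simp
qed

lemma card_joints_le: "card (joints H) \<le> length H * length H"
proof -
  have "joints H = (\<Union>i<length H. joints H \<inter> H ! i)" unfolding joints_def by blast
  then have "card (joints H) \<le> (\<Sum>i<length H. card (joints H \<inter> H ! i))"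
    by (metis card_UN_le finite_lessThan)
  also have "\<dots> \<le> (\<Sum>i<length H. length H)" by (intro sum_mono) (auto simp: card_joints_Int)
  finally show ?thesis by simp
qed

lemma deg_joints:
  assumes "x \<in> joints H"
  shows "deg H x = 2"
proof -
  obtain i j where ij: "i < length H" "j < length H" "i \<noteq> j" "x \<in> H ! i" "x \<in> H ! j"
    using assms by (auto simp: joints_def)
  have "l = i \<or> l = j" if "l < length H" "x \<in> H ! l" for l
    using nice_triple[OF ij(1,2) that(1) ij(4,5) that(2)] ij(3) by auto
  then have "{i. i < length H \<and> x \<in> H ! i} = {i, j}" using ij by auto
  then show ?thesis using ij by (simp add: deg_def)
qed

text \<open>Each joint lies in two edges and no edge contains two points of \<open>S\<close>, so
  \<open>S\<close> hits exactly \<open>2 * card S\<close> edges.\<close>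

lemma card_unhit:
  assumes S: "S \<in> indep H"
  shows "card (unhit H S) + 2 * card S = length H"
proof -
  have fS: "finite S" using S finite_subset[OF _ finite_joints] by (simp add: indep_def)
  have "2 * card S = (\<Sum>x\<in>S. deg H x)" using S deg_joints by (simp add: indep_def subset_iff)
  also have "\<dots> = (\<Sum>i<length H. card (S \<inter> H ! i))" using sum_card_eq_sum_deg[OF fS] by simp
  also have "\<dots> = (\<Sum>i<length H. if H ! i \<inter> S = {} then 0 else 1)"
  proof (intro sum.cong refl)
    fix i assume i: "i \<in> {..<length H}"
    have "card (S \<inter> H ! i) \<le> 1" using S i by (auto simp: indep_def Int_commute)
    moreover have "card (S \<inter> H ! i) = 0 \<longleftrightarrow> H ! i \<inter> S = {}" using fS by (simp add: Int_commute)
    ultimately show "card (S \<inter> H ! i) = (if H ! i \<inter> S = {} then 0 else 1)" by (metis le_neq_implies_less less_one)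
  qed
  also have "\<dots> = card ({..<length H} - unhit H S)"
    by (simp add: sum.If_cases unhit_def Collect_conj_eq Diff_eq) (rule arg_cong[where f=card], auto)
  also have "\<dots> = length H - card (unhit H S)"
    by (subst card_Diff_subset) (auto simp: unhit_def)
  finally have "2 * card S = length H - card (unhit H S)" .
  moreover have "card (unhit H S) \<le> card {..<length H}" by (intro card_mono) (auto simp: unhit_def)
  ultimately show ?thesis by simp
qed

lemma card_indep_le: "S \<in> indep H \<Longrightarrow> 2 * card S \<le> length H"
  using card_unhit[of S] by simp

lemma card_indep_family_le: "card (indep H) \<le> 2 ^ (length H * length H)"
proof -
  have "card (indep H) \<le> card (Pow (joints H))"
    by (intro card_mono) (auto simp: indep_def finite_joints)
  also have "\<dots> \<le> 2 ^ (length H * length H)"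
    unfolding card_Pow[OF finite_joints] by (intro power_increasing card_joints_le) auto
  finally show ?thesis .
qed

lemma exact_joints_indep:
  assumes "exact H A"
  shows "A \<inter> joints H \<in> indep H"
proof -
  have "card (H ! i \<inter> (A \<inter> joints H)) \<le> 1" if "i < length H" for i
  proof -
    have "card (A \<inter> H ! i) = 1" using assms that by (auto simp: exact_def)
    moreover have "card (H ! i \<inter> (A \<inter> joints H)) \<le> card (A \<inter> H ! i)"
      using nice_finite(1)[OF that] by (intro card_mono) auto
    ultimately show ?thesis by simp
  qed
  then show ?thesis by (auto simp: indep_def)
qed

text \<open>Inside \<open>points H\<close>, such a set consists of \<open>S\<close> and one point
  that is no joint from each edge missed by \<open>S\<close>; its remaining points are free outside
  \<open>points H\<close>. \<open>W\<close> is a further set to be avoided, later a bad set that is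
  to be blocked.\<close>

lemma card_exact_sets_avoiding:
  assumes S: "S \<in> indep H" and W: "W \<subseteq> {1..n}" "W \<inter> S = {}" and k: "length H \<le> k"
  shows "card {A \<in> exact_sets n k H S. A \<inter> W = {}}
    = (\<Prod>i\<in>unhit H S. card (H ! i - joints H - W))
      * ((n - card (points H \<union> W)) choose (k - (length H - card S)))"
proof -
  define V where "V = unhit H S"
  \<comment> \<open>A member of \<open>F\<close> chooses a point in every edge that \<open>S\<close>
    misses; \<open>T f\<close> is the resulting trace on \<open>points H\<close>.\<close>
  define F where "F = PiE V (\<lambda>i. H ! i - joints H - W)"
  define T where "T f = S \<union> f ` V" for f :: "nat \<Rightarrow> nat"
  define G where "G f = {A \<in> ksubsets n k. A \<inter> (points H \<union> W) = T f}" for f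
  have fS: "finite S" using S finite_subset[OF _ finite_joints] by (simp add: indep_def)
  have SJ: "S \<subseteq> joints H" using S by (auto simp: indep_def)
  have fV: "finite V" by (auto simp: V_def unhit_def)
  have Vi: "i < length H" "H ! i \<inter> S = {}" if "i \<in> V" for i using that by (auto simp: V_def unhit_def)
  have fP: "finite (H ! i - joints H - W)" if "i \<in> V" for i using nice_finite Vi that by blast
  have fF: "finite F" unfolding F_def using fV fP by (intro finite_PiE)
  have f: "f i \<in> H ! i" "f i \<notin> joints H" "f i \<notin> W" if "f \<in> F" "i \<in> V" for f i
    using that by (auto simp: F_def PiE_iff)
  \<comment> \<open>A chosen point is no joint, so it lies in its own edge only.\<close>
  have f_unique: "i = j" if "f \<in> F" "j \<in> V" "i < length H" "f j \<in> H ! i" for f i j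
    using f[OF that(1,2)] Vi(1)[OF that(2)] that(3,4) by (auto simp: joints_def)
  have T_hit: "T f \<inter> H ! i = {f i}" if "f \<in> F" "i \<in> V" for f i
    using f[OF that] f_unique[OF that(1) _ Vi(1)[OF that(2)]] Vi(2)[OF that(2)] that(2)
    by (auto simp: T_def)
  have T_nhit: "T f \<inter> H ! i = S \<inter> H ! i" if "f \<in> F" "i < length H" "i \<notin> V" for f i
    using f_unique[OF that(1) _ that(2)] that(3) by (auto simp: T_def)
  have inj: "T f = T g \<Longrightarrow> f = g" if "f \<in> F" "g \<in> F" for f g
  proof -
    assume "T f = T g"
    then have "f i = g i" if "i \<in> V" for i using T_hit[of f i] T_hit[of g i] \<open>f \<in> F\<close> \<open>g \<in> F\<close> that by auto
    then show "f = g" using that by (auto simp: F_def intro: PiE_ext)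
  qed
  have T_U: "T f \<subseteq> points H \<union> W" if "f \<in> F" for f
    using SJ joints_subset f(1)[OF that] Vi(1) by (fastforce simp: T_def)
  have card_T: "card (T f) = length H - card S" if "f \<in> F" for f
  proof -
    have "inj_on f V" using f_unique[OF that] f(1)[OF that] Vi(1) by (intro inj_onI) metis
    then have "card (f ` V) = card V" by (rule card_image)
    moreover have "S \<inter> f ` V = {}" using f(2)[OF that] SJ by auto
    ultimately have "card (T f) = card S + card V" unfolding T_def using fS fV by (subst card_Un_disjoint) auto
    then show ?thesis using card_unhit[OF S] by (simp add: V_def)
  qed
  have "{A \<in> exact_sets n k H S. A \<inter> W = {}} = (\<Union>f\<in>F. G f)"
  proof (intro set_eqI iffI)
    fix A assume A: "A \<in> {A \<in> exact_sets n k H S. A \<inter> W = {}}"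
    then have A': "A \<in> ksubsets n k" "A \<inter> W = {}" "A \<inter> joints H = S" and ex: "exact H A"
      by (auto simp: exact_sets_def)
    define f where "f = restrict (\<lambda>i. the_elem (A \<inter> H ! i)) V"
    have Ai: "\<exists>x. A \<inter> H ! i = {x}" if "i < length H" for i
      using ex that by (auto simp: exact_def card_1_singleton_iff)
    have fi: "A \<inter> H ! i = {f i}" if i: "i \<in> V" for i
    proof -
      obtain x where "A \<inter> H ! i = {x}" using Ai[OF Vi(1)[OF i]] ..
      then show ?thesis using i by (simp add: f_def)
    qed
    have fF: "f \<in> F" unfolding F_def
    proof (intro PiE_I)
      fix i assume i: "i \<in> V"
      have "f i \<in> A" "f i \<in> H ! i" using fi[OF i] by auto
      then show "f i \<in> H ! i - joints H - W" using A' Vi(2)[OF i] by auto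
    qed (auto simp: f_def)
    have Si: "A \<inter> H ! i = S \<inter> H ! i" if i: "i < length H" "i \<notin> V" for i
    proof -
      have "H ! i \<inter> S \<noteq> {}" using i by (auto simp: V_def unhit_def)
      moreover obtain x where "A \<inter> H ! i = {x}" using Ai[OF i(1)] ..
      moreover have "S \<inter> H ! i \<subseteq> A \<inter> H ! i" using A'(3) by blast
      ultimately show ?thesis by (metis Int_commute subset_singletonD)
    qed
    have "A \<inter> H ! i = T f \<inter> H ! i" if "i < length H" for i
      using T_hit[OF fF] T_nhit[OF fF] fi Si that by (cases "i \<in> V") auto
    then have "A \<inter> points H = T f \<inter> points H" by (fastforce simp: in_set_conv_nth)
    moreover have "T f \<inter> W = {}" using f(3)[OF fF] W(2) by (auto simp: T_def)
    ultimately have "A \<inter> (points H \<union> W) = T f"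
      using T_U[OF fF] A'(2) unfolding Int_Un_distrib by blast
    then have "A \<in> G f" using A'(1) unfolding G_def by simp
    then show "A \<in> (\<Union>f\<in>F. G f)" using fF by blast
  next
    fix A assume "A \<in> (\<Union>f\<in>F. G f)"
    then obtain f where fF: "f \<in> F" and A: "A \<in> ksubsets n k" "A \<inter> (points H \<union> W) = T f"
      by (auto simp: G_def)
    have TW: "T f \<inter> W = {}" using f(3)[OF fF] W(2) by (auto simp: T_def)
    have Ai: "A \<inter> H ! i = T f \<inter> H ! i" if "i < length H" for i
      using A(2) nth_mem[OF that] by blast
    have "card (A \<inter> H ! i) = 1" if i: "i < length H" for i
    proof (cases "i \<in> V")
      case True
      then show ?thesis using Ai[OF i] T_hit[OF fF True] by simp
    next
      case False
      have "card (H ! i \<inter> S) \<le> 1" using S i by (auto simp: indep_def)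
      moreover have "H ! i \<inter> S \<noteq> {}" using False i by (auto simp: V_def unhit_def)
      then have "card (H ! i \<inter> S) \<noteq> 0" using fS by simp
      ultimately show ?thesis using Ai[OF i] T_nhit[OF fF i False] by (simp add: Int_commute)
    qed
    moreover have "A \<inter> joints H = T f \<inter> joints H" using A(2) joints_subset by blast
    then have "A \<inter> joints H = S" using f(2)[OF fF] SJ by (auto simp: T_def)
    moreover have "A \<inter> W = {}" using A(2) TW by blast
    ultimately show "A \<in> {A \<in> exact_sets n k H S. A \<inter> W = {}}"
      using A(1) by (auto simp: exact_sets_def exact_def)
  qed
  moreover have "card (\<Union>f\<in>F. G f) = (\<Sum>f\<in>F. card (G f))"
    using fF inj finite_ksubsets by (intro card_UN_disjoint) (auto simp: G_def)
  moreover have "card (G f) = (n - card (points H \<union> W)) choose (k - (length H - card S))" if "f \<in> F" for f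
  proof -
    have "points H \<union> W \<subseteq> {1..n}" using points_subset[OF nice_ksubsets] W(1) by blast
    moreover have "card (T f) \<le> k" using card_T[OF that] k by simp
    ultimately show ?thesis
      unfolding G_def using card_ksubsets_trace[OF _ T_U[OF that], of n k] card_T[OF that] by simp
  qed
  moreover have "card F = (\<Prod>i\<in>V. card (H ! i - joints H - W))"
    unfolding F_def using fV by (rule card_PiE)
  ultimately show ?thesis by (simp add: V_def)
qed

text \<open>Prescribed are \<open>h - s\<close> points: the \<open>s\<close> joints and one point
  from each of the \<open>h - 2 * s\<close> remaining edges, with at most \<open>k\<close> choices
  in each of these. The deletion of all of \<open>points H\<close> is weakened to that of
  \<open>h - s\<close> points.\<close>

lemma card_exact_sets_upper:
  assumes S: "S \<in> indep H" and k: "length H \<le> k" "k \<le> n"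
  shows "real (card (exact_sets n k H S)) * real n ^ (length H - card S)
    \<le> real k ^ (length H - 2 * card S) * real k ^ (length H - card S) * real (n choose k)"
proof -
  define h s where "h = length H" and "s = card S"
  have unhit_eq: "card (unhit H S) = h - 2 * s" using card_unhit[OF S] by (simp add: h_def s_def)
  have "h - s \<le> card (points H)"
  proof (cases "h = 0")
    case False
    then have "H ! 0 \<subseteq> points H" "card (H ! 0) = k"
      using nice_finite(2)[of 0] Union_upper[OF nth_mem[of 0 H]] by (simp_all add: h_def)
    then show ?thesis using card_mono[OF finite_points, of "H ! 0"] k by (simp add: h_def)
  qed simp
  then have b: "(n - card (points H)) choose (k - (h - s)) \<le> (n - (h - s)) choose (k - (h - s))"
    by (intro binomial_right_mono) simp
  have "(\<Prod>i\<in>unhit H S. card (H ! i - joints H)) \<le> (\<Prod>i\<in>unhit H S. k)"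
  proof (intro prod_mono conjI)
    fix i assume "i \<in> unhit H S"
    then have "i < length H" by (simp add: unhit_def)
    then show "card (H ! i - joints H) \<le> k"
      using card_mono[of "H ! i" "H ! i - joints H"] nice_finite[of i] by auto
  qed simp
  also have "\<dots> = k ^ (h - 2 * s)" unfolding unhit_eq[symmetric] by simp
  finally have "card (exact_sets n k H S) \<le> k ^ (h - 2 * s) * ((n - (h - s)) choose (k - (h - s)))"
    using card_exact_sets_avoiding[OF S, of "{}"] k b by (auto simp: h_def s_def intro: mult_le_mono)
  then have "real (card (exact_sets n k H S)) * real n ^ (h - s)
     \<le> real (k ^ (h - 2 * s) * ((n - (h - s)) choose (k - (h - s)))) * real n ^ (h - s)"
    by (intro mult_right_mono of_nat_mono) auto
  also have "\<dots> = real k ^ (h - 2 * s) * (real ((n - (h - s)) choose (k - (h - s))) * real n ^ (h - s))"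
    by simp
  also have "\<dots> \<le> real k ^ (h - 2 * s) * (real (n choose k) * real k ^ (h - s))"
    using k by (intro mult_left_mono binomial_remove_upper) (auto simp: h_def)
  finally show ?thesis by (simp add: h_def s_def algebra_simps)
qed

text \<open>An edge missed by \<open>S\<close> loses at most \<open>h - 1\<close> joints and
  \<open>w\<close> points of \<open>W\<close>, so at least \<open>k - h - w\<close> choices are left
  in it. The ground set loses at most \<open>(h + 1) * k\<close> points, namely \<open>k\<close> for
  each edge and \<open>k\<close> for \<open>W\<close>.\<close>

lemma card_exact_sets_lower:
  assumes S: "S \<in> indep H" and W: "W \<subseteq> {1..n}" "W \<inter> S = {}" "card W \<le> k" "card (W \<inter> points H) \<le> w"
    and k: "length H \<le> k" "1 \<le> k" "(length H + 1) * k + d \<le> n" "d > 0"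
      "real ((length H + 1) * k) * real k \<le> real d"
  shows "real (card {A \<in> exact_sets n k H S. A \<inter> W = {}}) * real n ^ (length H - card S)
    \<ge> real (k - length H - w) ^ (length H - 2 * card S) * real (k - (length H - card S)) ^ (length H - card S)
      * real (n choose k) * (1 - real ((length H + 1) * k) * real k / real d)"
proof -
  define h s where "h = length H" and "s = card S"
  have unhit_eq: "card (unhit H S) = h - 2 * s" using card_unhit[OF S] by (simp add: h_def s_def)
  define X where "X = 1 - real ((h + 1) * k) * real k / real d"
  have kn: "k \<le> n" using k(3) by simp
  have fW: "finite W" using W(1) finite_subset[of W "{1..n}"] by simp
  have "(k - h - w) ^ (h - 2 * s) = (\<Prod>i\<in>unhit H S. k - h - w)"
    unfolding unhit_eq[symmetric] by simp
  also have "\<dots> \<le> (\<Prod>i\<in>unhit H S. card (H ! i - joints H - W))"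
  proof (intro prod_mono conjI)
    fix i assume "i \<in> unhit H S"
    then have i: "i < length H" by (simp add: unhit_def)
    have "card (H ! i) \<le> card ((H ! i - joints H - W) \<union> (joints H \<inter> H ! i) \<union> (W \<inter> points H))"
      using nice_finite(1)[OF i] i fW by (intro card_mono) auto
    also have "\<dots> \<le> card (H ! i - joints H - W) + card (joints H \<inter> H ! i) + card (W \<inter> points H)"
      using card_Un_le[of "(H ! i - joints H - W) \<union> (joints H \<inter> H ! i)" "W \<inter> points H"]
        card_Un_le[of "H ! i - joints H - W" "joints H \<inter> H ! i"] by linarith
    finally show "k - h - w \<le> card (H ! i - joints H - W)"
      using nice_finite(2)[OF i] card_joints_Int[OF i] W(4) by (simp add: h_def)
  qed simp
  finally have P: "(k - h - w) ^ (h - 2 * s) \<le> (\<Prod>i\<in>unhit H S. card (H ! i - joints H - W))" .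
  have U: "card (points H \<union> W) \<le> (h + 1) * k"
    using card_Un_le[of "points H" W] card_points_le[OF nice_ksubsets] W(3) by (simp add: h_def)
  have hk: "h - s \<le> (h + 1) * k"
  proof -
    have "h \<le> h * k" using k(2) by simp
    then show ?thesis unfolding add_mult_distrib by linarith
  qed
  have "real (k - h - w) ^ (h - 2 * s) * (real (n choose k) * real (k - (h - s)) ^ (h - s) * X)
    \<le> real (k - h - w) ^ (h - 2 * s)
      * (real ((n - card (points H \<union> W)) choose (k - (h - s))) * real n ^ (h - s))"
    unfolding X_def using k kn U hk by (intro mult_left_mono binomial_lower) (auto simp: h_def)
  also have "\<dots> \<le> real (\<Prod>i\<in>unhit H S. card (H ! i - joints H - W))
      * (real ((n - card (points H \<union> W)) choose (k - (h - s))) * real n ^ (h - s))"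
    using of_nat_mono[OF P, where 'a = real] by (intro mult_right_mono) simp_all
  also have "\<dots> = real (card {A \<in> exact_sets n k H S. A \<inter> W = {}}) * real n ^ (h - s)"
    using card_exact_sets_avoiding[OF S W(1,2) k(1)] by (simp add: h_def s_def)
  finally show ?thesis by (simp add: h_def s_def X_def algebra_simps)
qed

text \<open>Here \<open>E\<close> may cover almost all of an early edge. But it has \<open>k\<close>
  elements and is no early edge itself, so every early edge has a point outside \<open>E\<close>.
  One such point from each edge together with \<open>S\<close> gives a trace of at most
  \<open>2 * h\<close> points on \<open>points H \<union> E\<close> that ensures all
  requirements.\<close>

lemma card_avoiding_lower:
  assumes S: "S \<in> indep H" and E: "E \<in> ksubsets n k" "E \<notin> set H" "E \<inter> S = {}"
    and k: "2 * length H \<le> k" "1 \<le> k" "(length H + 1) * k + d \<le> n" "d > 0"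
      "real ((length H + 1) * k) * real k \<le> real d"
  shows "real (card {A \<in> ksubsets n k. S \<subseteq> A \<and> (\<forall>F\<in>set H. A \<inter> F \<noteq> {}) \<and> A \<inter> E = {}})
        * real n ^ (2 * length H)
    \<ge> real (k - 2 * length H) ^ (2 * length H)
      * real (n choose k) * (1 - real ((length H + 1) * k) * real k / real d)"
proof -
  define h where "h = length H"
  define X where "X = 1 - real ((h + 1) * k) * real k / real d"
  have X0: "X \<ge> 0" using k by (simp add: X_def h_def)
  have kn: "k \<le> n" using k(3) by simp
  note E' = ksubsetsD[OF E(1)]
  have fS: "finite S" using S finite_subset[OF _ finite_joints] by (simp add: indep_def)
  have SJ: "S \<subseteq> joints H" using S by (auto simp: indep_def)
  have "\<exists>x. x \<in> H ! i - E" if i: "i < h" for i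
  proof (rule ccontr)
    assume "\<nexists>x. x \<in> H ! i - E"
    then have "H ! i \<subseteq> E" by auto
    moreover have "card (H ! i) = card E" using nice_finite i E' by (simp add: h_def)
    ultimately have "H ! i = E" using card_subset_eq[of E "H ! i"] E' by simp
    then show False using E(2) i by (auto simp: h_def)
  qed
  then obtain x where x: "\<And>i. i < h \<Longrightarrow> x i \<in> H ! i - E" by metis
  define T where "T = S \<union> x ` {..<h}"
  define t where "t = card T"
  have fT: "finite T" using fS by (simp add: T_def)
  have t: "t \<le> 2 * h"
  proof -
    have "t \<le> card S + card (x ` {..<h})" by (simp add: t_def T_def card_Un_le)
    also have "\<dots> \<le> h + h" using card_indep_le[OF S] card_image_le[of "{..<h}" x] by (simp add: h_def)
    finally show ?thesis by simp
  qed
  have TU: "T \<subseteq> points H \<union> E" using SJ joints_subset[of H] x by (fastforce simp: T_def h_def)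
  have U: "points H \<union> E \<subseteq> {1..n}" using points_subset[OF nice_ksubsets] E' by blast
  have "{A \<in> ksubsets n k. A \<inter> (points H \<union> E) = T}
      \<subseteq> {A \<in> ksubsets n k. S \<subseteq> A \<and> (\<forall>F\<in>set H. A \<inter> F \<noteq> {}) \<and> A \<inter> E = {}}"
  proof
    fix A assume A: "A \<in> {A \<in> ksubsets n k. A \<inter> (points H \<union> E) = T}"
    have "T \<inter> E = {}" using E(3) x by (auto simp: T_def)
    then have "A \<inter> E = {}" using A by blast
    moreover have "A \<inter> F \<noteq> {}" if F: "F \<in> set H" for F
    proof -
      obtain i where "i < h" "F = H ! i" using F unfolding in_set_conv_nth h_def by auto
      then have "x i \<in> A \<inter> F" using A x[of i] by (auto simp: T_def)
      then show ?thesis by blast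
    qed
    moreover have "S \<subseteq> A" using A by (auto simp: T_def)
    ultimately show "A \<in> {A \<in> ksubsets n k. S \<subseteq> A \<and> (\<forall>F\<in>set H. A \<inter> F \<noteq> {}) \<and> A \<inter> E = {}}"
      using A by blast
  qed
  then have "card {A \<in> ksubsets n k. A \<inter> (points H \<union> E) = T}
      \<le> card {A \<in> ksubsets n k. S \<subseteq> A \<and> (\<forall>F\<in>set H. A \<inter> F \<noteq> {}) \<and> A \<inter> E = {}}"
    using finite_ksubsets by (intro card_mono) auto
  moreover have "card {A \<in> ksubsets n k. A \<inter> (points H \<union> E) = T}
      = (n - card (points H \<union> E)) choose (k - t)"
    unfolding t_def using t k by (intro card_ksubsets_trace[OF U TU]) (auto simp: h_def t_def)
  ultimately have c: "real ((n - card (points H \<union> E)) choose (k - t))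
     \<le> real (card {A \<in> ksubsets n k. S \<subseteq> A \<and> (\<forall>F\<in>set H. A \<inter> F \<noteq> {}) \<and> A \<inter> E = {}})" by simp
  have card_U: "card (points H \<union> E) \<le> (h + 1) * k"
    using card_Un_le[of "points H" E] card_points_le[OF nice_ksubsets] E' by (simp add: h_def)
  have tk: "t \<le> (h + 1) * k" using t k(1) by (simp add: h_def)
  \<comment> \<open>The exponent \<open>t\<close> varies with the chosen trace; padding with
    \<open>k - 2 * h \<le> n\<close> replaces it by \<open>2 * h\<close>.\<close>
  have "real (k - 2 * h) ^ (2 * h) * real (n choose k) * X
     = real (k - 2 * h) ^ t * real (k - 2 * h) ^ (2 * h - t) * real (n choose k) * X"
    using t by (simp flip: power_add)
  also have "\<dots> = (real (n choose k) * real (k - 2 * h) ^ t * X) * real (k - 2 * h) ^ (2 * h - t)"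
    by simp
  also have "\<dots> \<le> (real (n choose k) * real (k - t) ^ t * X) * real n ^ (2 * h - t)"
    using X0 t kn by (intro mult_mono power_mono mult_nonneg_nonneg) auto
  also have "\<dots> \<le> (real ((n - card (points H \<union> E)) choose (k - t)) * real n ^ t) * real n ^ (2 * h - t)"
    unfolding X_def using k kn card_U tk t by (intro mult_right_mono binomial_lower) (auto simp: h_def)
  also have "\<dots> = real ((n - card (points H \<union> E)) choose (k - t)) * real n ^ (2 * h)"
    using t by (simp add: mult.assoc flip: power_add)
  also have "\<dots> \<le> real (card {A \<in> ksubsets n k. S \<subseteq> A \<and> (\<forall>F\<in>set H. A \<inter> F \<noteq> {}) \<and> A \<inter> E = {}})
        * real n ^ (2 * h)"
    by (rule mult_right_mono[OF c]) simp
  finally show ?thesis by (simp add: h_def X_def)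
qed

end

section \<open>Independent sets, matchings and rare sets\<close>

text \<open>Counts the matchings of the complete graph on \<open>h\<close> vertices, each with
  \<open>t\<close> to the number of its edges. In the last clause a fixed vertex is either unmatched
  or matched with one of the \<open>h + 1\<close> others.\<close>

fun matching_poly :: "real \<Rightarrow> nat \<Rightarrow> real" where
  "matching_poly t 0 = 1"
| "matching_poly t (Suc 0) = 1"
| "matching_poly t (Suc (Suc h)) = matching_poly t (Suc h) + real (Suc h) * t * matching_poly t h"

text \<open>Each joint lies in exactly two edges, so independent sets are matchings of the complete graph
  whose vertices are the edges of \<open>H\<close>.\<close>

lemma sum_indep:
  assumes nice: "nice n k H"
  shows "(\<Sum>S\<in>indep H. t ^ card S) = matching_poly t (length H)"
proof -
  \<comment> \<open>Joints and independent sets are restricted to the edges with index in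
    \<open>V\<close>, so that vertices of the complete graph can be removed one at a time.\<close>
  define JV where "JV V = {x. \<exists>i\<in>V. \<exists>j\<in>V. i \<noteq> j \<and> x \<in> H ! i \<inter> H ! j}" for V
  define IV where "IV V = {S. S \<subseteq> JV V \<and> (\<forall>i\<in>V. card (H ! i \<inter> S) \<le> 1)}" for V
  have JVJ: "JV V \<subseteq> joints H" if "V \<subseteq> {..<length H}" for V
    using that unfolding JV_def joints_def by blast
  have fIV: "finite (IV V)" if "V \<subseteq> {..<length H}" for V
    by (rule finite_subset[of _ "Pow (joints H)"]) (use JVJ[OF that] finite_joints[OF nice] in \<open>auto simp: IV_def\<close>)
  have fS: "finite S" if "V \<subseteq> {..<length H}" "S \<in> IV V" for V S
    using JVJ[OF that(1)] that(2) finite_subset[OF _ finite_joints[OF nice]] by (auto simp: IV_def)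
  \<comment> \<open>Either \<open>S\<close> avoids edge \<open>v\<close>, or it contains exactly one
    point that \<open>v\<close> shares with some edge \<open>i\<close>, and then the rest of
    \<open>S\<close> avoids both of these edges.\<close>
  have step: "(\<Sum>S\<in>IV (insert v V). t ^ card S)
      = (\<Sum>S\<in>IV V. t ^ card S) + t * (\<Sum>i\<in>V. \<Sum>S\<in>IV (V - {i}). t ^ card S)"
    if V: "insert v V \<subseteq> {..<length H}" "v \<notin> V" for v V
  proof -
    have fV: "finite V" using V(1) finite_subset[of V "{..<length H}"] by auto
    have Vl: "i < length H" if "i \<in> V" for i using that V(1) by auto
    have vl: "v < length H" using V(1) by auto
    have "\<exists>y. H ! v \<inter> H ! i = {y}" if "i \<in> V" for i
      using nice_card_Int[OF nice vl Vl[OF that]] that V(2) card_1_singleton_iff[of "H ! v \<inter> H ! i"] by auto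
    then obtain x where x: "\<And>i. i \<in> V \<Longrightarrow> H ! v \<inter> H ! i = {x i}" by metis
    have xH: "x i \<in> H ! v" "x i \<in> H ! i" if "i \<in> V" for i using x[OF that] by auto
    have x_in: "i = j" if "i \<in> V" "j \<in> V" "x i \<in> H ! j" for i j
      using nice_triple[OF nice vl Vl[OF that(1)] Vl[OF that(2)] xH(1)[OF that(1)] xH(2)[OF that(1)] that(3)]
        V(2) that by auto
    \<comment> \<open>Otherwise \<open>y\<close> would lie in three edges.\<close>
    have JV_v: "y \<notin> H ! v" if yW: "y \<in> JV W" "W \<subseteq> V" for y W
    proof
      assume y: "y \<in> H ! v"
      obtain i j where ij: "i \<in> W" "j \<in> W" "i \<noteq> j" "y \<in> H ! i" "y \<in> H ! j"
        using yW(1) unfolding JV_def by blast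
      then have "i \<in> V" "j \<in> V" using yW(2) by auto
      then show False
        using nice_triple[OF nice vl Vl[of i] Vl[of j] y ij(4,5)] ij(3) V(2) by auto
    qed
    define B where "B i = insert (x i) ` IV (V - {i})" for i
    have x_notin: "x i \<notin> S" if "i \<in> V" "S \<in> IV W" "W \<subseteq> V" for i S W
      using JV_v[OF _ that(3)] xH(1)[OF that(1)] that(2) by (auto simp: IV_def)
    have IV_decomp: "IV (insert v V) = IV V \<union> (\<Union>i\<in>V. B i)"
    proof (intro set_eqI iffI)
      fix S assume "S \<in> IV (insert v V)"
      then have S: "S \<subseteq> JV (insert v V)" "\<And>i. i \<in> insert v V \<Longrightarrow> card (H ! i \<inter> S) \<le> 1"
        by (auto simp: IV_def)
      have one: "y = z" if "i \<in> insert v V" "y \<in> H ! i" "z \<in> H ! i" "y \<in> S" "z \<in> S" for i y z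
      proof -
        have "finite (H ! i \<inter> S)" using nice_finite(1)[OF nice] V(1) that(1) by auto
        then show ?thesis using S(2)[OF that(1)] that card_le_Suc0_iff_eq[of "H ! i \<inter> S"] by auto
      qed
      show "S \<in> IV V \<union> (\<Union>i\<in>V. B i)"
      proof (cases "S \<inter> H ! v = {}")
        case True
        then have "S \<subseteq> JV V" using S(1) unfolding JV_def by blast
        then show ?thesis using S(2) by (auto simp: IV_def)
      next
        case False
        then obtain y where y: "y \<in> S" "y \<in> H ! v" by blast
        then obtain i where i: "i \<in> V" "y \<in> H ! i"
        proof -
          obtain i j where ij: "i \<in> insert v V" "j \<in> insert v V" "i \<noteq> j" "y \<in> H ! i" "y \<in> H ! j"
            using S(1) y(1) unfolding JV_def by blast
          then show ?thesis using that by (cases "i = v") auto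
        qed
        have yx: "y = x i" using x[OF i(1)] y i by auto
        have "S - {x i} \<in> IV (V - {i})"
        proof -
          have "z \<in> JV (V - {i})" if z: "z \<in> S - {x i}" for z
          proof -
            obtain a b where ab: "a \<in> insert v V" "b \<in> insert v V" "a \<noteq> b" "z \<in> H ! a" "z \<in> H ! b"
              using S(1) z unfolding JV_def by blast
            have "z \<notin> H ! v" using one[of v z y] y z yx by auto
            moreover have "z \<notin> H ! i" using one[of i z y] y i z yx by auto
            ultimately have "a \<in> V - {i}" "b \<in> V - {i}" using ab by auto
            then show ?thesis using ab unfolding JV_def by blast
          qed
          moreover have "card (H ! j \<inter> (S - {x i})) \<le> 1" if "j \<in> V" for j
          proof -
            have "card (H ! j \<inter> (S - {x i})) \<le> card (H ! j \<inter> S)"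
              using nice_finite(1)[OF nice Vl[OF that]] by (intro card_mono) auto
            then show ?thesis using S(2)[of j] that by auto
          qed
          ultimately show ?thesis by (auto simp: IV_def)
        qed
        moreover have "S = insert (x i) (S - {x i})" using y yx by auto
        ultimately have "S \<in> B i" unfolding B_def by blast
        then show ?thesis using i by blast
      qed
    next
      fix S assume "S \<in> IV V \<union> (\<Union>i\<in>V. B i)"
      then consider "S \<in> IV V" | i S' where "i \<in> V" "S' \<in> IV (V - {i})" "S = insert (x i) S'"
        unfolding B_def by blast
      then show "S \<in> IV (insert v V)"
      proof cases
        case 1
        then have "S \<subseteq> JV (insert v V)" unfolding IV_def JV_def by blast
        moreover have "H ! v \<inter> S = {}" using JV_v[of _ V] 1 by (auto simp: IV_def)
        ultimately show ?thesis using 1 by (auto simp: IV_def)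
      next
        case 2
        have "S' \<subseteq> JV (insert v V)" using 2 unfolding IV_def JV_def by blast
        moreover have "x i \<in> JV (insert v V)"
          unfolding JV_def mem_Collect_eq using xH[OF 2(1)] 2(1) V(2)
          by (intro bexI[of _ v] bexI[of _ i]) auto
        moreover have "H ! v \<inter> S' = {}" using JV_v[of _ "V - {i}"] 2 by (auto simp: IV_def)
        then have "H ! v \<inter> S = {x i}" using 2(3) xH[OF 2(1)] by auto
        moreover have "card (H ! j \<inter> S) \<le> 1" if j: "j \<in> V" for j
        proof (cases "j = i")
          case True
          have "H ! i \<inter> S' = {}"
          proof (rule ccontr)
            assume "H ! i \<inter> S' \<noteq> {}"
            then obtain z where z: "z \<in> H ! i" "z \<in> JV (V - {i})" using 2(2) by (auto simp: IV_def)
            then obtain a b where ab: "a \<in> V - {i}" "b \<in> V - {i}" "a \<noteq> b" "z \<in> H ! a" "z \<in> H ! b"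
              unfolding JV_def by blast
            then show False using nice_triple[OF nice Vl[OF 2(1)] Vl[of a] Vl[of b] z(1)] by auto
          qed
          then have "H ! j \<inter> S = {x i}" using True 2(3) xH[OF 2(1)] by auto
          then show ?thesis by simp
        next
          case False
          then have "H ! j \<inter> S = H ! j \<inter> S'" using 2(3) x_in[OF 2(1) j] by auto
          then show ?thesis using 2(2) j False by (auto simp: IV_def)
        qed
        ultimately show ?thesis using 2(3) by (auto simp: IV_def)
      qed
    qed
    have VW: "V - {i} \<subseteq> {..<length H}" for i using V(1) by auto
    have fB: "finite (B i)" for i unfolding B_def using fIV[OF VW] by simp
    have xB: "x i \<in> S \<and> S \<inter> H ! v = {x i}" if iS: "i \<in> V" "S \<in> B i" for i S
    proof -
      obtain S' where S': "S' \<in> IV (V - {i})" "S = insert (x i) S'" using iS by (auto simp: B_def)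
      have "S' \<inter> H ! v = {}" using JV_v[of _ "V - {i}"] S' by (auto simp: IV_def)
      then show ?thesis using S' xH[OF iS(1)] by auto
    qed
    have disj1: "IV V \<inter> (\<Union>i\<in>V. B i) = {}" using xB x_notin[of _ _ V] by blast
    have disj2: "B i \<inter> B j = {}" if ij: "i \<in> V" "j \<in> V" "i \<noteq> j" for i j
    proof (rule ccontr)
      assume "B i \<inter> B j \<noteq> {}"
      then obtain S where "S \<in> B i" "S \<in> B j" by blast
      then have "{x i} = {x j}" using xB[OF ij(1)] xB[OF ij(2)] by metis
      then show False using x_in[OF ij(1,2)] xH(2)[OF ij(2)] ij(3) by simp
    qed
    have sumB: "(\<Sum>S\<in>B i. t ^ card S) = t * (\<Sum>S\<in>IV (V - {i}). t ^ card S)" if i: "i \<in> V" for i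
    proof -
      have inj: "inj_on (insert (x i)) (IV (V - {i}))"
        using x_notin[OF i, of _ "V - {i}"] by (intro inj_onI) (metis Diff_subset insert_ident)
      have "(\<Sum>S\<in>B i. t ^ card S) = (\<Sum>S\<in>IV (V - {i}). t ^ card (insert (x i) S))"
        unfolding B_def by (subst sum.reindex[OF inj]) simp
      also have "\<dots> = (\<Sum>S\<in>IV (V - {i}). t * t ^ card S)"
        using x_notin[OF i, of _ "V - {i}"] fS[OF VW] by (intro sum.cong) auto
      finally show ?thesis by (simp add: sum_distrib_left)
    qed
    have VV: "V \<subseteq> {..<length H}" using V(1) by auto
    have "(\<Sum>S\<in>IV (insert v V). t ^ card S) = (\<Sum>S\<in>IV V. t ^ card S) + (\<Sum>S\<in>(\<Union>i\<in>V. B i). t ^ card S)"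
      unfolding IV_decomp using fIV[OF VV] fB fV disj1 by (intro sum.union_disjoint) auto
    also have "(\<Sum>S\<in>(\<Union>i\<in>V. B i). t ^ card S) = (\<Sum>i\<in>V. \<Sum>S\<in>B i. t ^ card S)"
      using fV fB disj2 by (intro sum.UNION_disjoint) auto
    finally show ?thesis using sumB by (simp add: sum_distrib_left)
  qed
  \<comment> \<open>The sum depends on \<open>card V\<close> only, so removing \<open>v\<close>
    together with any \<open>i\<close> always gives the same term. Two vertices disappear at once,
    hence the strong induction.\<close>
  have main: "(\<Sum>S\<in>IV V. t ^ card S) = matching_poly t (card V)" if "V \<subseteq> {..<length H}" for V
    using that
  proof (induction "card V" arbitrary: V rule: less_induct)
    case less
    have fV: "finite V" using less.prems finite_subset[of V "{..<length H}"] by auto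
    show ?case
    proof (cases "V = {}")
      case True
      then have "IV V = {{}}" by (auto simp: IV_def JV_def)
      then show ?thesis using True by simp
    next
      case False
      then obtain v W where W: "V = insert v W" "v \<notin> W" by (meson ex_in_conv mk_disjoint_insert)
      have fW: "finite W" and WV: "W \<subseteq> {..<length H}" using fV W less.prems by auto
      have cV: "card V = Suc (card W)" using W fW by simp
      have "(\<Sum>S\<in>IV (W - {i}). t ^ card S) = matching_poly t (card W - 1)" if "i \<in> W" for i
        using less.hyps[of "W - {i}"] WV cV that fW card_Diff1_less[OF fW that] by fastforce
      moreover have "(\<Sum>S\<in>IV W. t ^ card S) = matching_poly t (card W)"
        using less.hyps[of W] WV cV by simp
      ultimately have "(\<Sum>S\<in>IV V. t ^ card S)
          = matching_poly t (card W) + t * (real (card W) * matching_poly t (card W - 1))"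
        using step[of v W] W less.prems by simp
      then show ?thesis unfolding cV by (cases "card W") (auto simp: algebra_simps)
    qed
  qed
  have "JV {..<length H} = joints H" unfolding JV_def joints_def by auto
  then have "IV {..<length H} = indep H" unfolding IV_def indep_def by auto
  then show ?thesis using main[of "{..<length H}"] by simp
qed

text \<open>The transversal family of the theorem, expressed by the early edges \<open>H\<close> and
  the later edges \<open>Ls\<close>.\<close>

definition hitting :: "nat set list \<Rightarrow> nat set list \<Rightarrow> nat set set" where
  "hitting H Ls = {S \<in> indep H. \<forall>E\<in>set Ls. S \<inter> E \<noteq> {}}"

text \<open>The case \<open>E = E'\<close> of the last clause says that each later edge contains a
  joint. So the first later edge creates a vertex of degree three, while \<open>Ls = []\<close>
  describes a history before that time.\<close>

definition good :: "nat \<Rightarrow> nat \<Rightarrow> nat set list \<Rightarrow> nat set list \<Rightarrow> bool" where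
  "good n k H Ls \<longleftrightarrow> nice n k H \<and> set Ls \<subseteq> ksubsets n k \<and> (\<forall>E\<in>set Ls. exact H E)
     \<and> (\<forall>E\<in>set Ls. \<forall>E'\<in>set Ls. E \<inter> E' \<inter> joints H \<noteq> {})"

text \<open>Sets that meet all edges so far without following the exact pattern. Only a choice among
  these can end a good history.\<close>

definition rare :: "nat \<Rightarrow> nat \<Rightarrow> nat set list \<Rightarrow> nat set list \<Rightarrow> nat set set" where
  "rare n k H Ls = {A \<in> ksubsets n k. (\<forall>F\<in>set H \<union> set Ls. A \<inter> F \<noteq> {})
     \<and> \<not> (exact H A \<and> (\<forall>E\<in>set Ls. A \<inter> E \<inter> joints H \<noteq> {}))}"

text \<open>The constant of \<open>card_ksubsets_weight\<close> for
  \<open>y = h * h + l * h\<close>, \<open>z = h + l + 1\<close> and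
  \<open>m = h + 1\<close>.\<close>

definition rare_const :: "real \<Rightarrow> nat \<Rightarrow> nat \<Rightarrow> real" where
  "rare_const D h l = 2 ^ (h * h + l * h) * (real (h + 1) + 1) * real (h + l + 1) ^ (h + 1)
     * D ^ (h * h + l * h + (h + 1))"

lemma nth_subset_points: "i < length H \<Longrightarrow> H ! i \<subseteq> points H"
  by (rule Union_upper) simp

lemma points_conv_nth: "points H = (\<Union>i<length H. H ! i)"
  unfolding set_conv_nth by blast

lemma card_exact_points:
  assumes "finite A" "exact H A"
  shows "card (A \<inter> points H) \<le> length H"
proof -
  have "A \<inter> points H = (\<Union>i<length H. A \<inter> H ! i)" unfolding points_conv_nth by blast
  also have "card \<dots> \<le> (\<Sum>i<length H. card (A \<inter> H ! i))"
    by (rule card_UN_le) simp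
  also have "\<dots> = (\<Sum>i<length H. 1)" using assms by (intro sum.cong) (auto simp: exact_def)
  finally show ?thesis by simp
qed

text \<open>Points that hit \<open>h\<close> edges have total degree at least \<open>h\<close>, and
  weights dominate degrees. A rare set contains points of weight \<open>h + 1\<close>: either it
  meets an early edge twice, or it is exact and needs a point that is no joint in order to meet some
  later edge.\<close>

lemma card_rare:
  assumes good: "good n k H Ls" and kn: "1 \<le> k" "k \<le> n" and D: "1 \<le> D" "real k ^ 3 \<le> D * real n"
  shows "real (card (rare n k H Ls)) \<le> rare_const D (length H) (length Ls) * real (n choose k) / real k ^ (length H + 1)"
proof -
  define h l where "h = length H" and "l = length Ls"
  have nice: "nice n k H" and Ls: "set Ls \<subseteq> ksubsets n k" and ex: "\<And>E. E \<in> set Ls \<Longrightarrow> exact H E"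
    using good by (auto simp: good_def)
  \<comment> \<open>Besides the joints, the points where later edges meet early ones get weight 2.
    Exactness of the later edges keeps their number bounded.\<close>
  define Y where "Y = joints H \<union> (points Ls \<inter> points H)"
  define Z where "Z = (points H \<union> points Ls) - Y"
  have pts: "points H \<subseteq> {1..n}" "points Ls \<subseteq> {1..n}"
    using points_subset[OF nice_ksubsets[OF nice]] points_subset[OF Ls] by auto
  have fpts: "finite (points H)" "finite (points Ls)"
    using pts finite_subset[of _ "{1..n}"] by auto
  have Y1: "Y \<subseteq> {1..n}" using pts joints_subset[of H] by (auto simp: Y_def)
  have "card (points Ls \<inter> points H) \<le> l * h"
  proof -
    have "points Ls \<inter> points H = (\<Union>E\<in>set Ls. E \<inter> points H)" by auto
    also have "card \<dots> \<le> (\<Sum>E\<in>set Ls. card (E \<inter> points H))"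
      by (rule card_UN_le) simp
    also have "\<dots> \<le> (\<Sum>E\<in>set Ls. h)"
      using ex Ls card_exact_points ksubsetsD unfolding h_def by (intro sum_mono) blast
    also have "\<dots> \<le> l * h" by (simp add: l_def card_length)
    finally show ?thesis .
  qed
  then have Y2: "card Y \<le> h * h + l * h"
    using card_joints_le[OF nice] card_Un_le[of "joints H" "points Ls \<inter> points H"] by (simp add: Y_def h_def)
  have Z1: "Z \<subseteq> {1..n}" using pts by (auto simp: Z_def)
  have Z2: "card Z \<le> (h + l + 1) * k"
  proof -
    have "card Z \<le> card (points H \<union> points Ls)" using fpts by (intro card_mono) (auto simp: Z_def)
    also have "\<dots> \<le> h * k + l * k"
      using card_Un_le[of "points H" "points Ls"] card_points_le[OF nice_ksubsets[OF nice]]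
        card_points_le[OF Ls] by (simp add: h_def l_def)
    finally show ?thesis by (simp add: algebra_simps)
  qed
  define wt where "wt x = (if x \<in> Y then 2 else 1 :: nat)" for x
  have wt_sum: "2 * card (X \<inter> Y) + card (X \<inter> Z) = (\<Sum>x\<in>X. wt x)" if "finite X" "X \<subseteq> Y \<union> Z" for X
  proof -
    have "X \<inter> Z = X - Y" using that by (auto simp: Z_def)
    moreover have "(\<Sum>x\<in>X \<inter> Y. wt x) = 2 * card (X \<inter> Y)" "(\<Sum>x\<in>X - Y. wt x) = card (X - Y)"
      by (simp_all add: wt_def)
    ultimately show ?thesis using sum.Int_Diff[OF that(1), of wt Y] by simp
  qed
  have wt_deg: "deg H x \<le> wt x" for x
    using deg_joints[OF nice, of x] deg_le_1[of x H] by (cases "x \<in> joints H") (auto simp: wt_def Y_def)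
  have YZ: "Y \<union> Z = points H \<union> points Ls" using joints_subset[of H] by (auto simp: Y_def Z_def)
  have "\<exists>X \<subseteq> A. X \<subseteq> Y \<union> Z \<and> card X \<le> h + 1 \<and> 2 * card (X \<inter> Y) + card (X \<inter> Z) \<ge> h + 1"
    if A: "A \<in> rare n k H Ls" for A
  proof -
    have Ak: "finite A" using A ksubsetsD by (auto simp: rare_def)
    have hit: "A \<inter> H ! i \<noteq> {}" if "i < h" for i using A that by (auto simp: rare_def h_def)
    show ?thesis
    proof (cases "exact H A")
      case True
      then obtain E where E: "E \<in> set Ls" "A \<inter> E \<inter> joints H = {}" using A by (auto simp: rare_def)
      obtain x where x: "x \<in> A" "x \<in> E" using A E(1) by (auto simp: rare_def)
      have xJ: "x \<notin> joints H" using x E by auto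
      define X where "X = insert x (A \<inter> points H)"
      have fX: "finite X" using Ak by (simp add: X_def)
      have XYZ: "X \<subseteq> Y \<union> Z" unfolding YZ X_def using x E(1) by auto
      have "card X \<le> h + 1"
        using card_insert_le_m1[of "h + 1" "A \<inter> points H" x] card_exact_points[OF Ak True]
        by (simp add: X_def h_def)
      \<comment> \<open>Off the early edges \<open>x\<close> has degree 0 and weight at least 1; on
        them it has degree at most 1 but weight 2, because it also lies on a later edge.\<close>
      moreover have "deg H x + 1 \<le> wt x"
      proof (cases "x \<in> points H")
        case True
        then have "x \<in> Y" using x E by (auto simp: Y_def)
        then show ?thesis using deg_le_1[OF xJ] by (simp add: wt_def)
      qed (simp add: deg_eq_0 wt_def)
      then have "(\<Sum>y\<in>X. deg H y) + 1 \<le> (\<Sum>y\<in>X. wt y)"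
        using sum_mono[of "X - {x}" "deg H" wt, OF wt_deg] fX
        by (subst (1 2) sum.remove[of X x]) (auto simp: X_def)
      moreover have "(\<Sum>y\<in>X. deg H y) \<ge> h"
      proof -
        have "h = (\<Sum>i<length H. card (A \<inter> H ! i))" using True by (simp add: exact_def h_def)
        also have "\<dots> \<le> (\<Sum>i<length H. card (X \<inter> H ! i))"
          using fX nth_subset_points by (intro sum_mono card_mono) (fastforce simp: X_def)+
        finally show ?thesis unfolding sum_card_eq_sum_deg[OF fX] .
      qed
      moreover have "X \<subseteq> A" using x(1) by (auto simp: X_def)
      ultimately show ?thesis using wt_sum[OF fX XYZ] XYZ by (intro exI[of _ X]) simp
    next
      case False
      then obtain j where j: "j < h" "card (A \<inter> H ! j) \<noteq> 1" by (auto simp: exact_def h_def)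
      have "\<forall>i. \<exists>y. i < h \<longrightarrow> y \<in> A \<inter> H ! i" using hit by blast
      from choice[OF this] obtain f where f: "\<And>i. i < h \<Longrightarrow> f i \<in> A \<inter> H ! i" by blast
      have "\<exists>y. y \<in> A \<inter> H ! j \<and> y \<noteq> f j"
      proof (rule ccontr)
        assume "\<not> ?thesis"
        then have "A \<inter> H ! j = {f j}" using f[OF j(1)] by auto
        then show False using j(2) by simp
      qed
      then obtain y where y: "y \<in> A \<inter> H ! j" "y \<noteq> f j" by blast
      \<comment> \<open>One point from each early edge and a second one from edge \<open>j\<close>.
        A point may serve two edges, so degrees are summed rather than points counted.\<close>
      define X where "X = insert y (f ` {..<h})"
      have fX: "finite X" by (simp add: X_def)
      have XA: "X \<subseteq> A" using y f by (auto simp: X_def)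
      have "y \<in> points H" using y(1) nth_subset_points[of j H] j(1) unfolding h_def by blast
      moreover have "f i \<in> points H" if "i < h" for i
        using f[OF that] nth_subset_points[of i H] that unfolding h_def by blast
      ultimately have XYZ: "X \<subseteq> Y \<union> Z" unfolding YZ X_def by auto
      have "card X \<le> h + 1"
        using card_insert_le_m1[of "h + 1" "f ` {..<h}" y] card_image_le[of "{..<h}" f] by (simp add: X_def)
      moreover have "h + 1 \<le> (\<Sum>x\<in>X. deg H x)"
      proof -
        have c1: "1 \<le> card (X \<inter> H ! i)" if "i < h" for i
        proof -
          have "f i \<in> X \<inter> H ! i" using f[OF that] that by (auto simp: X_def)
          then have "card (X \<inter> H ! i) \<noteq> 0" using fX by auto
          then show ?thesis by simp
        qed
        have c2: "2 \<le> card (X \<inter> H ! j)"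
        proof -
          have "{y, f j} \<subseteq> X \<inter> H ! j" using f[OF j(1)] y j by (auto simp: X_def)
          from card_mono[OF _ this] show ?thesis using y(2) fX by simp
        qed
        have "h + 1 = (\<Sum>i<h. if i = j then 2 else 1)"
          using j(1) by (subst sum.remove[of _ j]) auto
        also have "\<dots> \<le> (\<Sum>i<h. card (X \<inter> H ! i))" using c1 c2 by (intro sum_mono) auto
        finally show ?thesis unfolding h_def sum_card_eq_sum_deg[OF fX] .
      qed
      moreover have "(\<Sum>x\<in>X. deg H x) \<le> (\<Sum>x\<in>X. wt x)" by (intro sum_mono wt_deg)
      ultimately show ?thesis using wt_sum[OF fX XYZ] XA XYZ by (intro exI[of _ X]) simp
    qed
  qed
  moreover have "rare n k H Ls \<subseteq> ksubsets n k" by (auto simp: rare_def)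
  ultimately show ?thesis
    using card_ksubsets_weight[OF kn D Y1 Y2 Z1 Z2, of "rare n k H Ls" "h + 1" "h + 1"]
    unfolding rare_const_def h_def[symmetric] l_def[symmetric] by (auto simp: Z_def)
qed

section \<open>Adding an edge to a nice family or to a good history\<close>

lemma hitting_subset: "hitting H Ls \<subseteq> indep H"
  by (auto simp: hitting_def)

text \<open>A joint of \<open>H\<close> in \<open>A\<close> would lie in three edges; conversely, a
  set without joints meets different edges in different points.\<close>

lemma nice_snoc:
  assumes nice: "nice n k H"
  shows "nice n k (H @ [A]) \<longleftrightarrow> A \<in> exact_sets n k H {}"
proof
  assume A: "A \<in> exact_sets n k H {}"
  have c: "card (A \<inter> H ! i) = 1" if "i < length H" for i using A that by (auto simp: exact_sets_def exact_def)
  have d: "A \<inter> H ! i \<inter> H ! j = {}" if "i < length H" "j < length H" "i \<noteq> j" for i j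
    using A that by (auto simp: exact_sets_def joints_def)
  show "nice n k (H @ [A])" unfolding nice_def
  proof (intro conjI allI impI)
    show "set (H @ [A]) \<subseteq> ksubsets n k" using nice_ksubsets[OF nice] A by (auto simp: exact_sets_def)
  next
    fix i j assume "i < length (H @ [A])" "j < length (H @ [A])" "i \<noteq> j"
    then show "card ((H @ [A]) ! i \<inter> (H @ [A]) ! j) = 1"
      using c nice_card_Int[OF nice] by (auto simp: nth_append Int_commute)
  next
    fix i j l assume "i < length (H @ [A])" "j < length (H @ [A])" "l < length (H @ [A])" "i \<noteq> j" "j \<noteq> l" "i \<noteq> l"
    then show "(H @ [A]) ! i \<inter> (H @ [A]) ! j \<inter> (H @ [A]) ! l = {}"
      using d nice_triple[OF nice, of i j l] by (auto simp: nth_append Int_ac)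
  qed
next
  assume A: "nice n k (H @ [A])"
  have "card (A \<inter> H ! i) = 1" if "i < length H" for i
    using nice_card_Int[OF A, of "length H" i] that by (simp add: nth_append)
  moreover have "A \<inter> joints H = {}"
  proof (rule ccontr)
    assume "A \<inter> joints H \<noteq> {}"
    then obtain x i j where "x \<in> A" "i < length H" "j < length H" "i \<noteq> j" "x \<in> H ! i" "x \<in> H ! j"
      by (auto simp: joints_def)
    then show False using nice_triple[OF A, of "length H" i j x] by (simp add: nth_append)
  qed
  moreover have "A \<in> ksubsets n k" using nice_ksubsets[OF A] by simp
  ultimately show "A \<in> exact_sets n k H {}" by (auto simp: exact_sets_def exact_def)
qed

lemma nice_take: "nice n k H \<Longrightarrow> nice n k (take i H)"
  unfolding nice_def by (auto dest: in_set_takeD)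

context
  fixes n k :: nat and H Ls :: "nat set list"
  assumes good: "good n k H Ls"
begin

lemma good_nice: "nice n k H"
  using good by (simp add: good_def)

lemma candidates_cases:
  assumes "A \<in> candidates n k (H @ Ls)"
  shows "A \<in> rare n k H Ls \<or> (A \<inter> joints H \<in> hitting H Ls \<and> A \<in> exact_sets n k H (A \<inter> joints H))"
proof (cases "exact H A \<and> (\<forall>E\<in>set Ls. A \<inter> E \<inter> joints H \<noteq> {})")
  case True
  then have "A \<inter> joints H \<in> hitting H Ls"
    using exact_joints_indep[OF good_nice] by (auto simp: hitting_def)
  then show ?thesis using True assms by (auto simp: candidates_def exact_sets_def)
qed (use assms in \<open>auto simp: candidates_def rare_def\<close>)

lemma exact_sets_hit:
  assumes "S \<in> hitting H Ls" "A \<in> exact_sets n k H S"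
  shows "\<forall>F\<in>set (H @ Ls). A \<inter> F \<noteq> {}"
proof
  fix F assume "F \<in> set (H @ Ls)"
  then consider i where "i < length H" "F = H ! i" | "F \<in> set Ls" by (auto simp: in_set_conv_nth)
  then show "A \<inter> F \<noteq> {}"
  proof cases
    case 1
    then have "card (A \<inter> F) = 1" using assms(2) by (simp add: exact_sets_def exact_def)
    then show ?thesis by auto
  next
    case 2
    then have "S \<inter> F \<noteq> {}" using assms(1) by (auto simp: hitting_def)
    then show ?thesis using assms(2) by (auto simp: exact_sets_def)
  qed
qed

lemma exact_sets_candidates:
  assumes "S \<in> hitting H Ls" "A \<in> exact_sets n k H S" "A \<notin> set (H @ Ls)"
  shows "A \<in> candidates n k (H @ Ls)"
  using exact_sets_hit[OF assms(1,2)] assms by (auto simp: candidates_def exact_sets_def)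

lemma good_snoc:
  assumes S: "S \<in> hitting H Ls" "A \<in> exact_sets n k H S" and "S \<noteq> {}"
  shows "good n k H (Ls @ [A])"
proof -
  have "A \<inter> E \<inter> joints H \<noteq> {}" if "E \<in> set Ls" for E
  proof -
    have "S \<inter> E \<noteq> {}" "S = A \<inter> joints H" using S that by (auto simp: exact_sets_def hitting_def)
    then show ?thesis by blast
  qed
  moreover have "A \<inter> A \<inter> joints H \<noteq> {}" using S assms(3) by (auto simp: exact_sets_def)
  ultimately show ?thesis using good S(2) unfolding good_def exact_sets_def
    by (auto simp: Int_commute Int_left_commute Int_assoc)
qed

lemma hitting_snoc: "hitting H (Ls @ [A]) \<subseteq> hitting H Ls"
  by (auto simp: hitting_def)

text \<open>All joints of \<open>A\<close> lie in \<open>S\<close>, so \<open>A\<close> misses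
  \<open>T\<close>, which is lost.\<close>

lemma hitting_snoc_strict:
  assumes S: "S \<in> hitting H Ls" "T \<in> hitting H Ls" "S \<inter> T = {}" and A: "A \<in> exact_sets n k H S"
  shows "hitting H (Ls @ [A]) \<subset> hitting H Ls"
proof -
  have "T \<inter> A = {}" using S A by (auto simp: hitting_def indep_def exact_sets_def)
  then have "T \<notin> hitting H (Ls @ [A])" by (auto simp: hitting_def)
  then show ?thesis using S(2) hitting_snoc by blast
qed

text \<open>Later edges pairwise meet in joints, so the joints of one of them meet them all. Hence
  the transversal family is never empty in a good history, and later edges can be tested against it
  through their own joints.\<close>

lemma edge_in_hitting:
  assumes E: "E \<in> set Ls"
  shows "E \<inter> joints H \<in> hitting H Ls"
proof -
  have "exact H E" using good E by (simp add: good_def)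
  moreover have "E \<inter> joints H \<inter> E' \<noteq> {}" if "E' \<in> set Ls" for E'
  proof -
    have "E \<inter> E' \<inter> joints H \<noteq> {}" using good E that by (simp add: good_def)
    then show ?thesis by blast
  qed
  ultimately show ?thesis using exact_joints_indep[OF good_nice] by (simp add: hitting_def)
qed

lemma finite_hitting: "finite (hitting H Ls)"
  using finite_subset[OF hitting_subset finite_indep[OF good_nice]] .

lemma hitting_nonempty: "hitting H Ls \<noteq> {}"
proof (cases Ls)
  case Nil
  then have "{} \<in> hitting H Ls" by (auto simp: hitting_def indep_def)
  then show ?thesis by blast
qed (use edge_in_hitting in auto)

lemma card_hitting_le: "card (hitting H Ls) \<le> 2 ^ (length H * length H)"
  using order_trans[OF card_mono[OF finite_indep[OF good_nice] hitting_subset] card_indep_family_le[OF good_nice]] .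

lemma good_take: "good n k H (take i Ls)"
  using good unfolding good_def by (auto dest!: in_set_takeD)

end

section \<open>The times and the final family of a history\<close>

lemma deg_snoc: "deg (H @ [E]) x = deg H x + (if x \<in> E then 1 else 0)"
proof -
  have "{i. i < length (H @ [E]) \<and> x \<in> (H @ [E]) ! i}
      = {i. i < length H \<and> x \<in> H ! i} \<union> (if x \<in> E then {length H} else {})"
    by (auto simp: nth_append less_Suc_eq)
  then show ?thesis by (simp add: deg_def card_insert_if)
qed

lemma nice_deg_le: "nice n k H \<Longrightarrow> deg H x \<le> 2"
  using deg_joints[of n k H x] deg_le_1[of x H] by (cases "x \<in> joints H") auto

lemma vertex_degree_eq_deg:
  assumes "r \<le> length Es"
  shows "vertex_degree Es r x = deg (take r Es) x"
proof -
  have "{i \<in> {1..r}. x \<in> edge Es i} = Suc ` {i. i < length (take r Es) \<and> x \<in> take r Es ! i}"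
  proof (intro set_eqI iffI)
    fix i assume "i \<in> {i \<in> {1..r}. x \<in> edge Es i}"
    then show "i \<in> Suc ` {i. i < length (take r Es) \<and> x \<in> take r Es ! i}"
      using assms by (cases i) (auto simp: edge_def)
  qed (use assms in \<open>auto simp: edge_def\<close>)
  then show ?thesis by (simp add: vertex_degree_def deg_def card_image)
qed

lemma prefix_family_eq:
  assumes "r \<le> length Es"
  shows "prefix_family Es r = set (take r Es)"
proof -
  have "prefix_family Es r = edge Es ` Suc ` {0..<r}"
    unfolding prefix_family_def image_Suc_atLeastLessThan by (simp add: atLeastLessThanSuc_atLeastAtMost)
  also have "\<dots> = (!) Es ` {0..<r}" unfolding image_image by (simp add: edge_def)
  also have "\<dots> = set (take r Es)" using assms by (rule nth_image)
  finally show ?thesis .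
qed

lemma set_drop_take:
  assumes "r \<le> length Es"
  shows "set (drop h (take r Es)) = edge Es ` {h + 1..r}"
proof (intro set_eqI iffI)
  fix E assume "E \<in> set (drop h (take r Es))"
  then obtain i where "i < r - h" "E = Es ! (h + i)"
    using assms by (auto simp: in_set_conv_nth)
  then show "E \<in> edge Es ` {h + 1..r}"
    by (intro image_eqI[of _ _ "h + i + 1"]) (auto simp: edge_def)
next
  fix E assume "E \<in> edge Es ` {h + 1..r}"
  then obtain i where i: "h + 1 \<le> i" "i \<le> r" "E = Es ! (i - 1)" by (auto simp: edge_def)
  then have "E = drop h (take r Es) ! (i - 1 - h)" "i - 1 - h < length (drop h (take r Es))"
    using assms by auto
  then show "E \<in> set (drop h (take r Es))" by (metis nth_mem)
qed

text \<open>Prefixes of a nice list are nice, and in a nice list no degree exceeds two.\<close>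

lemma time0_greater:
  assumes "nice n k (take r Es)" "r \<le> length Es"
  shows "time0 Es > enat r"
proof -
  have "enat (Suc r) \<le> time0 Es" unfolding time0_def
  proof (rule Inf_greatest, clarify)
    fix r' x assume r': "r' \<le> length Es" "vertex_degree Es r' x = 3"
    show "enat (Suc r) \<le> enat r'"
    proof (rule ccontr)
      assume "\<not> ?thesis"
      then have "r' \<le> r" by simp
      then have "take r' Es = take r' (take r Es)" by (simp add: min_def)
      then have "nice n k (take r' Es)" using nice_take[OF assms(1)] by metis
      then show False using nice_deg_le[of n k "take r' Es" x] vertex_degree_eq_deg[OF r'(1)] r'(2) by simp
    qed
  qed
  then show ?thesis by (meson Suc_ile_eq)
qed

lemma time0_le_time1: "time0 Es \<le> time1 Es"
  unfolding time1_def by (rule Inf_greatest) auto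

context
  fixes n k :: nat and H Ls Fs Es :: "nat set list"
  assumes good: "good n k H Ls" and Ls: "Ls \<noteq> []" and Es: "Es = H @ Ls @ Fs"
begin

lemma time0_good: "time0 Es = enat (length H + 1)"
proof -
  have nice: "nice n k H" using good by (rule good_nice)
  obtain E Ls' where E: "Ls = E # Ls'" using Ls by (cases Ls) auto
  \<comment> \<open>The last clause of \<open>good\<close>, applied to \<open>E\<close> twice,
    provides a joint in the first later edge; it thereby reaches degree three.\<close>
  then have "E \<inter> E \<inter> joints H \<noteq> {}" using good by (auto simp: good_def)
  then obtain x where x: "x \<in> E" "x \<in> joints H" by auto
  have tk: "take (length H + 1) Es = H @ [E]" by (simp add: Es E)
  have "vertex_degree Es (length H + 1) x = 3"
    using vertex_degree_eq_deg[of "length H + 1" Es x] deg_snoc[of H E x] deg_joints[OF nice x(2)] x(1)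
    unfolding tk by (simp add: Es E)
  then have "time0 Es \<le> enat (length H + 1)"
    unfolding time0_def by (intro Inf_lower) (auto simp: Es E)
  moreover have "time0 Es > enat (length H)"
    using time0_greater[of n k "length H" Es] nice by (simp add: Es)
  then have "enat (length H + 1) \<le> time0 Es" by (simp add: Suc_ile_eq)
  ultimately show ?thesis by (rule antisym)
qed

lemma before0_good: "before0 Es = length H"
  by (simp add: before0_def time0_good)

lemma early_family_good: "early_family Es = set H"
  unfolding early_family_def before0_good using prefix_family_eq[of "length H" Es] by (simp add: Es)

lemma degree_two_good: "degree_two Es = joints H"
proof -
  have "vertex_degree Es (length H) x = deg H x" for x
    using vertex_degree_eq_deg[of "length H" Es x] by (simp add: Es)
  moreover have "deg H x = 2 \<longleftrightarrow> x \<in> joints H" for x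
    using deg_joints[OF good_nice[OF good], of x] deg_le_1[of x H] by (cases "x \<in> joints H") auto
  ultimately show ?thesis by (simp add: degree_two_def before0_good)
qed

lemma independent_set_good: "independent_set Es S \<longleftrightarrow> S \<in> indep H"
  unfolding independent_set_def degree_two_good early_family_good indep_def
  by (simp add: all_set_conv_all_nth)

lemma transversals_good:
  assumes "r \<le> length Es"
  shows "transversals Es r = hitting H (drop (length H) (take r Es))"
  unfolding transversals_def hitting_def independent_set_good time0_good set_drop_take[OF assms]
  by simp

text \<open>\<open>r_1\<close> may come before the end of \<open>Ls\<close>, but no transversal is
  lost in between: the joints of any edge of \<open>Ls\<close> form a transversal at time
  \<open>r_1\<close>, so they meet all members of the family, which is intersecting by then.\<close>

lemma time1_good:
  assumes "intersecting (hitting H Ls)"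
  shows "time1 Es \<le> enat (length H + length Ls)" "final_transversals Es = hitting H Ls"
proof -
  define T where "T = {enat r |r. r \<le> length Es \<and> time0 Es \<le> enat r \<and> intersecting (transversals Es r)}"
  define r where "r = length H + length Ls"
  have rE: "r \<le> length Es" by (simp add: r_def Es)
  have "transversals Es r = hitting H Ls"
    unfolding transversals_good[OF rE] by (simp add: r_def Es)
  then have rT: "enat r \<in> T"
    using assms rE Ls by (auto simp: T_def time0_good r_def Suc_le_eq)
  have time1: "time1 Es = Inf T" by (simp add: time1_def T_def)
  show "time1 Es \<le> enat (length H + length Ls)"
    unfolding time1 using rT by (auto simp: r_def intro: Inf_lower)
  have "Inf T \<in> T" using rT LeastI[of "\<lambda>x. x \<in> T"] by (auto simp: Inf_enat_def)
  then obtain r1 where r1: "Inf T = enat r1" "r1 \<le> length Es" "time0 Es \<le> enat r1" "intersecting (transversals Es r1)"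
    by (auto simp: T_def)
  have "r1 \<le> r" using Inf_lower[OF rT] r1(1) by simp
  moreover have "length H \<le> r1" using r1(3) by (simp add: time0_good)
  ultimately have tk: "drop (length H) (take r1 Es) = take (r1 - length H) Ls"
    by (simp add: Es r_def min_absorb1)
  have tr: "transversals Es r1 = hitting H (take (r1 - length H) Ls)"
    unfolding transversals_good[OF r1(2)] tk ..
  have sub: "hitting H Ls \<subseteq> hitting H (take (r1 - length H) Ls)"
    unfolding hitting_def using set_take_subset[of "r1 - length H" Ls] by blast
  have "S \<in> hitting H Ls" if S: "S \<in> hitting H (take (r1 - length H) Ls)" for S
  proof -
    have "S \<inter> E \<noteq> {}" if "E \<in> set Ls" for E
    proof -
      have "E \<inter> joints H \<in> transversals Es r1"
        unfolding tr using edge_in_hitting[OF good that] sub by (rule subsetD[rotated])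
      then have "S \<inter> (E \<inter> joints H) \<noteq> {}" using r1(4) S unfolding tr intersecting_def by simp
      then show ?thesis by blast
    qed
    then show ?thesis using S by (auto simp: hitting_def)
  qed
  then have "transversals Es r1 = hitting H Ls" unfolding tr by (intro antisym sub subsetI)
  then show "final_transversals Es = hitting H Ls"
    unfolding final_transversals_def time1 r1(1) by simp
qed

context
  assumes int: "intersecting (hitting H Ls)" and k2: "2 \<le> k"
begin

lemma upper_family_subset:
  "upper_family n k Es \<subseteq> rare n k H Ls \<union> (\<Union>S\<in>hitting H Ls. exact_sets n k H S)"
proof
  fix E assume E: "E \<in> upper_family n k Es"
  have nice: "nice n k H" using good by (rule good_nice)
  show "E \<in> rare n k H Ls \<union> (\<Union>S\<in>hitting H Ls. exact_sets n k H S)"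
  proof (cases "E \<in> set H")
    case True
    then obtain i where i: "i < length H" "E = H ! i" by (metis in_set_conv_nth)
    have Ek: "E \<in> ksubsets n k" using i nice_nth[OF nice] by simp
    \<comment> \<open>Early edges belong to the upper family as well. They meet themselves in
      \<open>k \<ge> 2\<close> points, so they are inexact and count as rare.\<close>
    have "card (E \<inter> H ! i) = k" using ksubsetsD[OF Ek] i by simp
    then have "\<not> exact H E" using i(1) k2 by (force simp: exact_def)
    moreover have "E \<inter> F \<noteq> {}" if "F \<in> set H" for F
    proof -
      obtain j where "j < length H" "F = H ! j" using \<open>F \<in> set H\<close> by (metis in_set_conv_nth)
      then have "card (E \<inter> F) \<noteq> 0"
        using nice_card_Int[OF nice i(1)] i \<open>card (E \<inter> H ! i) = k\<close> k2 by (cases "i = j") auto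
      then show ?thesis by auto
    qed
    moreover have "E \<inter> F \<noteq> {}" if "F \<in> set Ls" for F
    proof -
      have "card (F \<inter> E) = 1" using good that i by (simp add: good_def exact_def)
      then show ?thesis by (auto simp: Int_commute)
    qed
    ultimately show ?thesis using Ek by (auto simp: rare_def)
  next
    case False
    then have E': "E \<in> ksubsets n k" "\<And>S. S \<in> hitting H Ls \<Longrightarrow> E \<inter> S \<noteq> {}" "\<And>F. F \<in> set H \<Longrightarrow> E \<inter> F \<noteq> {}"
      using E unfolding upper_family_def early_family_good time1_good(2)[OF int] by auto
    have L: "E \<inter> F \<inter> joints H \<noteq> {}" if "F \<in> set Ls" for F
      using E'(2)[OF edge_in_hitting[OF good that]] by blast
    show ?thesis
    proof (cases "exact H E")
      case True
      then have "E \<inter> joints H \<in> hitting H Ls"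
        using exact_joints_indep[OF nice True] L unfolding hitting_def by blast
      moreover have "E \<in> exact_sets n k H (E \<inter> joints H)" using E'(1) True by (simp add: exact_sets_def)
      ultimately show ?thesis by blast
    next
      case False
      then have "E \<in> rare n k H Ls" using E'(1,3) L unfolding rare_def by blast
      then show ?thesis by blast
    qed
  qed
qed

lemma lower_family_superset: "(\<Union>S\<in>hitting H Ls. exact_sets n k H S) \<subseteq> lower_family n k Es"
proof
  fix E assume "E \<in> (\<Union>S\<in>hitting H Ls. exact_sets n k H S)"
  then obtain S where S: "S \<in> hitting H Ls" "E \<in> exact_sets n k H S" by blast
  have "\<forall>F\<in>set H. E \<inter> F \<noteq> {}" using exact_sets_hit[OF good S] by simp
  moreover have "S \<subseteq> E" "E \<in> ksubsets n k" using S(2) by (auto simp: exact_sets_def)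
  ultimately show "E \<in> lower_family n k Es"
    unfolding lower_family_def early_family_good time1_good(2)[OF int] using S(1) by blast
qed

text \<open>A set of the lower family that is not early contains a transversal, and every chosen
  edge is early or meets this transversal. So the set remains available until it is chosen, and the
  process cannot stop before.\<close>

lemma final_family_between:
  assumes Fs: "set Fs \<subseteq> candidates n k (H @ Ls)" "\<And>A S. A \<in> set Fs \<Longrightarrow> S \<in> hitting H Ls \<Longrightarrow> A \<inter> S \<noteq> {}"
    and stop: "candidates n k Es = {}"
  shows "lower_family n k Es \<subseteq> set Es" "set Es \<subseteq> upper_family n k Es"
proof -
  note defs = early_family_good time1_good(2)[OF int]
  show upper: "set Es \<subseteq> upper_family n k Es"
  proof
    fix E assume "E \<in> set Es"
    then consider "E \<in> set H" | "E \<in> set Ls" | "E \<in> set Fs" by (auto simp: Es)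
    then show "E \<in> upper_family n k Es"
    proof cases
      case 1
      then show ?thesis by (simp add: upper_family_def defs)
    next
      case 2
      then have ES: "E \<inter> joints H \<in> hitting H Ls" using edge_in_hitting[OF good] by blast
      have "E \<inter> S \<noteq> {}" if "S \<in> hitting H Ls" for S
      proof -
        have "(E \<inter> joints H) \<inter> S \<noteq> {}" using int ES that by (simp add: intersecting_def)
        then show ?thesis by blast
      qed
      moreover have "E \<in> exact_sets n k H (E \<inter> joints H)"
        using good 2 by (simp add: good_def exact_sets_def subset_iff)
      then have "\<forall>F\<in>set H. E \<inter> F \<noteq> {}" using exact_sets_hit[OF good ES] by simp
      moreover have "E \<in> ksubsets n k" using good 2 by (auto simp: good_def)
      ultimately show ?thesis by (simp add: upper_family_def defs)
    next
      case 3
      then have "E \<in> candidates n k (H @ Ls)" using Fs(1) by blast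
      then show ?thesis using Fs(2)[OF 3] by (simp add: upper_family_def defs candidates_def)
    qed
  qed
  show "lower_family n k Es \<subseteq> set Es"
  proof
    fix E assume E: "E \<in> lower_family n k Es"
    show "E \<in> set Es"
    proof (rule ccontr)
      assume nin: "E \<notin> set Es"
      then obtain S where S: "E \<in> ksubsets n k" "S \<in> hitting H Ls" "S \<subseteq> E" "\<forall>F\<in>set H. E \<inter> F \<noteq> {}"
        using E unfolding lower_family_def defs by (auto simp: Es)
      have "E \<inter> F \<noteq> {}" if "F \<in> set Es" for F
      proof (cases "F \<in> set H")
        case False
        then have "F \<inter> S \<noteq> {}" using upper that S(2) unfolding upper_family_def defs by blast
        then show ?thesis using S(3) by blast
      qed (use S in blast)
      then have "E \<in> candidates n k Es" using S(1) nin by (simp add: candidates_def)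
      then show False using stop by simp
    qed
  qed
qed

end

end

lemma card_UN_exact_sets:
  assumes "nice n k H" "SS \<subseteq> indep H"
  shows "card (\<Union>S\<in>SS. exact_sets n k H S) = (\<Sum>S\<in>SS. card (exact_sets n k H S))"
  using finite_subset[OF assms(2) finite_indep[OF assms(1)]] finite_ksubsets
  by (intro card_UN_disjoint) (auto simp: exact_sets_def)

section \<open>Running the process\<close>

text \<open>The process from an arbitrary history, so that it can be cut at a fixed time.\<close>

definition run :: "nat \<Rightarrow> nat \<Rightarrow> nat \<Rightarrow> nat set list \<Rightarrow> nat set list pmf" where
  "run n k i Es = ((\<lambda>M. bind_pmf M (next_edge n k)) ^^ i) (return_pmf Es)"

lemma run_0: "run n k 0 Es = return_pmf Es"
  by (simp add: run_def)

lemma run_Suc: "run n k (Suc i) Es = bind_pmf (run n k i Es) (next_edge n k)"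
  by (simp add: run_def)

lemma run_add: "run n k (i + j) Es = bind_pmf (run n k i Es) (run n k j)"
proof (induction j)
  case 0
  have "run n k 0 = return_pmf" by (simp add: run_0 fun_eq_iff)
  then show ?case by (simp add: bind_return_pmf')
next
  case (Suc j)
  have "run n k (Suc j) = (\<lambda>Es. bind_pmf (run n k j Es) (next_edge n k))"
    by (simp add: run_Suc fun_eq_iff)
  then show ?case using Suc by (simp add: run_Suc bind_assoc_pmf)
qed

lemma run_Suc_first: "run n k (Suc j) Es = bind_pmf (next_edge n k Es) (run n k j)"
  using run_add[of n k 1 j Es] run_Suc[of n k 0 Es] by (simp add: run_0 bind_return_pmf)

lemma intersecting_process_eq_run: "intersecting_process n k = run n k (n choose k) []"
  by (simp add: intersecting_process_def run_def)

lemma set_pmf_next_edge: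
  "set_pmf (next_edge n k Es)
    = (if candidates n k Es = {} then {Es} else (\<lambda>A. Es @ [A]) ` candidates n k Es)"
  by (simp add: next_edge_def finite_candidates)

lemma candidates_append: "candidates n k (Es @ Fs) \<subseteq> candidates n k Es"
  by (auto simp: candidates_def)

lemma run_extends:
  assumes "Es' \<in> set_pmf (run n k i Es)"
  shows "\<exists>Fs. Es' = Es @ Fs \<and> set Fs \<subseteq> candidates n k Es"
  using assms
proof (induction i arbitrary: Es')
  case (Suc i)
  then obtain Gs where Gs: "Gs \<in> set_pmf (run n k i Es)" "Es' \<in> set_pmf (next_edge n k Gs)"
    by (auto simp: run_Suc)
  from Suc.IH[OF Gs(1)] obtain Fs where Fs: "Gs = Es @ Fs" "set Fs \<subseteq> candidates n k Es" by blast
  show ?case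
  proof (cases "candidates n k Gs = {}")
    case False
    then obtain A where A: "A \<in> candidates n k Gs" "Es' = Gs @ [A]"
      using Gs(2) by (auto simp: set_pmf_next_edge)
    then have "A \<in> candidates n k Es" using candidates_append Fs(1) by blast
    then show ?thesis using A(2) Fs by simp
  qed (use Fs Gs(2) in \<open>simp add: set_pmf_next_edge\<close>)
qed (simp add: run_0)

lemma run_stopped: "candidates n k Es = {} \<Longrightarrow> run n k i Es = return_pmf Es"
  by (induction i) (simp_all add: run_0 run_Suc bind_return_pmf next_edge_def)

lemma run_length:
  assumes "Es \<in> set_pmf (run n k i [])"
  shows "length Es \<le> i" "length Es = i \<or> candidates n k Es = {}"
proof -
  show "length Es = i \<or> candidates n k Es = {}"
    using process_invariant[OF assms[unfolded run_def]] by blast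
  show "length Es \<le> i" using assms
  proof (induction i arbitrary: Es)
    case (Suc i)
    then obtain Gs where Gs: "Gs \<in> set_pmf (run n k i [])" "Es \<in> set_pmf (next_edge n k Gs)"
      by (auto simp: run_Suc)
    then show ?case using Suc.IH[OF Gs(1)] by (auto simp: set_pmf_next_edge split: if_splits)
  qed (simp add: run_0)
qed

text \<open>Histories grow at the end only, and one with fewer than \<open>i\<close> edges after
  \<open>i\<close> rounds has stopped, so that further rounds do not change it.\<close>

lemma map_take_run:
  assumes "i \<le> N"
  shows "map_pmf (take i) (run n k N []) = run n k i []"
proof -
  have "map_pmf (take i) (run n k N []) = bind_pmf (run n k i []) (\<lambda>Es. map_pmf (take i) (run n k (N - i) Es))"
    using run_add[of n k i "N - i" "[]"] assms by (simp add: map_bind_pmf)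
  also have "\<dots> = bind_pmf (run n k i []) return_pmf"
  proof (intro bind_pmf_cong refl)
    fix Es assume Es: "Es \<in> set_pmf (run n k i [])"
    show "map_pmf (take i) (run n k (N - i) Es) = return_pmf Es"
    proof (cases "candidates n k Es = {}")
      case True
      then show ?thesis using run_length(1)[OF Es] by (simp add: run_stopped)
    next
      case False
      then have "length Es = i" using run_length(2)[OF Es] by blast
      then have "map_pmf (take i) (run n k (N - i) Es) = map_pmf (\<lambda>_. Es) (run n k (N - i) Es)"
        by (intro map_pmf_cong refl) (auto dest: run_extends)
      then show ?thesis by (simp add: map_pmf_const)
    qed
  qed
  finally show ?thesis by (simp add: bind_return_pmf')
qed

lemma prob_process_take:
  assumes "i \<le> n choose k"
  shows "measure_pmf.prob (intersecting_process n k) {Es. Q (take i Es)} = measure_pmf.prob (run n k i []) {Es. Q Es}"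
  using map_take_run[OF assms, of n k] measure_map_pmf[of "take i" "run n k (n choose k) []" "{Es. Q Es}"]
  by (simp add: intersecting_process_eq_run vimage_def)

section \<open>Integrals over mixtures of distributions\<close>

lemma integral_pmf_bounded:
  fixes f :: "'a \<Rightarrow> real"
  assumes "\<And>x. \<bar>f x\<bar> \<le> B"
  shows "integrable (measure_pmf M) f"
  using assms by (intro measure_pmf.integrable_const_bound[of _ B]) auto

lemma prob_bind_pmf:
  "measure_pmf.prob (bind_pmf M f) A = (\<integral>x. measure_pmf.prob (f x) A \<partial>measure_pmf M)"
proof -
  have i: "integrable (measure_pmf M) (\<lambda>x. measure_pmf.prob (f x) A)"
    by (rule integral_pmf_bounded[of _ 1]) simp
  have "ennreal (measure_pmf.prob (bind_pmf M f) A) = (\<integral>\<^sup>+x. ennreal (measure_pmf.prob (f x) A) \<partial>measure_pmf M)"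
    by (simp add: measure_pmf.emeasure_eq_measure[symmetric])
  also have "\<dots> = ennreal (\<integral>x. measure_pmf.prob (f x) A \<partial>measure_pmf M)"
    using i by (intro nn_integral_eq_integral) auto
  finally show ?thesis by (simp add: integral_nonneg_AE)
qed

lemma integral_prob_indicator:
  "(\<integral>x. indicator {x. P x} x \<partial>measure_pmf M) = measure_pmf.prob M {x. P x}"
  by simp

text \<open>Used for one step of the process: a failure either is already present, where 1 bounds
  its probability, or occurs in this step.\<close>

lemma prob_bind_pmf_le:
  fixes e :: real
  assumes "\<And>x. x \<in> set_pmf M \<Longrightarrow> P x \<Longrightarrow> measure_pmf.prob (f x) A \<le> e" "0 \<le> e"
  shows "measure_pmf.prob (bind_pmf M f) A \<le> measure_pmf.prob M {x. \<not> P x} + e"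
proof -
  have "measure_pmf.prob (bind_pmf M f) A \<le> (\<integral>x. indicator {x. \<not> P x} x + e \<partial>measure_pmf M)"
    unfolding prob_bind_pmf
  proof (intro integral_mono_AE)
    show "AE x in measure_pmf M. measure_pmf.prob (f x) A \<le> indicator {x. \<not> P x} x + e"
      using assms by (auto intro!: AE_pmfI simp: indicator_def intro: order_trans[OF measure_pmf.prob_le_1])
    show "integrable (measure_pmf M) (\<lambda>x. measure_pmf.prob (f x) A)"
      by (rule integral_pmf_bounded[of _ 1]) simp
    show "integrable (measure_pmf M) (\<lambda>x. indicator {x. \<not> P x} x + e)"
      using assms(2) by (intro integral_pmf_bounded[of _ "1 + e"]) (auto simp: indicator_def)
  qed
  also have "\<dots> = measure_pmf.prob M {x. \<not> P x} + e"
    by (subst Bochner_Integration.integral_add) (auto intro!: integral_pmf_bounded[of _ 1] simp: indicator_def)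
  finally show ?thesis .
qed

text \<open>Multiplies the probability of \<open>P\<close> by a limiting one-step probability
  \<open>z\<close>. The error does not depend on \<open>M\<close>, because the event is impossible
  outside \<open>P\<close>.\<close>

lemma prob_bind_pmf_approx:
  fixes e :: real
  assumes "\<And>x. x \<in> set_pmf M \<Longrightarrow> P x \<Longrightarrow> \<bar>measure_pmf.prob (f x) A - z\<bar> \<le> e"
    and "\<And>x. x \<in> set_pmf M \<Longrightarrow> \<not> P x \<Longrightarrow> measure_pmf.prob (f x) A = 0" and "0 \<le> e"
  shows "\<bar>measure_pmf.prob (bind_pmf M f) A - measure_pmf.prob M {x. P x} * z\<bar> \<le> e"
proof -
  have i1: "integrable (measure_pmf M) (\<lambda>x. measure_pmf.prob (f x) A)"
    by (rule integral_pmf_bounded[of _ 1]) simp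
  have i2: "integrable (measure_pmf M) (\<lambda>x. indicator {x. P x} x * z)"
    by (rule integral_pmf_bounded[of _ "\<bar>z\<bar>"]) (simp add: indicator_def)
  have eq: "measure_pmf.prob (bind_pmf M f) A - measure_pmf.prob M {x. P x} * z
     = (\<integral>x. measure_pmf.prob (f x) A - indicator {x. P x} x * z \<partial>measure_pmf M)"
    unfolding prob_bind_pmf using i1 i2 by (subst Bochner_Integration.integral_diff) auto
  have "\<bar>\<integral>x. measure_pmf.prob (f x) A - indicator {x. P x} x * z \<partial>measure_pmf M\<bar>
      \<le> (\<integral>x. \<bar>measure_pmf.prob (f x) A - indicator {x. P x} x * z\<bar> \<partial>measure_pmf M)"
    by (rule integral_abs_bound)
  also have "\<dots> \<le> (\<integral>x. e \<partial>measure_pmf M)"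
  proof (intro integral_mono_AE)
    show "AE x in measure_pmf M. \<bar>measure_pmf.prob (f x) A - indicator {x. P x} x * z\<bar> \<le> e"
      using assms by (auto intro!: AE_pmfI simp: indicator_def)
  qed (use i1 i2 in auto)
  finally show ?thesis unfolding eq by simp
qed

text \<open>The tower rule; the bounds on \<open>V\<close> and \<open>W\<close> supply
  integrability.\<close>

lemma integral_bind_pmf_le:
  fixes V :: "'b \<Rightarrow> real"
  assumes V: "\<And>x. 0 \<le> V x" "\<And>x. V x \<le> B" and "\<And>x. x \<in> set_pmf M \<Longrightarrow> (\<integral>y. V y \<partial>measure_pmf (f x)) \<le> W x"
    and W: "\<And>x. \<bar>W x\<bar> \<le> C"
  shows "(\<integral>y. V y \<partial>measure_pmf (bind_pmf M f)) \<le> (\<integral>x. W x \<partial>measure_pmf M)"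
proof -
  have iV: "integrable (measure_pmf N) V" for N
    using V by (intro integral_pmf_bounded[of _ B]) (simp add: abs_of_nonneg)
  have b: "\<bar>\<integral>y. V y \<partial>measure_pmf (f x)\<bar> \<le> B" for x
  proof -
    have "(\<integral>y. V y \<partial>measure_pmf (f x)) \<le> (\<integral>y. B \<partial>measure_pmf (f x))"
      using iV V by (intro integral_mono) auto
    then show ?thesis using V(1) by (simp add: abs_of_nonneg)
  qed
  have "ennreal (\<integral>y. V y \<partial>measure_pmf (bind_pmf M f)) = (\<integral>\<^sup>+y. ennreal (V y) \<partial>measure_pmf (bind_pmf M f))"
    using iV V(1) by (subst nn_integral_eq_integral) auto
  also have "\<dots> = (\<integral>\<^sup>+x. \<integral>\<^sup>+y. ennreal (V y) \<partial>measure_pmf (f x) \<partial>measure_pmf M)" by simp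
  also have "\<dots> = (\<integral>\<^sup>+x. ennreal (\<integral>y. V y \<partial>measure_pmf (f x)) \<partial>measure_pmf M)"
    using iV V(1) by (subst nn_integral_eq_integral) auto
  also have "\<dots> = ennreal (\<integral>x. (\<integral>y. V y \<partial>measure_pmf (f x)) \<partial>measure_pmf M)"
    using b V(1) by (intro nn_integral_eq_integral integral_pmf_bounded[of _ B]) auto
  finally have "(\<integral>y. V y \<partial>measure_pmf (bind_pmf M f)) = (\<integral>x. (\<integral>y. V y \<partial>measure_pmf (f x)) \<partial>measure_pmf M)"
    using V(1) by (simp add: integral_nonneg_AE)
  also have "\<dots> \<le> (\<integral>x. W x \<partial>measure_pmf M)"
    using assms(3) W b by (intro integral_mono_AE AE_pmfI integral_pmf_bounded[of _ C] integral_pmf_bounded[of _ B]) auto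
  finally show ?thesis .
qed

lemma prob_next_edge:
  assumes "candidates n k Es \<noteq> {}"
  shows "measure_pmf.prob (next_edge n k Es) {x. Q x}
    = real (card {A \<in> candidates n k Es. Q (Es @ [A])}) / real (card (candidates n k Es))"
proof -
  have "candidates n k Es \<inter> (\<lambda>A. Es @ [A]) -` {x. Q x} = {A \<in> candidates n k Es. Q (Es @ [A])}" by auto
  then show ?thesis using assms by (simp add: next_edge_def measure_pmf_of_set finite_candidates)
qed

text \<open>
  A bad set is the first one chosen only if it precedes, in the order of choice, all those members
  of \<open>L\<close> that are disjoint from it, since any of them would have blocked it.
\<close>

lemma prob_run_bad_le:
  assumes disj: "L \<inter> B = {}" and LE: "L \<subseteq> ksubsets n k" "\<And>A E. A \<in> L \<Longrightarrow> E \<in> set Es \<Longrightarrow> A \<inter> E \<noteq> {}"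
    and LC: "\<And>A E. A \<in> L \<Longrightarrow> E \<in> candidates n k Es \<Longrightarrow> E \<notin> B \<Longrightarrow> A \<inter> E \<noteq> {}"
    and B: "B \<inter> set Es = {}"
  shows "measure_pmf.prob (run n k N Es) {Es'. set Es' \<inter> B \<noteq> {}}
    \<le> (\<Sum>E\<in>B \<inter> candidates n k Es. 1 / (1 + real (card {A \<in> L - set Es. A \<inter> E = {}})))"
  using LE(2) LC B
proof (induction N arbitrary: Es)
  case 0
  then show ?case by (auto simp: run_0 indicator_def Int_commute intro!: sum_nonneg)
next
  case (Suc N)
  define C where "C = candidates n k Es"
  define d where "d Gs E = card {A \<in> L - set Gs. A \<inter> E = {}}" for Gs E
  define T where "T E = 1 / (1 + real (d Es E))" for E
  define Q where "Q Es' = (set Es' \<inter> B \<noteq> {})" for Es'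
  have fC: "finite C" by (simp add: C_def finite_candidates)
  have fL: "finite L" using LE(1) finite_ksubsets finite_subset by blast
  have T0: "0 \<le> T E" for E by (simp add: T_def)
  show ?case
  proof (cases "B \<inter> C = {}")
    case True
    have "Es' \<notin> {Es'. Q Es'}" if Es': "Es' \<in> set_pmf (run n k (Suc N) Es)" for Es'
    proof -
      obtain Fs where "Es' = Es @ Fs" "set Fs \<subseteq> C" using run_extends[OF Es'] by (auto simp: C_def)
      then show ?thesis using True Suc.prems(3) by (auto simp: Q_def)
    qed
    then have "set_pmf (run n k (Suc N) Es) \<inter> {Es'. Q Es'} = {}" by blast
    then have "measure_pmf.prob (run n k (Suc N) Es) {Es'. Q Es'} = 0"
      by (simp add: measure_pmf_zero_iff)
    then show ?thesis using T0 True by (simp add: Q_def C_def)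
  next
    case False
    then have C: "C \<noteq> {}" by blast
    \<comment> \<open>A bad choice is estimated by 1. Any other choice \<open>A\<close> eliminates
      the bad sets disjoint from it, whose terms therefore vanish.\<close>
    have one: "measure_pmf.prob (run n k N (Es @ [A])) {Es'. Q Es'}
        \<le> (if A \<in> B then 1 else \<Sum>E\<in>B \<inter> C. if A \<inter> E = {} then 0 else T E)" if A: "A \<in> C" for A
    proof (cases "A \<in> B")
      case False
      have AL: "A' \<inter> A \<noteq> {}" if "A' \<in> L" for A' using Suc.prems(2)[OF that] A False by (simp add: C_def)
      have "measure_pmf.prob (run n k N (Es @ [A])) {Es'. Q Es'}
        \<le> (\<Sum>E\<in>B \<inter> candidates n k (Es @ [A]). 1 / (1 + real (d (Es @ [A]) E)))"
        unfolding d_def Q_def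
      proof (rule Suc.IH)
        show "A' \<inter> E \<noteq> {}" if "A' \<in> L" "E \<in> set (Es @ [A])" for A' E
          using Suc.prems(1)[OF that(1)] AL[OF that(1)] that(2) by auto
        show "A' \<inter> E \<noteq> {}" if "A' \<in> L" "E \<in> candidates n k (Es @ [A])" "E \<notin> B" for A' E
          using Suc.prems(2)[OF that(1) _ that(3)] candidates_append that(2) by blast
        show "B \<inter> set (Es @ [A]) = {}" using Suc.prems(3) False by simp
      qed
      also have "\<dots> = (\<Sum>E\<in>B \<inter> candidates n k (Es @ [A]). if A \<inter> E = {} then 0 else T E)"
      proof (intro sum.cong refl)
        fix E assume "E \<in> B \<inter> candidates n k (Es @ [A])"
        then have AE: "A \<inter> E \<noteq> {}" by (auto simp: candidates_def)
        \<comment> \<open>The blockers of \<open>E\<close> are disjoint from \<open>E\<close>,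
          whereas \<open>A\<close> meets it. So \<open>A\<close> is none of them and their number
          stays the same.\<close>
        then have "{A' \<in> L - set (Es @ [A]). A' \<inter> E = {}} = {A' \<in> L - set Es. A' \<inter> E = {}}" by auto
        then show "1 / (1 + real (d (Es @ [A]) E)) = (if A \<inter> E = {} then 0 else T E)"
          using AE by (simp add: d_def T_def)
      qed
      also have "\<dots> \<le> (\<Sum>E\<in>B \<inter> C. if A \<inter> E = {} then 0 else T E)"
        using fC T0 candidates_append[of n k Es "[A]"] by (intro sum_mono2) (auto simp: C_def)
      finally show ?thesis using False by simp
    qed simp
    define m where "m = card C"
    define b where "b = card (B \<inter> C)"
    have m: "m > 0" using C fC by (simp add: m_def card_gt_0_iff)
    have b: "b \<ge> 1" using False fC by (simp add: b_def Suc_le_eq card_gt_0_iff)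
    \<comment> \<open>The candidates outside \<open>B\<close> meeting \<open>E\<close>, the blockers
      of \<open>E\<close> not yet chosen, and the bad candidates are disjoint parts of the set of
      candidates.\<close>
    have count: "real (card {A \<in> C - B. A \<inter> E \<noteq> {}}) + real (d Es E) + real b \<le> real m"
      if E: "E \<in> B \<inter> C" for E
    proof -
      define X where "X = {A \<in> C - B. A \<inter> E \<noteq> {}}"
      define Y where "Y = {A \<in> L - set Es. A \<inter> E = {}}"
      have Y: "Y \<subseteq> C - B" using LE(1) Suc.prems(1) disj by (auto simp: Y_def C_def candidates_def)
      have fXY: "finite X" "finite Y" using fC finite_subset[OF Y] by (auto simp: X_def)
      have "card (X \<union> Y) = card X + card Y"
        using fXY by (intro card_Un_disjoint) (auto simp: X_def Y_def)
      moreover have "card (X \<union> Y \<union> (B \<inter> C)) = card (X \<union> Y) + card (B \<inter> C)"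
        using fC fXY Y by (intro card_Un_disjoint) (auto simp: X_def)
      ultimately have "card X + card Y + card (B \<inter> C) = card (X \<union> Y \<union> (B \<inter> C))" by simp
      also have "\<dots> \<le> card C" using fC Y by (intro card_mono) (auto simp: X_def)
      finally show ?thesis by (simp add: X_def Y_def d_def b_def m_def)
    qed
    have "measure_pmf.prob (run n k (Suc N) Es) {Es'. Q Es'}
        = (\<Sum>A\<in>C. measure_pmf.prob (run n k N (Es @ [A])) {Es'. Q Es'}) / real m"
      unfolding run_Suc_first prob_bind_pmf using C fC
      by (simp add: next_edge_def C_def[symmetric] integral_pmf_of_set m_def)
    also have "\<dots> \<le> (\<Sum>A\<in>C. if A \<in> B then 1 else \<Sum>E\<in>B \<inter> C. if A \<inter> E = {} then 0 else T E) / real m"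
      using one by (intro divide_right_mono sum_mono) auto
    also have "(\<Sum>A\<in>C. if A \<in> B then 1 else \<Sum>E\<in>B \<inter> C. if A \<inter> E = {} then 0 else T E)
        = real b + (\<Sum>A\<in>C - B. \<Sum>E\<in>B \<inter> C. if A \<inter> E = {} then 0 else T E)"
    proof -
      have e: "C \<inter> {x. x \<in> B} = B \<inter> C" "C \<inter> - {x. x \<in> B} = C - B" by auto
      show ?thesis unfolding sum.If_cases[OF fC] e by (simp add: b_def)
    qed
    also have "(\<Sum>A\<in>C - B. \<Sum>E\<in>B \<inter> C. if A \<inter> E = {} then 0 else T E)
        = (\<Sum>E\<in>B \<inter> C. \<Sum>A\<in>C - B. if A \<inter> E = {} then 0 else T E)" by (rule sum.swap)
    also have "\<dots> = (\<Sum>E\<in>B \<inter> C. real (card {A \<in> C - B. A \<inter> E \<noteq> {}}) * T E)"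
    proof (intro sum.cong refl)
      fix E
      have "(C - B) \<inter> - {x. x \<inter> E = {}} = {A \<in> C - B. A \<inter> E \<noteq> {}}" by auto
      then show "(\<Sum>A\<in>C - B. if A \<inter> E = {} then 0 else T E) = real (card {A \<in> C - B. A \<inter> E \<noteq> {}}) * T E"
        using fC by (simp add: sum.If_cases)
    qed
    also have "real b = (\<Sum>E\<in>B \<inter> C. 1)" by (simp add: b_def)
    also have "(\<Sum>E\<in>B \<inter> C. 1) + (\<Sum>E\<in>B \<inter> C. real (card {A \<in> C - B. A \<inter> E \<noteq> {}}) * T E)
       = (\<Sum>E\<in>B \<inter> C. 1 + real (card {A \<in> C - B. A \<inter> E \<noteq> {}}) * T E)" by (simp add: sum.distrib)
    also have "\<dots> \<le> (\<Sum>E\<in>B \<inter> C. real m * T E)"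
    proof (intro sum_mono)
      fix E assume E: "E \<in> B \<inter> C"
      \<comment> \<open>The choice of \<open>T E\<close> makes this an identity; the summand 1 is
        then absorbed by \<open>b \<ge> 1\<close> in \<open>count\<close>.\<close>
      have "1 = (1 + real (d Es E)) * T E" by (simp add: T_def)
      then have "1 + real (card {A \<in> C - B. A \<inter> E \<noteq> {}}) * T E
          = (1 + real (d Es E) + real (card {A \<in> C - B. A \<inter> E \<noteq> {}})) * T E" by (simp add: algebra_simps)
      also have "\<dots> \<le> real m * T E" using count[OF E] b T0 by (intro mult_right_mono) auto
      finally show "1 + real (card {A \<in> C - B. A \<inter> E \<noteq> {}}) * T E \<le> real m * T E" .
    qed
    also have "\<dots> = real m * (\<Sum>E\<in>B \<inter> C. T E)" by (simp add: sum_distrib_left)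
    finally have "measure_pmf.prob (run n k (Suc N) Es) {Es'. Q Es'} \<le> real m * (\<Sum>E\<in>B \<inter> C. T E) / real m"
      by (simp add: divide_right_mono)
    then show ?thesis using m by (simp add: T_def d_def C_def Q_def)
  qed
qed

section \<open>Counts of order \<open>(n choose k) / k ^ h\<close>\<close>

text \<open>In the theorem \<open>\<gamma>\<close> is \<open>c ^ 3\<close>.\<close>

locale regime =
  fixes k :: "nat \<Rightarrow> nat" and \<gamma> :: real
  assumes cube: "(\<lambda>n. real (k n) ^ 3 / real n) \<longlonglongrightarrow> \<gamma>"
    and \<gamma>_pos: "\<gamma> > 0"
    and k_top: "filterlim k at_top sequentially"
begin

definition W :: "nat \<Rightarrow> real" where "W n = real (n choose k n)"

text \<open>The order of magnitude of the number of candidates when there are \<open>h\<close> early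
  edges.\<close>

definition unit :: "nat \<Rightarrow> nat \<Rightarrow> real" where "unit h n = W n / real (k n) ^ h"

definition D :: real where "D = \<gamma> + 1"

text \<open>A positive lower bound for all powers \<open>\<gamma> ^ j\<close> with
  \<open>j \<le> h\<close>, whether \<open>\<gamma>\<close> lies below or above 1.\<close>

definition \<mu> :: "nat \<Rightarrow> real" where "\<mu> h = min 1 \<gamma> ^ h"

text \<open>The limiting number of exact sets whose joints form a member of \<open>SS\<close>, in
  multiples of \<open>unit h\<close>.\<close>

definition total :: "nat \<Rightarrow> nat set set \<Rightarrow> real" where
  "total h SS = (\<Sum>S\<in>SS. \<gamma> ^ (h - card S))"

lemma D1: "1 \<le> D" using \<gamma>_pos by (simp add: D_def)

lemma \<mu>_pos: "\<mu> h > 0" using \<gamma>_pos by (simp add: \<mu>_def)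

section \<open>Growth of \<open>k\<close> and of the binomial coefficient\<close>

lemma ev_k_ge: "eventually (\<lambda>n. m \<le> k n) sequentially"
  using k_top by (auto simp: filterlim_at_top)

lemma ev_real_k_ge: "eventually (\<lambda>n. x \<le> real (k n)) sequentially"
  using ev_k_ge[of "nat \<lceil>x\<rceil>"] by eventually_elim (simp add: nat_ceiling_le_eq)

lemma k_real_top: "filterlim (\<lambda>n. real (k n)) at_top sequentially"
  using ev_real_k_ge by (auto simp: filterlim_at_top)

lemma ev_cube_le: "eventually (\<lambda>n. real (k n) ^ 3 \<le> D * real n) sequentially"
proof -
  have "eventually (\<lambda>n. real (k n) ^ 3 / real n < D) sequentially"
    using cube by (rule order_tendstoD) (simp add: D_def)
  then show ?thesis using eventually_gt_at_top[of 0] by eventually_elim (simp add: field_simps)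
qed

lemma ev_cube_ge: "eventually (\<lambda>n. \<gamma> / 2 * real n \<le> real (k n) ^ 3) sequentially"
proof -
  have "eventually (\<lambda>n. real (k n) ^ 3 / real n > \<gamma> / 2) sequentially"
    using cube by (rule order_tendstoD) (simp add: \<gamma>_pos)
  then show ?thesis using eventually_gt_at_top[of 0] by eventually_elim (simp add: field_simps)
qed

lemma ev_n_ge: "eventually (\<lambda>n. real (k n) * real (k n) \<le> real n) sequentially"
  using ev_cube_le ev_real_k_ge[of D] ev_real_k_ge[of 1]
proof eventually_elim
  case (elim n)
  have "D * (real (k n) * real (k n)) \<le> real (k n) ^ 3"
    using elim by (simp add: power3_eq_cube mult_right_mono)
  then have "D * (real (k n) * real (k n)) \<le> D * real n" using elim(1) by linarith
  then show ?case using D1 by simp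
qed

lemma ev_k_le: "eventually (\<lambda>n. k n \<le> n) sequentially"
  using ev_n_ge ev_real_k_ge[of 1]
proof eventually_elim
  case (elim n)
  have "real (k n) * 1 \<le> real (k n) * real (k n)" using elim by (intro mult_left_mono) auto
  then show ?case using elim by linarith
qed

lemma inverse_k: "(\<lambda>n. c / real (k n)) \<longlonglongrightarrow> 0"
  by (rule tendsto_divide_0[OF tendsto_const]) (rule filterlim_at_top_imp_at_infinity[OF k_real_top])

lemma ev_inverse_k: "e > 0 \<Longrightarrow> eventually (\<lambda>n. c / real (k n) \<le> e) sequentially"
  using order_tendstoD(2)[OF inverse_k, of e c] by (auto elim: eventually_mono)

lemma ev_W_pos: "eventually (\<lambda>n. W n > 0) sequentially"
  using ev_k_le by eventually_elim (simp add: W_def zero_less_binomial)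

text \<open>\<open>n choose k\<close> is at least \<open>(n / k) ^ k \<ge> k ^ k\<close>, which
  beats every fixed power of \<open>k\<close>. This makes boundedly many edges already chosen
  negligible in all counts.\<close>

lemma ev_W_large: "eventually (\<lambda>n. real c * real (k n) ^ j \<le> W n) sequentially"
  using ev_n_ge ev_k_ge[of "j + 1"] ev_k_le ev_k_ge[of c] ev_k_ge[of 1]
proof eventually_elim
  case (elim n)
  have k0: "real (k n) > 0" using elim by simp
  have "real c * real (k n) ^ j \<le> real (k n) ^ (j + 1)" using elim by (simp add: mult_right_mono)
  also have "\<dots> \<le> real (k n) ^ k n" using elim by (intro power_increasing) auto
  also have "\<dots> \<le> (real n / real (k n)) ^ k n"
    using elim k0 by (intro power_mono) (auto simp: field_simps)
  also have "\<dots> \<le> W n" unfolding W_def using binomial_ge_n_over_k_pow_k[of "k n" n, where 'a = real] elim by simp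
  finally show ?case .
qed

lemma ev_unit_large:
  assumes "e > 0"
  shows "eventually (\<lambda>n. real c \<le> e * unit h n) sequentially"
proof -
  define c' where "c' = nat \<lceil>real c / e\<rceil>"
  have c': "real c \<le> e * real c'"
  proof -
    have "real c / e \<le> real c'" by (simp add: c'_def real_nat_ceiling_ge)
    then show ?thesis using assms by (simp add: field_simps)
  qed
  show ?thesis using ev_W_large[of c' h] ev_k_ge[of 1]
  proof eventually_elim
    case (elim n)
    have "real c' \<le> unit h n" using elim by (simp add: unit_def pos_le_divide_eq)
    then have "e * real c' \<le> e * unit h n" using assms by simp
    then show ?case using c' by simp
  qed
qed

text \<open>The room left when \<open>h\<close> early edges and one further \<open>k\<close>-set are
  deleted; \<open>shrink\<close> is the resulting correction factor in
  \<open>binomial_lower\<close>. It tends to 1 because \<open>k ^ 2 / n\<close> is of order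
  \<open>1 / k\<close>.\<close>

definition dd :: "nat \<Rightarrow> nat \<Rightarrow> nat" where "dd h n = n - (h + 1) * k n"

definition shrink :: "nat \<Rightarrow> nat \<Rightarrow> real" where
  "shrink h n = 1 - real ((h + 1) * k n) * real (k n) / real (dd h n)"

lemma shrink_tendsto: "shrink h \<longlonglongrightarrow> 1"
proof -
  define a where "a = real (h + 1)"
  have q: "(\<lambda>n. real (k n) / real n) \<longlonglongrightarrow> 0" and p: "(\<lambda>n. real (k n) * real (k n) / real n) \<longlonglongrightarrow> 0"
  proof -
    have 1: "(\<lambda>n. (real (k n) ^ 3 / real n) * (1 / real (k n))) \<longlonglongrightarrow> \<gamma> * 0"
      by (intro tendsto_mult cube inverse_k)
    have e: "eventually (\<lambda>n. (real (k n) ^ 3 / real n) * (1 / real (k n)) = real (k n) * real (k n) / real n) sequentially"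
      using ev_k_ge[of 1] by eventually_elim (simp add: power3_eq_cube)
    show p: "(\<lambda>n. real (k n) * real (k n) / real n) \<longlonglongrightarrow> 0"
      using 1 e by (simp add: tendsto_cong)
    have 2: "(\<lambda>n. (real (k n) * real (k n) / real n) * (1 / real (k n))) \<longlonglongrightarrow> 0 * 0"
      by (intro tendsto_mult p inverse_k)
    have e: "eventually (\<lambda>n. (real (k n) * real (k n) / real n) * (1 / real (k n)) = real (k n) / real n) sequentially"
      using ev_k_ge[of 1] by eventually_elim simp
    show "(\<lambda>n. real (k n) / real n) \<longlonglongrightarrow> 0" using 2 e by (simp add: tendsto_cong)
  qed
  have lim: "(\<lambda>n. 1 - a * (real (k n) * real (k n) / real n) / (1 - a * (real (k n) / real n))) \<longlonglongrightarrow> 1 - a * 0 / (1 - a * 0)"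
    by (intro tendsto_intros p q) simp
  have "eventually (\<lambda>n. a * (real (k n) / real n) < 1) sequentially"
    using tendsto_mult[OF tendsto_const q, of a] by (intro order_tendstoD(2)) auto
  then have "eventually (\<lambda>n. 1 - a * (real (k n) * real (k n) / real n) / (1 - a * (real (k n) / real n)) = shrink h n) sequentially"
    using eventually_gt_at_top[of 0]
  proof eventually_elim
    case (elim n)
    have "real ((h + 1) * k n) \<le> real n" using elim by (simp add: a_def field_simps)
    then have le: "(h + 1) * k n \<le> n" by (simp only: of_nat_le_iff)
    have "real (dd h n) = real n - a * real (k n)"
      unfolding dd_def a_def of_nat_diff[OF le] of_nat_mult ..
    moreover have "1 - a * (real (k n) / real n) = (real n - a * real (k n)) / real n"
      using elim by (simp add: field_simps)
    moreover have "real ((h + 1) * k n) = a * real (k n)" unfolding a_def by (rule of_nat_mult)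
    ultimately show ?case using elim(2) by (simp add: shrink_def)
  qed
  from Lim_transform_eventually[OF lim this] show ?thesis by simp
qed

lemma ev_dd:
  "eventually (\<lambda>n. (h + 1) * k n + dd h n \<le> n \<and> dd h n > 0
     \<and> real ((h + 1) * k n) * real (k n) \<le> real (dd h n) \<and> shrink h n > 1 / 2) sequentially"
proof -
  have "eventually (\<lambda>n. shrink h n > 1 / 2) sequentially"
    using shrink_tendsto by (rule order_tendstoD) simp
  then show ?thesis using ev_n_ge ev_k_ge[of "h + 2"]
  proof eventually_elim
    case (elim n)
    have "real (h + 2) * real (k n) \<le> real (k n) * real (k n)" using elim(3) by (intro mult_right_mono) auto
    then have "real ((h + 2) * k n) \<le> real n" using elim(2) unfolding of_nat_mult by (rule order_trans)
    then have "(h + 2) * k n \<le> n" by (simp only: of_nat_le_iff)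
    then have d: "(h + 1) * k n + dd h n = n" "dd h n > 0" using elim(3) by (auto simp: dd_def)
    have "real ((h + 1) * k n) * real (k n) / real (dd h n) \<le> 1"
      using elim(1) unfolding shrink_def by linarith
    then have "real ((h + 1) * k n) * real (k n) \<le> real (dd h n)"
      using d(2) by (subst (asm) divide_le_eq_1_pos) auto
    then show ?case using d elim(1) by simp
  qed
qed

lemma ev_exact_upper:
  assumes "e > 0"
  shows "eventually (\<lambda>n. \<forall>H S. nice n (k n) H \<longrightarrow> length H = h \<longrightarrow> S \<in> indep H \<longrightarrow>
     real (card (exact_sets n (k n) H S)) \<le> (\<gamma> ^ (h - card S) + e) * unit h n) sequentially"
proof -
  \<comment> \<open>Only \<open>card S \<le> h\<close> enters the bound, so finitely many limits
    give an estimate uniform in \<open>H\<close> and \<open>S\<close>.\<close>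
  have "eventually (\<lambda>n. \<forall>s\<in>{..h}. (real (k n) ^ 3 / real n) ^ (h - s) < \<gamma> ^ (h - s) + e) sequentially"
  proof (intro eventually_ball_finite ballI)
    fix s show "eventually (\<lambda>n. (real (k n) ^ 3 / real n) ^ (h - s) < \<gamma> ^ (h - s) + e) sequentially"
      by (rule order_tendstoD(2)[OF tendsto_power[OF cube]]) (use assms in simp)
  qed simp
  then show ?thesis using ev_k_ge[of "h + 1"] ev_k_le
  proof eventually_elim
    case (elim n)
    show ?case
    proof (intro allI impI)
      fix H S assume H: "nice n (k n) H" "length H = h" "S \<in> indep H"
      define s where "s = card S"
      define K where "K = real (k n)"
      have s: "2 * s \<le> h" using card_indep_le[OF H(1,3)] H(2) by (simp add: s_def)
      have K: "K > 0" "real n > 0" using elim by (auto simp: K_def)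
      have "real (card (exact_sets n (k n) H S)) * real n ^ (h - s) \<le> K ^ (h - 2 * s) * K ^ (h - s) * W n"
        using card_exact_sets_upper[OF H(1,3)] elim H(2) by (simp add: s_def K_def W_def)
      then have "real (card (exact_sets n (k n) H S)) \<le> K ^ (h - 2 * s) * K ^ (h - s) * W n / real n ^ (h - s)"
        using K by (simp add: pos_le_divide_eq)
      also have "\<dots> = (K ^ 3 / real n) ^ (h - s) * (W n / K ^ h)"
      proof -
        \<comment> \<open>The exponents of \<open>k\<close> add up to
          \<open>3 * (h - s) - h\<close>: every factor \<open>n\<close> in the denominator is
          matched by \<open>k ^ 3\<close>, and \<open>1 / k ^ h\<close> is left over.\<close>
        have "3 * (h - s) = (h - 2 * s) + (h - s) + h" using s by simp
        then have "(K ^ 3) ^ (h - s) = K ^ ((h - 2 * s) + (h - s) + h)"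
          unfolding power_mult[symmetric] by (rule arg_cong)
        then have "(K ^ 3) ^ (h - s) = K ^ (h - 2 * s) * K ^ (h - s) * K ^ h"
          by (simp only: power_add)
        then show ?thesis using K by (simp add: power_divide field_simps)
      qed
      also have "\<dots> \<le> (\<gamma> ^ (h - s) + e) * (W n / K ^ h)"
      proof (intro mult_right_mono)
        show "(K ^ 3 / real n) ^ (h - s) \<le> \<gamma> ^ (h - s) + e"
          using elim(1) s by (auto simp: K_def intro: less_imp_le)
      qed (use K in \<open>simp add: W_def\<close>)
      finally show "real (card (exact_sets n (k n) H S)) \<le> (\<gamma> ^ (h - card S) + e) * unit h n"
        by (simp add: unit_def K_def s_def)
    qed
  qed
qed

lemma ev_exact_lower_avoiding:
  assumes "e > 0"
  shows "eventually (\<lambda>n. \<forall>H S E. nice n (k n) H \<longrightarrow> length H = h \<longrightarrow> S \<in> indep H \<longrightarrow>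
     E \<subseteq> {1..n} \<longrightarrow> card E \<le> k n \<longrightarrow> card (E \<inter> points H) \<le> w \<longrightarrow> E \<inter> S = {} \<longrightarrow>
     (\<gamma> ^ (h - card S) - e) * unit h n \<le> real (card {A \<in> exact_sets n (k n) H S. A \<inter> E = {}})) sequentially"
proof -
  have r: "(\<lambda>n. 1 - real (h + w) / real (k n)) \<longlonglongrightarrow> 1 - 0"
    by (intro tendsto_diff tendsto_const inverse_k)
  have "eventually (\<lambda>n. \<forall>s\<in>{..h}. (1 - real (h + w) / real (k n)) ^ (2 * h) * (real (k n) ^ 3 / real n) ^ (h - s) * shrink h n
      > \<gamma> ^ (h - s) - e) sequentially"
  proof (intro eventually_ball_finite ballI)
    fix s
    have "(\<lambda>n. (1 - real (h + w) / real (k n)) ^ (2 * h) * (real (k n) ^ 3 / real n) ^ (h - s) * shrink h n)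
       \<longlonglongrightarrow> (1 - 0) ^ (2 * h) * \<gamma> ^ (h - s) * 1"
      by (intro tendsto_mult tendsto_power cube shrink_tendsto r)
    from order_tendstoD(1)[OF this, of "\<gamma> ^ (h - s) - e"]
    show "eventually (\<lambda>n. (1 - real (h + w) / real (k n)) ^ (2 * h) * (real (k n) ^ 3 / real n) ^ (h - s) * shrink h n
      > \<gamma> ^ (h - s) - e) sequentially" using assms by simp
  qed simp
  then show ?thesis using ev_k_ge[of "h + w + 1"] ev_dd[of h] eventually_gt_at_top[of 0]
  proof eventually_elim
    case (elim n)
    show ?case
    proof (intro allI impI)
      fix H S E assume H: "nice n (k n) H" "length H = h" "S \<in> indep H"
        and E: "E \<subseteq> {1..n}" "card E \<le> k n" "card (E \<inter> points H) \<le> w" "E \<inter> S = {}"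
      define s where "s = card S"
      define K where "K = real (k n)"
      define r where "r = 1 - real (h + w) / K"
      define N where "N = real (card {A \<in> exact_sets n (k n) H S. A \<inter> E = {}})"
      have s: "2 * s \<le> h" using card_indep_le[OF H(1,3)] H(2) by (simp add: s_def)
      have K: "K > 0" "real n > 0" using elim by (auto simp: K_def)
      have r: "0 \<le> r" "r \<le> 1" using elim(2) K by (auto simp: r_def K_def)
      have Kr: "real (k n - h - w) = K * r" using elim(2) K by (simp add: K_def r_def field_simps)
      have sh: "shrink h n > 0" using elim(3) by linarith
      have "real (k n - h - w) ^ (h - 2 * s) * real (k n - (h - s)) ^ (h - s) * W n * shrink h n
         \<le> N * real n ^ (h - s)"
        using card_exact_sets_lower[OF H(1,3) E(1,4,2,3), of "dd h n"] elim(2,3) H(2)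
        by (simp add: s_def W_def shrink_def N_def)
      moreover have "real (k n - h - w) ^ (h - 2 * s) * real (k n - h - w) ^ (h - s) * W n * shrink h n
         \<le> real (k n - h - w) ^ (h - 2 * s) * real (k n - (h - s)) ^ (h - s) * W n * shrink h n"
        using sh by (intro mult_right_mono mult_left_mono power_mono) (auto simp: W_def)
      ultimately have "(K * r) ^ (h - 2 * s) * (K * r) ^ (h - s) * W n * shrink h n \<le> N * real n ^ (h - s)"
        unfolding Kr by linarith
      then have N: "(K * r) ^ (h - 2 * s) * (K * r) ^ (h - s) * W n * shrink h n / real n ^ (h - s) \<le> N"
        using K by (simp add: pos_divide_le_eq)
      have "(\<gamma> ^ (h - s) - e) * (W n / K ^ h) \<le> (r ^ (2 * h) * (K ^ 3 / real n) ^ (h - s) * shrink h n) * (W n / K ^ h)"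
      proof (intro mult_right_mono)
        show "\<gamma> ^ (h - s) - e \<le> r ^ (2 * h) * (K ^ 3 / real n) ^ (h - s) * shrink h n"
          using elim(1) s unfolding K_def r_def by (auto intro: less_imp_le)
      qed (use K in \<open>simp add: W_def\<close>)
      \<comment> \<open>The true exponent of \<open>r\<close> is \<open>2 * h - 3 * s\<close>. As
        \<open>r \<le> 1\<close>, the bound with \<open>2 * h\<close> is weaker and independent of
        \<open>S\<close>; it costs nothing in the limit because \<open>r\<close> tends to 1.\<close>
      also have "\<dots> \<le> (r ^ (h - 2 * s + (h - s)) * (K ^ 3 / real n) ^ (h - s) * shrink h n) * (W n / K ^ h)"
        using r K sh s by (intro mult_right_mono power_decreasing) (auto simp: W_def)
      also have "\<dots> = (K * r) ^ (h - 2 * s) * (K * r) ^ (h - s) * W n * shrink h n / real n ^ (h - s)"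
      proof -
        have "3 * (h - s) = (h - 2 * s) + (h - s) + h" using s by simp
        then have "(K ^ 3) ^ (h - s) = K ^ ((h - 2 * s) + (h - s) + h)"
          unfolding power_mult[symmetric] by (rule arg_cong)
        then have "(K ^ 3) ^ (h - s) = K ^ (h - 2 * s) * K ^ (h - s) * K ^ h"
          by (simp only: power_add)
        then show ?thesis using K by (simp add: power_divide power_mult_distrib power_add field_simps)
      qed
      also note N
      finally show "(\<gamma> ^ (h - card S) - e) * unit h n \<le> real (card {A \<in> exact_sets n (k n) H S. A \<inter> E = {}})"
        by (simp add: unit_def K_def s_def N_def)
    qed
  qed
qed

lemma ev_exact_lower:
  assumes "e > 0"
  shows "eventually (\<lambda>n. \<forall>H S. nice n (k n) H \<longrightarrow> length H = h \<longrightarrow> S \<in> indep H \<longrightarrow>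
     (\<gamma> ^ (h - card S) - e) * unit h n \<le> real (card (exact_sets n (k n) H S))) sequentially"
  using ev_exact_lower_avoiding[OF assms, of h 0]
proof eventually_elim
  case (elim n)
  show ?case
  proof (intro allI impI)
    fix H S assume "nice n (k n) H" "length H = h" "S \<in> indep H"
    then show "(\<gamma> ^ (h - card S) - e) * unit h n \<le> real (card (exact_sets n (k n) H S))"
      using elim[rule_format, of H S "{}"] by simp
  qed
qed

lemma ev_rare:
  "eventually (\<lambda>n. \<forall>H Ls. good n (k n) H Ls \<longrightarrow> length H = h \<longrightarrow> length Ls = l \<longrightarrow>
     real (card (rare n (k n) H Ls)) \<le> rare_const D h l / real (k n) * unit h n) sequentially"
  using ev_k_ge[of 1] ev_k_le ev_cube_le
proof eventually_elim
  case (elim n)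
  show ?case
  proof (intro allI impI)
    fix H Ls assume good: "good n (k n) H Ls" and l: "length H = h" "length Ls = l"
    show "real (card (rare n (k n) H Ls)) \<le> rare_const D h l / real (k n) * unit h n"
      using card_rare[OF good elim(1,2) D1 elim(3)] unfolding l by (simp add: unit_def W_def mult.commute)
  qed
qed

section \<open>The number of candidates in terms of the transversals\<close>

lemma \<mu>_le_power: "j \<le> h \<Longrightarrow> \<mu> h \<le> \<gamma> ^ j"
proof -
  assume "j \<le> h"
  then have "\<mu> h \<le> min 1 \<gamma> ^ j" unfolding \<mu>_def using \<gamma>_pos by (intro power_decreasing) auto
  also have "\<dots> \<le> \<gamma> ^ j" using \<gamma>_pos by (intro power_mono) auto
  finally show ?thesis .
qed

definition total_bound :: "nat \<Rightarrow> real" where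
  "total_bound h = 2 ^ (h * h) * max 1 \<gamma> ^ h"

lemma total_bounds:
  assumes good: "good n (k n) H Ls" and h: "length H = h"
  shows "\<mu> h \<le> total h (hitting H Ls)" "total h (hitting H Ls) \<le> total_bound h"
proof -
  obtain S where S: "S \<in> hitting H Ls" using hitting_nonempty[OF good] by blast
  have "\<mu> h \<le> \<gamma> ^ (h - card S)" by (rule \<mu>_le_power) simp
  also have "\<dots> \<le> total h (hitting H Ls)"
    unfolding total_def using \<gamma>_pos finite_hitting[OF good] S
    by (intro member_le_sum[of S _ "\<lambda>S. \<gamma> ^ (h - card S)"]) auto
  finally show "\<mu> h \<le> total h (hitting H Ls)" .
  have "\<gamma> ^ j \<le> max 1 \<gamma> ^ h" if "j \<le> h" for j
  proof -
    have "\<gamma> ^ j \<le> max 1 \<gamma> ^ j" using \<gamma>_pos by (intro power_mono) auto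
    also have "\<dots> \<le> max 1 \<gamma> ^ h" using that by (intro power_increasing) auto
    finally show ?thesis .
  qed
  then have "total h (hitting H Ls) \<le> real (card (hitting H Ls)) * max 1 \<gamma> ^ h"
    unfolding total_def by (intro sum_bounded_above) auto
  also have "\<dots> \<le> 2 ^ (h * h) * max 1 \<gamma> ^ h"
    using card_hitting_le[OF good] h by (intro mult_right_mono) (auto simp flip: of_nat_le_iff)
  finally show "total h (hitting H Ls) \<le> total_bound h" by (simp add: total_bound_def)
qed

text \<open>Extracting \<open>\<gamma> ^ length H\<close> leaves the weights
  \<open>(1 / \<gamma>) ^ card S\<close>, summed over all matchings.\<close>

lemma total_indep:
  assumes "nice n (k n) H"
  shows "total (length H) (indep H) = \<gamma> ^ length H * matching_poly (1 / \<gamma>) (length H)"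
proof -
  have "total (length H) (indep H) = (\<Sum>S\<in>indep H. \<gamma> ^ length H * (1 / \<gamma>) ^ card S)"
    unfolding total_def
  proof (intro sum.cong refl)
    fix S assume "S \<in> indep H"
    then have "2 * card S \<le> length H" by (rule card_indep_le[OF assms])
    then show "\<gamma> ^ (length H - card S) = \<gamma> ^ length H * (1 / \<gamma>) ^ card S"
      using \<gamma>_pos by (simp add: power_diff power_divide)
  qed
  then show ?thesis using sum_indep[OF assms, of "1 / \<gamma>"] by (simp add: sum_distrib_left[symmetric])
qed

lemma ev_exact_sum:
  assumes "e > 0"
  shows "eventually (\<lambda>n. \<forall>H Ls. good n (k n) H Ls \<longrightarrow> length H = h \<longrightarrow>
     (total h (hitting H Ls) - e) * unit h n \<le> real (card (\<Union>S\<in>hitting H Ls. exact_sets n (k n) H S))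
   \<and> real (card (\<Union>S\<in>hitting H Ls. exact_sets n (k n) H S)) \<le> (total h (hitting H Ls) + e) * unit h n) sequentially"
proof -
  \<comment> \<open>The error is shared by at most \<open>2 ^ (h * h)\<close> transversals.\<close>
  define e' where "e' = e / 2 ^ (h * h)"
  have e': "e' > 0" using assms by (simp add: e'_def)
  show ?thesis using ev_exact_lower[OF e', of h] ev_exact_upper[OF e', of h]
  proof eventually_elim
    case (elim n)
    show ?case
    proof (intro allI impI)
      fix H Ls assume good: "good n (k n) H Ls" and h: "length H = h"
      define T where "T = hitting H Ls"
      have nice: "nice n (k n) H" by (rule good_nice[OF good])
      have sub: "T \<subseteq> indep H" unfolding T_def by (rule hitting_subset)
      have c: "real (card T) * e' \<le> e"
      proof -
        have "real (card T) \<le> 2 ^ (h * h)" using card_hitting_le[OF good] h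
          unfolding T_def by (metis of_nat_le_iff of_nat_numeral of_nat_power)
        then have "real (card T) * e' \<le> 2 ^ (h * h) * e'" using e' by (intro mult_right_mono) auto
        then show ?thesis by (simp add: e'_def)
      qed
      have u: "unit h n \<ge> 0" by (simp add: unit_def W_def)
      have eq: "real (card (\<Union>S\<in>T. exact_sets n (k n) H S)) = (\<Sum>S\<in>T. real (card (exact_sets n (k n) H S)))"
        using card_UN_exact_sets[OF nice sub] by simp
      have "(total h T - e) * unit h n \<le> (total h T - real (card T) * e') * unit h n"
        using c u by (intro mult_right_mono) auto
      also have "\<dots> = (\<Sum>S\<in>T. (\<gamma> ^ (h - card S) - e') * unit h n)"
        unfolding sum_distrib_right[symmetric] by (simp add: total_def sum_subtractf)
      also have "\<dots> \<le> (\<Sum>S\<in>T. real (card (exact_sets n (k n) H S)))"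
        using elim(1) nice h sub by (intro sum_mono) blast
      finally have low: "(total h T - e) * unit h n \<le> real (card (\<Union>S\<in>T. exact_sets n (k n) H S))"
        unfolding eq .
      have "(\<Sum>S\<in>T. real (card (exact_sets n (k n) H S))) \<le> (\<Sum>S\<in>T. (\<gamma> ^ (h - card S) + e') * unit h n)"
        using elim(2) nice h sub by (intro sum_mono) blast
      also have "\<dots> = (total h T + real (card T) * e') * unit h n"
        unfolding sum_distrib_right[symmetric] by (simp add: total_def sum.distrib)
      also have "\<dots> \<le> (total h T + e) * unit h n" using c u by (intro mult_right_mono) auto
      finally have up: "real (card (\<Union>S\<in>T. exact_sets n (k n) H S)) \<le> (total h T + e) * unit h n"
        unfolding eq .
      show "(total h (hitting H Ls) - e) * unit h n \<le> real (card (\<Union>S\<in>hitting H Ls. exact_sets n (k n) H S))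
        \<and> real (card (\<Union>S\<in>hitting H Ls. exact_sets n (k n) H S)) \<le> (total h (hitting H Ls) + e) * unit h n"
        using low up unfolding T_def by blast
    qed
  qed
qed

lemma ev_rare_small:
  assumes "e > 0"
  shows "eventually (\<lambda>n. \<forall>H Ls. good n (k n) H Ls \<longrightarrow> length H = h \<longrightarrow> length Ls = l \<longrightarrow>
     real (card (rare n (k n) H Ls)) \<le> e * unit h n) sequentially"
  using ev_rare[of h l] ev_inverse_k[OF assms, of "rare_const D h l"]
proof eventually_elim
  case (elim n)
  have "rare_const D h l / real (k n) * unit h n \<le> e * unit h n"
    using elim(2) by (intro mult_right_mono) (auto simp: unit_def W_def)
  then show ?case using elim(1) by (blast intro: order_trans)
qed

text \<open>Up to rare sets and at most \<open>h + l\<close> edges already chosen, the candidates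
  are the exact sets over the transversals.\<close>

lemma ev_candidates:
  assumes "e > 0"
  shows "eventually (\<lambda>n. \<forall>H Ls. good n (k n) H Ls \<longrightarrow> length H = h \<longrightarrow> length Ls = l \<longrightarrow>
     (total h (hitting H Ls) - e) * unit h n \<le> real (card (candidates n (k n) (H @ Ls)))
   \<and> real (card (candidates n (k n) (H @ Ls))) \<le> (total h (hitting H Ls) + e) * unit h n) sequentially"
proof -
  have e2: "e / 2 > 0" using assms by simp
  show ?thesis using ev_exact_sum[OF e2, of h] ev_rare_small[OF e2, of h l] ev_unit_large[OF e2, of "h + l" h]
  proof eventually_elim
    case (elim n)
    show ?case
    proof (intro allI impI)
      fix H Ls assume good: "good n (k n) H Ls" and h: "length H = h" and l: "length Ls = l"
      define X where "X = (\<Union>S\<in>hitting H Ls. exact_sets n (k n) H S)"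
      define C where "C = candidates n (k n) (H @ Ls)"
      note b = elim(1)[rule_format, OF good h, folded X_def]
      have fX: "finite X" unfolding X_def
        by (rule finite_subset[OF _ finite_ksubsets[of n "k n"]]) (auto simp: exact_sets_def)
      have fR: "finite (rare n (k n) H Ls)"
        by (rule finite_subset[OF _ finite_ksubsets[of n "k n"]]) (auto simp: rare_def)
      have "C \<subseteq> rare n (k n) H Ls \<union> X"
        using candidates_cases[OF good] by (auto simp: C_def X_def)
      then have "card C \<le> card (rare n (k n) H Ls) + card X"
        using card_mono[of "rare n (k n) H Ls \<union> X" C] card_Un_le[of "rare n (k n) H Ls" X] fX fR by simp
      then have up: "real (card C) \<le> real (card (rare n (k n) H Ls)) + real (card X)" by linarith
      have "X - set (H @ Ls) \<subseteq> C"
        using exact_sets_candidates[OF good] by (auto simp: C_def X_def)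
      then have "card (X - set (H @ Ls)) \<le> card C" by (intro card_mono) (auto simp: C_def finite_candidates)
      moreover have "card X - card (set (H @ Ls)) \<le> card (X - set (H @ Ls))" by (rule diff_card_le_card_Diff) simp
      moreover have "card (set (H @ Ls)) \<le> h + l" using card_length[of "H @ Ls"] h l by simp
      ultimately have low: "real (card X) - real (h + l) \<le> real (card C)" by linarith
      have "real (card (rare n (k n) H Ls)) \<le> e / 2 * unit h n" using elim(2) good h l by blast
      then show "(total h (hitting H Ls) - e) * unit h n \<le> real (card (candidates n (k n) (H @ Ls)))
        \<and> real (card (candidates n (k n) (H @ Ls))) \<le> (total h (hitting H Ls) + e) * unit h n"
        using b up low elim(3) unfolding C_def[symmetric] by (simp add: algebra_simps)
    qed
  qed
qed

lemma ev_unit_pos: "eventually (\<lambda>n. unit h n > 0) sequentially"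
  using ev_W_pos ev_k_ge[of 1] by eventually_elim (simp add: unit_def)

end

section \<open>One step of the process\<close>

definition good_state :: "nat \<Rightarrow> nat \<Rightarrow> nat \<Rightarrow> nat set list \<Rightarrow> bool" where
  "good_state n k i Es \<longleftrightarrow> length Es = i \<and> (\<exists>H Ls. Es = H @ Ls \<and> good n k H Ls)"

definition nice_state :: "nat \<Rightarrow> nat \<Rightarrow> nat \<Rightarrow> nat set list \<Rightarrow> bool" where
  "nice_state n k i Es \<longleftrightarrow> length Es = i \<and> nice n k Es"

text \<open>The first \<open>h\<close> edges are the early ones, \<open>r_0\<close> has passed and
  \<open>r_1\<close> has not.\<close>

definition active :: "nat \<Rightarrow> nat \<Rightarrow> nat \<Rightarrow> nat set list \<Rightarrow> bool" where
  "active n k h Es \<longleftrightarrow> h < length Es \<and> good n k (take h Es) (drop h Es)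
     \<and> \<not> intersecting (hitting (take h Es) (drop h Es))"

text \<open>The value 0 marks the states in which the family of transversals need not shrink any more.\<close>

definition potential :: "nat \<Rightarrow> nat \<Rightarrow> nat \<Rightarrow> nat set list \<Rightarrow> real" where
  "potential n k h Es = (if active n k h Es then 2 ^ card (hitting (take h Es) (drop h Es)) else 0)"

lemma good_Nil: "good n k H [] \<longleftrightarrow> nice n k H"
  by (simp add: good_def)

lemma nice_state_Nil: "nice_state n k 0 []"
  by (simp add: nice_state_def nice_def)

lemma nice_imp_good_state: "nice_state n k i Es \<Longrightarrow> good_state n k i Es"
  unfolding nice_state_def good_state_def using good_Nil by (metis append_Nil2)

lemma active_snoc: "active n k h (Es @ [A]) \<Longrightarrow> h < length Es \<Longrightarrow> active n k h Es"
proof -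
  assume a: "active n k h (Es @ [A])" and h: "h < length Es"
  have g: "good n k (take h Es) (drop h Es @ [A])" and ni: "\<not> intersecting (hitting (take h Es) (drop h Es @ [A]))"
    using a h by (simp_all add: active_def)
  have "good n k (take h Es) (drop h Es)"
    using good_take[OF g, of "length (drop h Es)"] by simp
  moreover have "hitting (take h Es) (drop h Es @ [A]) \<subseteq> hitting (take h Es) (drop h Es)"
    by (auto simp: hitting_def)
  then have "\<not> intersecting (hitting (take h Es) (drop h Es))"
    using ni unfolding intersecting_def by blast
  ultimately show ?thesis using h by (simp add: active_def)
qed

lemma potential_nonneg: "0 \<le> potential n k h Es"
  by (simp add: potential_def)

lemma potential_le: "potential n k h Es \<le> 2 ^ (2 ^ (h * h))"
proof (cases "active n k h Es")
  case True
  then have "card (hitting (take h Es) (drop h Es)) \<le> 2 ^ (length (take h Es) * length (take h Es))"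
    by (intro card_hitting_le[of n k]) (simp add: active_def)
  then have "card (hitting (take h Es) (drop h Es)) \<le> 2 ^ (h * h)" using True by (simp add: active_def min_def)
  then show ?thesis using True by (simp add: potential_def power_increasing)
qed (simp add: potential_def)

lemma potential_ge_1: "active n k h Es \<Longrightarrow> 1 \<le> potential n k h Es"
  by (simp add: potential_def)

context regime begin

abbreviation "R n i \<equiv> run n (k n) i []"

text \<open>Only rare sets spoil a good history, and their share of the candidates is of order at
  most \<open>1 / k\<close>.\<close>

lemma ev_good_step:
  assumes "e > 0"
  shows "eventually (\<lambda>n. \<forall>Es. good_state n (k n) i Es \<longrightarrow>
     measure_pmf.prob (next_edge n (k n) Es) {Es'. \<not> good_state n (k n) (Suc i) Es'} \<le> e) sequentially"
proof -
  have "eventually (\<lambda>n. \<forall>h\<in>{..i}. \<forall>H Ls. good n (k n) H Ls \<longrightarrow> length H = h \<longrightarrow> length Ls = i - h \<longrightarrow>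
     measure_pmf.prob (next_edge n (k n) (H @ Ls)) {Es'. \<not> good_state n (k n) (Suc i) Es'} \<le> e) sequentially"
  proof (intro eventually_ball_finite ballI)
    fix h assume "h \<in> {..i}"
    then have hi: "h \<le> i" by simp
    \<comment> \<open>There are at least \<open>(\<mu> h / 2) * unit h n\<close> candidates, so this
      tolerance for the rare sets becomes \<open>e\<close> after division.\<close>
    define e' where "e' = e * (\<mu> h / 2)"
    have e': "e' > 0" "\<mu> h / 2 > 0" using assms \<mu>_pos[of h] by (auto simp: e'_def)
    show "eventually (\<lambda>n. \<forall>H Ls. good n (k n) H Ls \<longrightarrow> length H = h \<longrightarrow> length Ls = i - h \<longrightarrow>
       measure_pmf.prob (next_edge n (k n) (H @ Ls)) {Es'. \<not> good_state n (k n) (Suc i) Es'} \<le> e) sequentially"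
      using ev_rare_small[OF e'(1), of h "i - h"] ev_candidates[OF e'(2), of h "i - h"] ev_unit_pos[of h]
    proof eventually_elim
      case (elim n)
      show ?case
      proof (intro allI impI)
        fix H Ls assume good: "good n (k n) H Ls" and h: "length H = h" and l: "length Ls = i - h"
        define C where "C = candidates n (k n) (H @ Ls)"
        have nice: "nice n (k n) H" by (rule good_nice[OF good])
        have "(total h (hitting H Ls) - \<mu> h / 2) * unit h n \<le> real (card C)"
          using elim(2) good h l unfolding C_def by blast
        moreover have "(\<mu> h / 2) * unit h n \<le> (total h (hitting H Ls) - \<mu> h / 2) * unit h n"
          using total_bounds(1)[OF good h] elim(3) by (intro mult_right_mono) auto
        ultimately have cC: "(\<mu> h / 2) * unit h n \<le> real (card C)" by linarith
        have pos: "(\<mu> h / 2) * unit h n > 0" using e'(2) elim(3) by simp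
        then have C0: "C \<noteq> {}" using cC by auto
        have "{A \<in> C. \<not> good_state n (k n) (Suc i) ((H @ Ls) @ [A])} \<subseteq> rare n (k n) H Ls"
        proof safe
          fix A assume A: "A \<in> C" "\<not> good_state n (k n) (Suc i) ((H @ Ls) @ [A])"
          show "A \<in> rare n (k n) H Ls"
          proof (rule ccontr)
            assume "A \<notin> rare n (k n) H Ls"
            then have S: "A \<inter> joints H \<in> hitting H Ls" "A \<in> exact_sets n (k n) H (A \<inter> joints H)"
              using candidates_cases[OF good] A(1) unfolding C_def by auto
            have "\<exists>H' Ls'. (H @ Ls) @ [A] = H' @ Ls' \<and> good n (k n) H' Ls'"
            proof (cases "A \<inter> joints H = {}")
              case False
              then show ?thesis using good_snoc[OF good S] by (intro exI[of _ H] exI[of _ "Ls @ [A]"]) simp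
            next
              case True
              \<comment> \<open>The empty trace is a transversal only if there are no later edges.
                So \<open>r_0\<close> has not come yet and \<open>A\<close> joins the early
                edges.\<close>
              then have "Ls = []" using S(1) by (cases Ls) (auto simp: hitting_def)
              then show ?thesis using nice_snoc[OF nice, of A] S(2) True
                by (intro exI[of _ "H @ [A]"] exI[of _ "[]"]) (simp add: good_Nil)
            qed
            then show False using A(2) h l hi by (simp add: good_state_def)
          qed
        qed
        then have "card {A \<in> C. \<not> good_state n (k n) (Suc i) ((H @ Ls) @ [A])} \<le> card (rare n (k n) H Ls)"
          by (intro card_mono finite_subset[OF _ finite_ksubsets[of n "k n"]]) (auto simp: rare_def)
        moreover have "real (card (rare n (k n) H Ls)) \<le> e' * unit h n" using elim(1) good h l by blast
        ultimately have "real (card {A \<in> C. \<not> good_state n (k n) (Suc i) ((H @ Ls) @ [A])}) \<le> e * ((\<mu> h / 2) * unit h n)"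
          by (simp add: e'_def mult.assoc)
        also have "\<dots> \<le> e * real (card C)" using cC assms by (intro mult_left_mono) auto
        finally have "real (card {A \<in> C. \<not> good_state n (k n) (Suc i) ((H @ Ls) @ [A])}) / real (card C) \<le> e"
          using cC pos by (simp add: pos_divide_le_eq)
        then show "measure_pmf.prob (next_edge n (k n) (H @ Ls)) {Es'. \<not> good_state n (k n) (Suc i) Es'} \<le> e"
          using prob_next_edge[of n "k n" "H @ Ls"] C0 unfolding C_def by simp
      qed
    qed
  qed simp
  then show ?thesis
  proof eventually_elim
    case (elim n)
    show ?case
    proof (intro allI impI)
      fix Es assume "good_state n (k n) i Es"
      then obtain H Ls where "length (H @ Ls) = i" "Es = H @ Ls" "good n (k n) H Ls" by (auto simp: good_state_def)
      then show "measure_pmf.prob (next_edge n (k n) Es) {Es'. \<not> good_state n (k n) (Suc i) Es'} \<le> e"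
        using elim[rule_format, of "length H" H Ls] by simp
    qed
  qed
qed

lemma good_state_tendsto:
  "(\<lambda>n. measure_pmf.prob (R n i) {Es. \<not> good_state n (k n) i Es}) \<longlonglongrightarrow> 0"
proof (induction i)
  case 0
  have "good_state n (k n) 0 []" for n using nice_imp_good_state[OF nice_state_Nil] .
  then show ?case by (simp add: run_0)
next
  case (Suc i)
  show ?case
  proof (rule tendstoI)
    fix e :: real assume e: "e > 0"
    have "eventually (\<lambda>n. measure_pmf.prob (R n i) {Es. \<not> good_state n (k n) i Es} < e / 2) sequentially"
      using order_tendstoD(2)[OF Suc, of "e / 2"] e by simp
    then show "eventually (\<lambda>n. dist (measure_pmf.prob (R n (Suc i)) {Es. \<not> good_state n (k n) (Suc i) Es}) 0 < e) sequentially"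
      using ev_good_step[of "e / 2" i, OF half_gt_zero[OF e]]
    proof eventually_elim
      case (elim n)
      have "measure_pmf.prob (R n (Suc i)) {Es. \<not> good_state n (k n) (Suc i) Es}
         \<le> measure_pmf.prob (R n i) {Es. \<not> good_state n (k n) i Es} + e / 2"
        unfolding run_Suc using elim(2) e by (intro prob_bind_pmf_le) auto
      then show ?case using elim(1) by simp
    qed
  qed
qed

text \<open>Before \<open>r_0\<close> all independent sets are transversals, so after
  \<open>i\<close> edges there are about \<open>\<gamma> ^ i * Z i\<close> units of
  candidates.\<close>

abbreviation Z :: "nat \<Rightarrow> real" where "Z i \<equiv> matching_poly (1 / \<gamma>) i"

lemma matching_poly_ge_1: "0 \<le> t \<Longrightarrow> 1 \<le> matching_poly t h"
proof (induction t h rule: matching_poly.induct)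
  case (3 t h)
  then have "1 \<le> matching_poly t (Suc h)" "0 \<le> real (Suc h) * t * matching_poly t h" by auto
  then show ?case unfolding matching_poly.simps by linarith
qed simp_all

text \<open>The difference is written over the denominator \<open>b * \<beta>\<close>;
  \<open>b \<ge> \<beta> / 2\<close> keeps it away from 0, which is the origin of the 2 in the last
  bound on \<open>d\<close>.\<close>

lemma quotient_approx:
  fixes a b \<alpha> \<beta> e :: real
  assumes "0 < \<alpha>" "0 < \<beta>" "0 < e" "0 < d" "d \<le> \<beta> / 2" "d \<le> e * \<beta> ^ 2 / (2 * (\<alpha> + \<beta>))"
    and a: "\<bar>a - \<alpha>\<bar> \<le> d" and b: "\<bar>b - \<beta>\<bar> \<le> d"
  shows "\<bar>a / b - \<alpha> / \<beta>\<bar> \<le> e"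
proof -
  have b2: "b \<ge> \<beta> / 2" "b > 0" using b assms by auto
  have "a / b - \<alpha> / \<beta> = ((a - \<alpha>) * \<beta> + \<alpha> * (\<beta> - b)) / (b * \<beta>)"
    using b2 assms by (simp add: field_simps)
  then have "\<bar>a / b - \<alpha> / \<beta>\<bar> = \<bar>(a - \<alpha>) * \<beta> + \<alpha> * (\<beta> - b)\<bar> / (b * \<beta>)"
    using b2 assms by (simp add: abs_divide)
  also have "\<dots> \<le> (d * (\<alpha> + \<beta>)) / (b * \<beta>)"
  proof (intro divide_right_mono)
    have "\<bar>(a - \<alpha>) * \<beta> + \<alpha> * (\<beta> - b)\<bar> \<le> \<bar>a - \<alpha>\<bar> * \<beta> + \<alpha> * \<bar>\<beta> - b\<bar>"
      using assms by (intro order_trans[OF abs_triangle_ineq]) (simp add: abs_mult)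
    also have "\<dots> \<le> d * \<beta> + \<alpha> * d" using a b assms by (intro add_mono mult_mono) auto
    finally show "\<bar>(a - \<alpha>) * \<beta> + \<alpha> * (\<beta> - b)\<bar> \<le> d * (\<alpha> + \<beta>)" by (simp add: algebra_simps)
  qed (use b2 assms in simp)
  also have "\<dots> \<le> (d * (\<alpha> + \<beta>)) / (\<beta> / 2 * \<beta>)"
    using b2 assms by (intro divide_left_mono mult_right_mono) auto
  also have "\<dots> \<le> e"
    using assms by (simp add: field_simps power2_eq_square)
  finally show ?thesis .
qed

text \<open>The history stays nice exactly when the new edge avoids all joints. This is the choice
  \<open>S = {}\<close>, which takes \<open>\<gamma> ^ i\<close> of the
  \<open>\<gamma> ^ i * Z i\<close> units of candidates.\<close>

lemma ev_nice_step:
  assumes "e > 0"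
  shows "eventually (\<lambda>n. \<forall>Es. nice_state n (k n) i Es \<longrightarrow>
     \<bar>measure_pmf.prob (next_edge n (k n) Es) {Es'. nice_state n (k n) (Suc i) Es'} - 1 / Z i\<bar> \<le> e) sequentially"
proof -
  define \<alpha> where "\<alpha> = \<gamma> ^ i"
  define \<beta> where "\<beta> = \<gamma> ^ i * Z i"
  have p: "Z i \<ge> 1" using matching_poly_ge_1[of "1 / \<gamma>"] \<gamma>_pos by simp
  have ab: "0 < \<alpha>" "0 < \<beta>" using \<gamma>_pos p by (auto simp: \<alpha>_def \<beta>_def)
  define d where "d = min (\<beta> / 2) (e * \<beta> ^ 2 / (2 * (\<alpha> + \<beta>)))"
  have d: "0 < d" "d \<le> \<beta> / 2" "d \<le> e * \<beta> ^ 2 / (2 * (\<alpha> + \<beta>))"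
    using ab assms by (simp add: d_def) (simp_all only: d_def min.cobounded1 min.cobounded2)
  have d2: "d / 2 > 0" using d by simp
  show ?thesis
    using ev_exact_lower[OF d2, of i] ev_exact_upper[OF d2, of i] ev_candidates[OF d(1), of i 0]
      ev_unit_large[OF d2, of i i] ev_unit_pos[of i]
  proof eventually_elim
    case (elim n)
    show ?case
    proof (intro allI impI)
      fix H assume "nice_state n (k n) i H"
      then have nice: "nice n (k n) H" and h: "length H = i" by (auto simp: nice_state_def)
      have good: "good n (k n) H []" using nice by (simp add: good_Nil)
      define C where "C = candidates n (k n) (H @ [])"
      define X where "X = exact_sets n (k n) H {}"
      have hit: "hitting H [] = indep H" by (simp add: hitting_def)
      have e0: "{} \<in> indep H" by (simp add: indep_def)
      have tot: "total i (hitting H []) = \<beta>" using total_indep[OF nice] h by (simp add: hit \<beta>_def)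
      have "(\<beta> - d) * unit i n \<le> real (card C) \<and> real (card C) \<le> (\<beta> + d) * unit i n"
        using elim(3)[rule_format, OF good h] unfolding C_def tot by simp
      then have bC: "\<bar>real (card C) / unit i n - \<beta>\<bar> \<le> d"
        using elim(5) by (simp add: abs_le_iff field_simps)
      have fX: "finite X" unfolding X_def
        by (rule finite_subset[OF _ finite_ksubsets[of n "k n"]]) (auto simp: exact_sets_def)
      have X1: "(\<alpha> - d / 2) * unit i n \<le> real (card X)" "real (card X) \<le> (\<alpha> + d / 2) * unit i n"
        using elim(1)[rule_format, OF nice h e0] elim(2)[rule_format, OF nice h e0] by (auto simp: X_def \<alpha>_def)
      have eq: "{A \<in> C. nice_state n (k n) (Suc i) ((H @ []) @ [A])} = X - set H"
      proof (intro set_eqI iffI)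
        fix A assume "A \<in> {A \<in> C. nice_state n (k n) (Suc i) ((H @ []) @ [A])}"
        then show "A \<in> X - set H"
          using nice_snoc[OF nice, of A] by (auto simp: nice_state_def X_def C_def candidates_def)
      next
        fix A assume A: "A \<in> X - set H"
        then have "A \<in> C" using exact_sets_candidates[OF good, of "{}" A] e0 hit
          by (simp add: C_def X_def)
        then show "A \<in> {A \<in> C. nice_state n (k n) (Suc i) ((H @ []) @ [A])}"
          using A nice_snoc[OF nice, of A] h by (simp add: nice_state_def X_def)
      qed
      have "card X - card (set H) \<le> card (X - set H)" by (rule diff_card_le_card_Diff) simp
      moreover have "card (set H) \<le> i" using card_length[of H] h by simp
      moreover have "card (X - set H) \<le> card X" using fX by (intro card_mono) auto
      ultimately have "real (card X) - real i \<le> real (card (X - set H))" "real (card (X - set H)) \<le> real (card X)"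
        by linarith+
      then have "(\<alpha> - d) * unit i n \<le> real (card (X - set H))" "real (card (X - set H)) \<le> (\<alpha> + d) * unit i n"
        using X1 elim(4) d(1) elim(5) by (simp_all add: algebra_simps)
      then have aX: "\<bar>real (card (X - set H)) / unit i n - \<alpha>\<bar> \<le> d"
        using elim(5) by (simp add: abs_le_iff field_simps)
      have C0: "C \<noteq> {}" using bC d ab by auto
      have "\<bar>(real (card (X - set H)) / unit i n) / (real (card C) / unit i n) - \<alpha> / \<beta>\<bar> \<le> e"
        by (rule quotient_approx[OF ab assms d aX bC])
      then have "\<bar>real (card (X - set H)) / real (card C) - 1 / Z i\<bar> \<le> e"
        using elim(5) \<gamma>_pos by (simp add: \<alpha>_def \<beta>_def)
      then show "\<bar>measure_pmf.prob (next_edge n (k n) H) {Es'. nice_state n (k n) (Suc i) Es'} - 1 / Z i\<bar> \<le> e"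
        using prob_next_edge[of n "k n" "H @ []"] C0 eq unfolding C_def by simp
    qed
  qed
qed

definition nice_limit :: "nat \<Rightarrow> real" where
  "nice_limit i = (\<Prod>j<i. 1 / Z j)"

lemma nice_state_tendsto:
  "(\<lambda>n. measure_pmf.prob (R n i) {Es. nice_state n (k n) i Es}) \<longlonglongrightarrow> nice_limit i"
proof (induction i)
  case 0
  then show ?case by (simp add: run_0 nice_state_Nil nice_limit_def)
next
  case (Suc i)
  have lim: "(\<lambda>n. measure_pmf.prob (R n i) {Es. nice_state n (k n) i Es} * (1 / Z i)) \<longlonglongrightarrow> nice_limit (Suc i)"
    unfolding nice_limit_def prod.lessThan_Suc by (intro tendsto_mult Suc[unfolded nice_limit_def] tendsto_const)
  have zero: "(\<lambda>n. measure_pmf.prob (R n (Suc i)) {Es. nice_state n (k n) (Suc i) Es}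
      - measure_pmf.prob (R n i) {Es. nice_state n (k n) i Es} * (1 / Z i)) \<longlonglongrightarrow> 0"
  proof (rule tendstoI)
    fix e :: real assume e: "e > 0"
    show "eventually (\<lambda>n. dist (measure_pmf.prob (R n (Suc i)) {Es. nice_state n (k n) (Suc i) Es}
      - measure_pmf.prob (R n i) {Es. nice_state n (k n) i Es} * (1 / Z i)) 0 < e) sequentially"
      using ev_nice_step[of "e / 2" i, OF half_gt_zero[OF e]]
    proof eventually_elim
      case (elim n)
      have "\<bar>measure_pmf.prob (R n (Suc i)) {Es. nice_state n (k n) (Suc i) Es}
        - measure_pmf.prob (R n i) {Es. nice_state n (k n) i Es} * (1 / Z i)\<bar> \<le> e / 2"
        unfolding run_Suc
      proof (rule prob_bind_pmf_approx)
        \<comment> \<open>Histories that are no longer nice, or have stopped too early, cannot reach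
          a nice state of length \<open>Suc i\<close>.\<close>
        fix Es assume Es: "Es \<in> set_pmf (R n i)" "\<not> nice_state n (k n) i Es"
        have "\<not> nice_state n (k n) (Suc i) Es'" if Es': "Es' \<in> set_pmf (next_edge n (k n) Es)" for Es'
        proof
          assume N: "nice_state n (k n) (Suc i) Es'"
          have "Es' = Es \<or> (\<exists>A. Es' = Es @ [A])" using Es' by (auto simp: set_pmf_next_edge split: if_splits)
          then obtain A where A: "Es' = Es @ [A]" using N run_length(1)[OF Es(1)] by (auto simp: nice_state_def)
          then have "length Es = i" "nice n (k n) Es"
            using N nice_take[of n "k n" Es' i] by (auto simp: nice_state_def)
          then show False using Es(2) by (simp add: nice_state_def)
        qed
        then have "set_pmf (next_edge n (k n) Es) \<inter> {Es'. nice_state n (k n) (Suc i) Es'} = {}" by blast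
        then show "measure_pmf.prob (next_edge n (k n) Es) {Es'. nice_state n (k n) (Suc i) Es'} = 0"
          by (simp add: measure_pmf_zero_iff)
      qed (use elim e in auto)
      then show ?case using e by simp
    qed
  qed
  from tendsto_add[OF zero lim] show ?case by simp
qed

lemma nice_limit_pos: "nice_limit i > 0"
proof -
  have "Z j > 0" for j using matching_poly_ge_1[of "1 / \<gamma>" j] \<gamma>_pos by simp
  then show ?thesis unfolding nice_limit_def by (intro prod_pos) auto
qed

text \<open>\<open>Z j \<ge> 1 + 1 / \<gamma>\<close> for all \<open>j \<ge> 2\<close>, so the
  product decays geometrically. This is what makes \<open>r_0\<close> tight.\<close>

lemma nice_limit_tendsto: "nice_limit \<longlonglongrightarrow> 0"
proof -
  define q where "q = 1 / (1 + 1 / \<gamma>)"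
  have q: "0 < q" "q < 1" using \<gamma>_pos by (auto simp: q_def field_simps)
  have step: "nice_limit (Suc (Suc (Suc i))) \<le> q * nice_limit (Suc (Suc i))" for i
  proof -
    have "1 + 1 / \<gamma> \<le> Z (Suc i) + real (Suc i) * (1 / \<gamma>) * Z i"
    proof (intro add_mono)
      have "1 * (1 / \<gamma>) * 1 \<le> real (Suc i) * (1 / \<gamma>) * Z i"
        using \<gamma>_pos matching_poly_ge_1[of "1 / \<gamma>" i] by (intro mult_mono) auto
      then show "1 / \<gamma> \<le> real (Suc i) * (1 / \<gamma>) * Z i" by simp
    qed (use matching_poly_ge_1[of "1 / \<gamma>"] \<gamma>_pos in auto)
    then have "1 + 1 / \<gamma> \<le> Z (Suc (Suc i))" by simp
    then have "1 / Z (Suc (Suc i)) \<le> q"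
      unfolding q_def using \<gamma>_pos by (intro frac_le) (simp_all add: add_pos_pos del: matching_poly.simps)
    then have "nice_limit (Suc (Suc i)) * (1 / Z (Suc (Suc i))) \<le> nice_limit (Suc (Suc i)) * q"
      using nice_limit_pos[of "Suc (Suc i)"] by (intro mult_left_mono) auto
    then show ?thesis by (simp add: nice_limit_def mult.commute)
  qed
  have "nice_limit (i + 2) \<le> q ^ i * nice_limit 2" for i
  proof (induction i)
    case (Suc i)
    have "nice_limit (Suc i + 2) \<le> q * nice_limit (i + 2)" using step[of i] by simp
    also have "\<dots> \<le> q * (q ^ i * nice_limit 2)" using Suc q by (intro mult_left_mono) auto
    finally show ?case by simp
  qed (simp add: numeral_2_eq_2)
  moreover have "(\<lambda>i. q ^ i * nice_limit 2) \<longlonglongrightarrow> 0 * nice_limit 2"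
    using q by (intro tendsto_mult LIMSEQ_realpow_zero tendsto_const) auto
  ultimately have "(\<lambda>i. nice_limit (i + 2)) \<longlonglongrightarrow> 0"
    using less_imp_le[OF nice_limit_pos]
    by (intro tendsto_sandwich[of "\<lambda>_. 0" "\<lambda>i. nice_limit (i + 2)" _ "\<lambda>i. q ^ i * nice_limit 2"] always_eventually) auto
  then show ?thesis by (rule LIMSEQ_offset)
qed

end

section \<open>Stabilisation of the transversals and exit from the upper family\<close>

context regime begin

text \<open>A lower bound for the share of candidates that remove a transversal: at least
  \<open>\<mu> h / 4\<close> units among at most \<open>total_bound h + 1\<close>.\<close>

definition drop_rate :: "nat \<Rightarrow> real" where
  "drop_rate h = (\<mu> h / 4) / (total_bound h + 1)"

text \<open>Removing a transversal at least halves the potential, so half of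
  \<open>drop_rate h\<close> is gained in expectation.\<close>

definition rate :: "nat \<Rightarrow> real" where "rate h = 1 - drop_rate h / 2"

lemma total_bound_ge_1: "1 \<le> total_bound h"
proof -
  have "1 * 1 \<le> 2 ^ (h * h) * max 1 \<gamma> ^ h" by (intro mult_mono one_le_power) auto
  then show ?thesis by (simp add: total_bound_def)
qed

lemma rate_bounds: "0 < rate h" "rate h < 1"
proof -
  have "\<mu> h \<le> 1" unfolding \<mu>_def using \<gamma>_pos by (intro power_le_one) auto
  then have "drop_rate h \<le> 1" "0 < drop_rate h"
    using total_bound_ge_1[of h] \<mu>_pos[of h] by (auto simp: drop_rate_def field_simps)
  then show "0 < rate h" "rate h < 1" by (auto simp: rate_def)
qed

text \<open>There are disjoint transversals \<open>S\<close> and \<open>T\<close>, and every new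
  exact set over \<open>S\<close> removes \<open>T\<close>.\<close>

lemma ev_drop:
  "eventually (\<lambda>n. \<forall>H Ls. good n (k n) H Ls \<longrightarrow> length H = h \<longrightarrow> length Ls = l \<longrightarrow> Ls \<noteq> [] \<longrightarrow>
     \<not> intersecting (hitting H Ls) \<longrightarrow> candidates n (k n) (H @ Ls) \<noteq> {} \<and>
     drop_rate h * real (card (candidates n (k n) (H @ Ls)))
       \<le> real (card {A \<in> candidates n (k n) (H @ Ls). hitting H (Ls @ [A]) \<subset> hitting H Ls})) sequentially"
proof -
  have m: "\<mu> h / 2 > 0" "\<mu> h / 4 > 0" using \<mu>_pos[of h] by auto
  show ?thesis
    using ev_exact_lower[OF m(1), of h] ev_candidates[OF zero_less_one, of h l]
      ev_unit_large[OF m(2), of "h + l" h] ev_unit_pos[of h]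
  proof eventually_elim
    case (elim n)
    show ?case
    proof (intro allI impI)
      fix H Ls assume good: "good n (k n) H Ls" and h: "length H = h" and l: "length Ls = l" and Ls: "Ls \<noteq> []"
        and ni: "\<not> intersecting (hitting H Ls)"
      define C where "C = candidates n (k n) (H @ Ls)"
      define G where "G = {A \<in> C. hitting H (Ls @ [A]) \<subset> hitting H Ls}"
      obtain S T where ST: "S \<in> hitting H Ls" "T \<in> hitting H Ls" "S \<inter> T = {}"
        using ni by (auto simp: intersecting_def)
      have "(\<gamma> ^ (h - card S) - \<mu> h / 2) * unit h n \<le> real (card (exact_sets n (k n) H S))"
        using elim(1) good_nice[OF good] h ST(1) hitting_subset by blast
      moreover have "\<mu> h \<le> \<gamma> ^ (h - card S)" by (rule \<mu>_le_power) simp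
      then have "(\<mu> h / 2) * unit h n \<le> (\<gamma> ^ (h - card S) - \<mu> h / 2) * unit h n"
        using elim(4) by (intro mult_right_mono) auto
      ultimately have X: "(\<mu> h / 2) * unit h n \<le> real (card (exact_sets n (k n) H S))" by linarith
      have "exact_sets n (k n) H S - set (H @ Ls) \<subseteq> G"
        using exact_sets_candidates[OF good ST(1)] hitting_snoc_strict[OF good ST] by (auto simp: G_def C_def)
      then have "card (exact_sets n (k n) H S - set (H @ Ls)) \<le> card G"
        by (intro card_mono) (auto simp: G_def C_def finite_candidates)
      moreover have "card (exact_sets n (k n) H S) - card (set (H @ Ls)) \<le> card (exact_sets n (k n) H S - set (H @ Ls))"
        by (rule diff_card_le_card_Diff) simp
      moreover have "card (set (H @ Ls)) \<le> h + l" using card_length[of "H @ Ls"] h l by simp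
      ultimately have "real (card (exact_sets n (k n) H S)) - real (h + l) \<le> real (card G)" by linarith
      then have G: "(\<mu> h / 4) * unit h n \<le> real (card G)" using X elim(3) by linarith
      have "real (card C) \<le> (total h (hitting H Ls) + 1) * unit h n"
        using elim(2) good h l unfolding C_def by blast
      also have "\<dots> \<le> (total_bound h + 1) * unit h n"
        using total_bounds(2)[OF good h] elim(4) by (intro mult_right_mono) auto
      finally have "drop_rate h * real (card C) \<le> drop_rate h * ((total_bound h + 1) * unit h n)"
        using \<mu>_pos[of h] total_bound_ge_1[of h] by (intro mult_left_mono) (auto simp: drop_rate_def)
      also have "\<dots> = (\<mu> h / 4) * unit h n"
      proof -
        have "drop_rate h * (total_bound h + 1) = \<mu> h / 4"
          using total_bound_ge_1[of h] unfolding drop_rate_def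
          by (intro iffD1[OF nonzero_eq_divide_eq] refl) simp
        then show ?thesis by (simp only: mult.assoc[symmetric])
      qed
      also note G
      finally have "drop_rate h * real (card C) \<le> real (card G)" .
      moreover have "C \<noteq> {}"
      proof
        assume "C = {}"
        then have "real (card G) = 0" by (simp add: G_def)
        then show False using G elim(4) \<mu>_pos[of h] by (simp add: mult_le_0_iff)
      qed
      ultimately show "candidates n (k n) (H @ Ls) \<noteq> {} \<and>
         drop_rate h * real (card (candidates n (k n) (H @ Ls)))
         \<le> real (card {A \<in> candidates n (k n) (H @ Ls). hitting H (Ls @ [A]) \<subset> hitting H Ls})"
        by (simp add: C_def G_def)
    qed
  qed
qed

lemma ev_potential_step:
  "eventually (\<lambda>n. \<forall>Es. h < length Es \<longrightarrow> length Es \<le> m \<longrightarrow>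
     (\<integral>Es'. potential n (k n) h Es' \<partial>measure_pmf (next_edge n (k n) Es)) \<le> rate h * potential n (k n) h Es) sequentially"
proof -
  have "eventually (\<lambda>n. \<forall>l\<in>{..m}. \<forall>H Ls. good n (k n) H Ls \<longrightarrow> length H = h \<longrightarrow> length Ls = l \<longrightarrow> Ls \<noteq> [] \<longrightarrow>
     \<not> intersecting (hitting H Ls) \<longrightarrow> candidates n (k n) (H @ Ls) \<noteq> {} \<and>
     drop_rate h * real (card (candidates n (k n) (H @ Ls)))
       \<le> real (card {A \<in> candidates n (k n) (H @ Ls). hitting H (Ls @ [A]) \<subset> hitting H Ls})) sequentially"
    by (intro eventually_ball_finite ballI ev_drop) simp
  then show ?thesis
  proof eventually_elim
    case (elim n)
    show ?case
    proof (intro allI impI)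
      fix Es :: "nat set list" assume len: "h < length Es" "length Es \<le> m"
      define V where "V = potential n (k n) h"
      show "(\<integral>Es'. potential n (k n) h Es' \<partial>measure_pmf (next_edge n (k n) Es)) \<le> rate h * potential n (k n) h Es"
      proof (cases "active n (k n) h Es")
        case False
        \<comment> \<open>Goodness passes to prefixes and the transversal family only shrinks, so an
          inactive state with more than \<open>h\<close> edges remains inactive.\<close>
        have "V Es' = 0" if "Es' \<in> set_pmf (next_edge n (k n) Es)" for Es'
        proof -
          have "\<not> active n (k n) h Es'"
            using that False active_snoc[OF _ len(1)] by (auto simp: set_pmf_next_edge split: if_splits)
          then show ?thesis by (simp add: V_def potential_def)
        qed
        then have "(\<integral>Es'. V Es' \<partial>measure_pmf (next_edge n (k n) Es)) = (\<integral>Es'. 0 \<partial>measure_pmf (next_edge n (k n) Es))"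
          by (intro integral_cong_AE AE_pmfI) auto
        then show ?thesis using False by (simp add: V_def potential_def)
      next
        case True
        define H Ls where "H = take h Es" and "Ls = drop h Es"
        have Es: "Es = H @ Ls" and h: "length H = h" and Ls: "Ls \<noteq> []" "length Ls \<le> m"
          using len by (auto simp: H_def Ls_def)
        have good: "good n (k n) H Ls" and ni: "\<not> intersecting (hitting H Ls)"
          using True by (simp_all add: active_def H_def Ls_def)
        define C where "C = candidates n (k n) Es"
        define G where "G = {A \<in> C. hitting H (Ls @ [A]) \<subset> hitting H Ls}"
        have fC: "finite C" by (simp add: C_def finite_candidates)
        have C0: "C \<noteq> {}" and G: "drop_rate h * real (card C) \<le> real (card G)"
          using elim[rule_format, OF _ good h refl Ls(1) ni] Ls(2) by (auto simp: C_def G_def Es)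
        have VE: "V Es = 2 ^ card (hitting H Ls)" using True by (simp add: V_def potential_def H_def Ls_def)
        have Vn: "V (Es @ [A]) \<le> (if A \<in> G then V Es / 2 else V Es)" for A
        proof (cases "active n (k n) h (Es @ [A])")
          case True
          have V': "V (Es @ [A]) = 2 ^ card (hitting H (Ls @ [A]))"
            using True len(1) by (simp add: V_def potential_def H_def Ls_def)
          have fin: "finite (hitting H Ls)" by (rule finite_hitting[OF good])
          show ?thesis
          proof (cases "A \<in> G")
            case True
            then have "card (hitting H (Ls @ [A])) < card (hitting H Ls)"
              using fin by (intro psubset_card_mono) (auto simp: G_def)
            then have "(2::real) ^ Suc (card (hitting H (Ls @ [A]))) \<le> 2 ^ card (hitting H Ls)"
              by (intro power_increasing) auto
            then show ?thesis using True by (simp add: V' VE)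
          next
            case False
            have "card (hitting H (Ls @ [A])) \<le> card (hitting H Ls)"
              using fin hitting_snoc[OF good, of A] by (intro card_mono) auto
            then show ?thesis using False by (simp add: V' VE power_increasing)
          qed
        next
          case False
          then show ?thesis using potential_nonneg[of n "k n" h Es] by (simp add: V_def potential_def)
        qed
        have "(\<integral>Es'. V Es' \<partial>measure_pmf (next_edge n (k n) Es)) = (\<Sum>A\<in>C. V (Es @ [A])) / real (card C)"
          using C0 fC by (simp add: next_edge_def C_def[symmetric] integral_pmf_of_set)
        also have "\<dots> \<le> (\<Sum>A\<in>C. if A \<in> G then V Es / 2 else V Es) / real (card C)"
          by (intro divide_right_mono sum_mono Vn) simp
        also have "(\<Sum>A\<in>C. if A \<in> G then V Es / 2 else V Es) = (\<Sum>A\<in>C. V Es - (if A \<in> G then V Es / 2 else 0))"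
          by (intro sum.cong) auto
        also have "\<dots> = real (card C) * V Es - real (card G) * (V Es / 2)"
        proof -
          have "C \<inter> {A. A \<in> G} = G" by (auto simp: G_def)
          then show ?thesis using fC by (simp add: sum_subtractf sum.If_cases)
        qed
        also have "\<dots> \<le> real (card C) * V Es - (drop_rate h * real (card C)) * (V Es / 2)"
          using G VE by (intro diff_left_mono mult_right_mono) auto
        also have "\<dots> = real (card C) * (rate h * V Es)" by (simp add: rate_def algebra_simps)
        finally have "(\<integral>Es'. V Es' \<partial>measure_pmf (next_edge n (k n) Es)) \<le> real (card C) * (rate h * V Es) / real (card C)"
          by (simp add: divide_right_mono)
        then show ?thesis using C0 fC by (simp add: V_def)
      qed
    qed
  qed
qed

lemma ev_potential_decay:
  "eventually (\<lambda>n. (\<integral>Es. potential n (k n) h Es \<partial>measure_pmf (R n (h + 1 + j))) \<le> rate h ^ j * 2 ^ (2 ^ (h * h))) sequentially"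
proof (induction j)
  case 0
  have "(\<integral>Es. potential n (k n) h Es \<partial>measure_pmf (R n (h + 1))) \<le> (\<integral>Es. 2 ^ (2 ^ (h * h)) \<partial>measure_pmf (R n (h + 1)))" for n
    using potential_nonneg[of n "k n" h] potential_le[of n "k n" h]
    by (intro integral_mono integral_pmf_bounded[of _ "2 ^ (2 ^ (h * h))"]) auto
  then show ?case by simp
next
  case (Suc j)
  show ?case using Suc ev_potential_step[of h "h + 1 + j"]
  proof eventually_elim
    case (elim n)
    have "(\<integral>Es. potential n (k n) h Es \<partial>measure_pmf (R n (Suc (h + 1 + j))))
       \<le> (\<integral>Es. rate h * potential n (k n) h Es \<partial>measure_pmf (R n (h + 1 + j)))"
      unfolding run_Suc
    proof (rule integral_bind_pmf_le[of _ "2 ^ (2 ^ (h * h))" _ _ _ "2 ^ (2 ^ (h * h))"])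
      fix Es assume Es: "Es \<in> set_pmf (R n (h + 1 + j))"
      show "(\<integral>Es'. potential n (k n) h Es' \<partial>measure_pmf (next_edge n (k n) Es)) \<le> rate h * potential n (k n) h Es"
      proof (cases "h < length Es")
        case True
        then show ?thesis using elim(2) run_length(1)[OF Es] by blast
      next
        case False
        \<comment> \<open>A history with at most \<open>h\<close> edges after more than
          \<open>h\<close> rounds has stopped and never becomes active.\<close>
        then have "candidates n (k n) Es = {}" using run_length(2)[OF Es] by auto
        then show ?thesis using False by (simp add: next_edge_def potential_def active_def)
      qed
    next
      fix Es
      have "rate h * potential n (k n) h Es \<le> 1 * 2 ^ (2 ^ (h * h))"
        using rate_bounds[of h] potential_nonneg potential_le by (intro mult_mono) auto
      then show "\<bar>rate h * potential n (k n) h Es\<bar> \<le> 2 ^ (2 ^ (h * h))"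
        using rate_bounds[of h] potential_nonneg[of n "k n" h Es] by (simp add: abs_mult)
    qed (auto intro: potential_nonneg potential_le)
    also have "\<dots> = rate h * (\<integral>Es. potential n (k n) h Es \<partial>measure_pmf (R n (h + 1 + j)))" by simp
    also have "\<dots> \<le> rate h * (rate h ^ j * 2 ^ (2 ^ (h * h)))"
      using elim(1) rate_bounds[of h] by (intro mult_left_mono) auto
    finally show ?case by (simp add: mult.assoc)
  qed
qed

definition finished :: "nat \<Rightarrow> nat \<Rightarrow> nat set list \<Rightarrow> bool" where
  "finished n K Es \<longleftrightarrow> length Es = K \<and>
     (\<exists>H Ls. Es = H @ Ls \<and> good n (k n) H Ls \<and> Ls \<noteq> [] \<and> intersecting (hitting H Ls))"

lemma prob_active_le:
  "measure_pmf.prob M {Es. active n (k n) h Es} \<le> (\<integral>Es. potential n (k n) h Es \<partial>measure_pmf M)"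
proof -
  have "(\<integral>Es. indicator {Es. active n (k n) h Es} Es \<partial>measure_pmf M) \<le> (\<integral>Es. potential n (k n) h Es \<partial>measure_pmf M)"
  proof (intro integral_mono)
    show "integrable (measure_pmf M) (potential n (k n) h)"
      using potential_nonneg[of n "k n" h] potential_le[of n "k n" h]
      by (intro integral_pmf_bounded[of _ "2 ^ (2 ^ (h * h))"]) auto
    fix Es show "indicator {Es. active n (k n) h Es} Es \<le> potential n (k n) h Es"
      using potential_ge_1[of n "k n" h Es] potential_nonneg[of n "k n" h Es] by (simp add: indicator_def)
  qed (auto intro!: integral_pmf_bounded[of _ 1] simp: indicator_def)
  then show ?thesis unfolding integral_prob_indicator .
qed

text \<open>Three things can go wrong by time \<open>K\<close>: the history is not good, its first
  \<open>h0 + 1\<close> edges still form a nice family, or it has at most \<open>h0\<close> early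
  edges and its transversals do not intersect yet. First \<open>h0\<close> is fixed to control the
  second case, then \<open>K\<close> so large that the potential has decayed for every
  \<open>h \<le> h0\<close>.\<close>

lemma finished_tight:
  assumes "e > 0"
  shows "\<exists>K. eventually (\<lambda>n. measure_pmf.prob (R n K) {Es. \<not> finished n K Es} \<le> e) sequentially"
proof -
  have e3: "e / 3 > 0" using assms by simp
  have "eventually (\<lambda>i. nice_limit i < e / 3) sequentially"
    by (rule order_tendstoD(2)[OF nice_limit_tendsto e3])
  then obtain I where I: "\<And>i. i \<ge> I \<Longrightarrow> nice_limit i < e / 3" by (auto simp: eventually_sequentially)
  define h0 where "h0 = I"
  have lim: "(\<lambda>K. \<Sum>h\<le>h0. rate h ^ (K - (h + 1)) * 2 ^ (2 ^ (h * h))) \<longlonglongrightarrow> (\<Sum>h\<le>h0. 0 * 2 ^ (2 ^ (h * h)))"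
  proof (intro tendsto_sum tendsto_mult tendsto_const)
    fix h
    have "(\<lambda>j. rate h ^ j) \<longlonglongrightarrow> 0" using rate_bounds[of h] by (intro LIMSEQ_realpow_zero) auto
    then have "(\<lambda>K. rate h ^ (K + (h + 1) - (h + 1))) \<longlonglongrightarrow> 0" by simp
    then show "(\<lambda>K. rate h ^ (K - (h + 1))) \<longlonglongrightarrow> 0" by (rule LIMSEQ_offset)
  qed
  have "eventually (\<lambda>K. (\<Sum>h\<le>h0. rate h ^ (K - (h + 1)) * 2 ^ (2 ^ (h * h))) < e / 3) sequentially"
    by (rule order_tendstoD(2)[OF lim]) (use e3 in simp)
  then obtain K0 where K0: "\<And>K. K \<ge> K0 \<Longrightarrow> (\<Sum>h\<le>h0. rate h ^ (K - (h + 1)) * 2 ^ (2 ^ (h * h))) < e / 3"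
    by (auto simp: eventually_sequentially)
  define K where "K = max K0 (h0 + 1)"
  have K: "h0 + 1 \<le> K" "(\<Sum>h\<le>h0. rate h ^ (K - (h + 1)) * 2 ^ (2 ^ (h * h))) < e / 3"
    using K0[of K] by (auto simp: K_def)
  have e1: "eventually (\<lambda>n. measure_pmf.prob (R n K) {Es. \<not> good_state n (k n) K Es} < e / 3) sequentially"
    by (rule order_tendstoD(2)[OF good_state_tendsto e3])
  have e2: "eventually (\<lambda>n. measure_pmf.prob (R n (h0 + 1)) {Es. nice_state n (k n) (h0 + 1) Es} < e / 3) sequentially"
    by (rule order_tendstoD(2)[OF nice_state_tendsto]) (use I[of "h0 + 1"] in \<open>simp add: h0_def\<close>)
  have e4: "eventually (\<lambda>n. \<forall>h\<in>{..h0}. (\<integral>Es. potential n (k n) h Es \<partial>measure_pmf (R n K))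
      \<le> rate h ^ (K - (h + 1)) * 2 ^ (2 ^ (h * h))) sequentially"
  proof (intro eventually_ball_finite ballI)
    fix h assume "h \<in> {..h0}"
    then have "h + 1 + (K - (h + 1)) = K" using K(1) by simp
    then show "eventually (\<lambda>n. (\<integral>Es. potential n (k n) h Es \<partial>measure_pmf (R n K))
      \<le> rate h ^ (K - (h + 1)) * 2 ^ (2 ^ (h * h))) sequentially"
      using ev_potential_decay[of h "K - (h + 1)"] by simp
  qed simp
  have "eventually (\<lambda>n. measure_pmf.prob (R n K) {Es. \<not> finished n K Es} \<le> e) sequentially"
    using e1 e2 e4
  proof eventually_elim
    case (elim n)
    define A where "A = {Es. \<not> good_state n (k n) K Es}"
    define B where "B = {Es. nice_state n (k n) (h0 + 1) (take (h0 + 1) Es)}"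
    define F where "F h = {Es. active n (k n) h Es}" for h
    have sub: "{Es. \<not> finished n K Es} \<subseteq> A \<union> B \<union> (\<Union>h\<in>{..h0}. F h)"
    proof
      fix Es assume nf: "Es \<in> {Es. \<not> finished n K Es}"
      show "Es \<in> A \<union> B \<union> (\<Union>h\<in>{..h0}. F h)"
      proof (cases "good_state n (k n) K Es")
        case True
        then obtain H Ls where len: "length Es = K" and Es: "Es = H @ Ls" and good: "good n (k n) H Ls"
          by (auto simp: good_state_def)
        show ?thesis
        proof (cases "length H \<le> h0")
          case True
          then have Ls: "Ls \<noteq> []" using len Es K(1) by auto
          then have "\<not> intersecting (hitting H Ls)" using nf len Es good by (auto simp: finished_def)
          then have "active n (k n) (length H) Es" using Es good Ls by (simp add: active_def)
          then show ?thesis using True by (auto simp: F_def)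
        next
          case False
          then have "take (h0 + 1) Es = take (h0 + 1) H" by (simp add: Es)
          then have "Es \<in> B"
            using nice_take[OF good_nice[OF good], of "h0 + 1"] len K(1) by (simp add: B_def nice_state_def)
          then show ?thesis by blast
        qed
      qed (simp add: A_def)
    qed
    have "measure_pmf.prob (R n K) {Es. \<not> finished n K Es} \<le> measure_pmf.prob (R n K) (A \<union> B \<union> (\<Union>h\<in>{..h0}. F h))"
      by (rule measure_pmf.finite_measure_mono[OF sub]) simp
    also have "\<dots> \<le> measure_pmf.prob (R n K) (A \<union> B) + measure_pmf.prob (R n K) (\<Union>h\<in>{..h0}. F h)"
      by (rule measure_Un_le) auto
    also have "\<dots> \<le> measure_pmf.prob (R n K) A + measure_pmf.prob (R n K) B + (\<Sum>h\<in>{..h0}. measure_pmf.prob (R n K) (F h))"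
      by (intro add_mono measure_Un_le measure_UNION_le) auto
    also have "\<dots> \<le> e / 3 + e / 3 + e / 3"
    proof (intro add_mono)
      show "measure_pmf.prob (R n K) A \<le> e / 3" using elim(1) by (simp add: A_def)
      have "measure_pmf.prob (R n K) B = measure_pmf.prob (R n (h0 + 1)) {Es. nice_state n (k n) (h0 + 1) Es}"
        unfolding map_take_run[OF K(1), of n "k n", symmetric] measure_map_pmf by (simp add: B_def vimage_def)
      then show "measure_pmf.prob (R n K) B \<le> e / 3" using elim(2) by simp
      have "(\<Sum>h\<in>{..h0}. measure_pmf.prob (R n K) (F h)) \<le> (\<Sum>h\<le>h0. rate h ^ (K - (h + 1)) * 2 ^ (2 ^ (h * h)))"
        using elim(3) unfolding F_def by (intro sum_mono order_trans[OF prob_active_le]) auto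
      then show "(\<Sum>h\<in>{..h0}. measure_pmf.prob (R n K) (F h)) \<le> e / 3" using K(2) by simp
    qed
    finally show ?case by simp
  qed
  then show ?thesis by blast
qed

section \<open>Leaving the upper family after \<open>r_1\<close>\<close>

definition bad_sets :: "nat \<Rightarrow> nat set list \<Rightarrow> nat set list \<Rightarrow> nat set set" where
  "bad_sets n H Ls = {A \<in> candidates n (k n) (H @ Ls). \<exists>S\<in>hitting H Ls. A \<inter> S = {}}"

text \<open>
  Bad sets meeting the early edges in at most \<open>4 h\<close> points are blocked by a constant proportion of
  the lower family. The other bad sets may be blocked by few members of it, but they are much rarer still.
\<close>

lemma ev_exit:
  assumes "e > 0"
  shows "eventually (\<lambda>n. \<forall>H Ls. good n (k n) H Ls \<longrightarrow> length H = h \<longrightarrow> length Ls = l \<longrightarrow> Ls \<noteq> [] \<longrightarrow>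
     intersecting (hitting H Ls) \<longrightarrow>
     (\<forall>N. measure_pmf.prob (run n (k n) N (H @ Ls)) {Es. set Es \<inter> bad_sets n H Ls \<noteq> {}} \<le> e)) sequentially"
proof -
  \<comment> \<open>Comes from \<open>card_avoiding_lower\<close>: eventually
    \<open>n \<le> 2 * k ^ 3 / \<gamma>\<close> and \<open>k - 2 * h \<ge> k / 2\<close>, which
    gives \<open>\<gamma> / 4\<close>, and \<open>shrink h n \<ge> 1 / 2\<close> gives the final
    half.\<close>
  define c0 where "c0 = (\<gamma> / 4) ^ (2 * h) / 2"
  \<comment> \<open>The constant of \<open>card_ksubsets_weight\<close> with \<open>Y = {}\<close>,
    \<open>z = h + 1\<close> and \<open>m = 4 * h + 1\<close>.\<close>
  define Ch where "Ch = 2 ^ 0 * (real (4 * h + 1) + 1) * real (h + 1) ^ (4 * h + 1) * D ^ (0 + (4 * h + 1))"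
  have c0: "c0 > 0" using \<gamma>_pos by (simp add: c0_def)
  have m: "\<mu> h / 2 > 0" "\<mu> h / 4 > 0" "c0 / 2 > 0" using \<mu>_pos[of h] c0 by auto
  have e1: "e / 2 * (\<mu> h / 4) > 0" "e / 2 * (c0 / 2) > 0" using assms m by auto
  show ?thesis
    using ev_rare_small[OF e1(1), of h l] ev_exact_lower_avoiding[OF m(1), of h "4 * h"]
      ev_unit_large[OF m(2), of "h + l" h] ev_unit_large[OF m(3), of "h + l" "4 * h"]
      ev_unit_pos[of h] ev_unit_pos[of "4 * h"] ev_inverse_k[OF e1(2), of Ch]
      ev_k_ge[of "4 * h + 1"] ev_k_le ev_cube_le ev_cube_ge ev_dd[of h]
  proof eventually_elim
    case (elim n)
    show ?case
    proof (intro allI impI)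
      fix H Ls N
      assume good: "good n (k n) H Ls" and h: "length H = h" and l: "length Ls = l" and Ls: "Ls \<noteq> []"
        and int: "intersecting (hitting H Ls)"
      have nice: "nice n (k n) H" by (rule good_nice[OF good])
      define B where "B = bad_sets n H Ls"
      define C where "C = candidates n (k n) (H @ Ls)"
      \<comment> \<open>The sets that enter the lower family through a transversal. They meet every
        candidate that is not bad, so before a bad choice they are either available or already
        chosen.\<close>
      define L where "L = {A \<in> ksubsets n (k n). (\<exists>S\<in>hitting H Ls. S \<subseteq> A) \<and> (\<forall>F\<in>set H. A \<inter> F \<noteq> {})}"
      define d where "d E = card {A \<in> L - set (H @ Ls). A \<inter> E = {}}" for E
      have BC: "B \<subseteq> C" by (auto simp: B_def C_def bad_sets_def)
      have fC: "finite C" by (simp add: C_def finite_candidates)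
      have fB: "finite B" using BC fC finite_subset by blast
      have fL: "finite L" using finite_ksubsets by (simp add: L_def)
      \<comment> \<open>The joints of a candidate that is not rare form a transversal, and this
        meets all the others.\<close>
      have B_rare: "B \<subseteq> rare n (k n) H Ls"
      proof
        fix A assume A: "A \<in> B"
        then obtain S where S: "S \<in> hitting H Ls" "A \<inter> S = {}" by (auto simp: B_def bad_sets_def)
        have "A \<inter> joints H \<notin> hitting H Ls"
        proof
          assume "A \<inter> joints H \<in> hitting H Ls"
          then have "(A \<inter> joints H) \<inter> S \<noteq> {}" using int S(1) by (simp add: intersecting_def)
          then show False using S(2) by blast
        qed
        then show "A \<in> rare n (k n) H Ls" using candidates_cases[OF good] A BC unfolding C_def by blast
      qed
      have d_lower: "real (card X) - real (h + l) \<le> real (d E)" if "X \<subseteq> {A \<in> L. A \<inter> E = {}}" for X E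
      proof -
        have "X - set (H @ Ls) \<subseteq> {A \<in> L - set (H @ Ls). A \<inter> E = {}}" using that by auto
        then have "card (X - set (H @ Ls)) \<le> d E" unfolding d_def using fL by (intro card_mono) auto
        moreover have "card X - card (set (H @ Ls)) \<le> card (X - set (H @ Ls))"
          by (rule diff_card_le_card_Diff) simp
        moreover have "card (set (H @ Ls)) \<le> h + l" using card_length[of "H @ Ls"] h l by simp
        ultimately show ?thesis by linarith
      qed
      \<comment> \<open>Every bad set has at least order \<open>unit (4 * h)\<close> blockers. Sets
        with more than \<open>4 * h\<close> points on early edges are fewer than that by a factor of
        order \<open>1 / k\<close>, hence the threshold.\<close>
      define Hv where "Hv = {A \<in> ksubsets n (k n). card (A \<inter> points H) > 4 * h}"
      have fHv: "finite Hv" using finite_ksubsets by (simp add: Hv_def)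
      have light: "(\<mu> h / 4) * unit h n \<le> real (d E)" if E: "E \<in> B - Hv" for E
      proof -
        obtain S where S: "S \<in> hitting H Ls" "E \<inter> S = {}" using E by (auto simp: B_def bad_sets_def)
        have Ek: "E \<in> ksubsets n (k n)" using E BC by (auto simp: C_def candidates_def)
        have Sind: "S \<in> indep H" using S(1) hitting_subset by blast
        define X where "X = {A \<in> exact_sets n (k n) H S. A \<inter> E = {}}"
        have "X \<subseteq> {A \<in> L. A \<inter> E = {}}"
          using exact_sets_hit[OF good S(1)] S(1) by (auto simp: X_def L_def exact_sets_def)
        note dX = d_lower[OF this]
        have "card (E \<inter> points H) \<le> 4 * h" using E Ek by (simp add: Hv_def)
        then have "(\<gamma> ^ (h - card S) - \<mu> h / 2) * unit h n \<le> real (card X)"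
          using elim(2)[rule_format, OF nice h Sind, of E] ksubsetsD[OF Ek] S(2) by (simp add: X_def)
        moreover have "\<mu> h \<le> \<gamma> ^ (h - card S)" by (rule \<mu>_le_power) simp
        then have "(\<mu> h / 2) * unit h n \<le> (\<gamma> ^ (h - card S) - \<mu> h / 2) * unit h n"
          using elim(5) by (intro mult_right_mono) auto
        ultimately show ?thesis using dX elim(3) by linarith
      qed
      have heavy: "(c0 / 2) * unit (4 * h) n \<le> real (d E)" if E: "E \<in> B" for E
      proof -
        obtain S where S: "S \<in> hitting H Ls" "E \<inter> S = {}" using E by (auto simp: B_def bad_sets_def)
        have Ek: "E \<in> ksubsets n (k n)" "E \<notin> set H" using E BC by (auto simp: C_def candidates_def)
        have Sind: "S \<in> indep H" using S(1) hitting_subset by blast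
        define X where "X = {A \<in> ksubsets n (k n). S \<subseteq> A \<and> (\<forall>F\<in>set H. A \<inter> F \<noteq> {}) \<and> A \<inter> E = {}}"
        have "X \<subseteq> {A \<in> L. A \<inter> E = {}}" using S(1) by (auto simp: X_def L_def)
        note dX = d_lower[OF this]
        define K where "K = real (k n)"
        have K: "K > 0" "real n > 0" using elim(8,9) by (auto simp: K_def)
        have sh: "shrink h n \<ge> 1 / 2" using elim(12) by simp
        have X: "real (k n - 2 * h) ^ (2 * h) * W n * shrink h n \<le> real (card X) * real n ^ (2 * h)"
          using card_avoiding_lower[OF nice Sind Ek S(2), of "dd h n"] elim(8,12)
          by (simp add: h X_def W_def shrink_def)
        have "real n * (\<gamma> / (4 * K ^ 2)) \<le> K / 2"
          using elim(11) K \<gamma>_pos by (simp add: K_def field_simps power2_eq_square power3_eq_cube)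
        also have "K / 2 \<le> real (k n - 2 * h)" using elim(8) by (simp add: K_def)
        finally have "real n ^ (2 * h) * (\<gamma> / (4 * K ^ 2)) ^ (2 * h) \<le> real (k n - 2 * h) ^ (2 * h)"
          unfolding power_mult_distrib[symmetric] using K \<gamma>_pos by (intro power_mono) auto
        then have "(real n ^ (2 * h) * (\<gamma> / (4 * K ^ 2)) ^ (2 * h)) * (W n * (1 / 2))
            \<le> real (k n - 2 * h) ^ (2 * h) * (W n * shrink h n)"
          using sh by (intro mult_mono) (auto simp: W_def)
        then have "real n ^ (2 * h) * ((\<gamma> / (4 * K ^ 2)) ^ (2 * h) * W n / 2) \<le> real n ^ (2 * h) * real (card X)"
          using X by (simp add: mult_ac)
        then have "(\<gamma> / (4 * K ^ 2)) ^ (2 * h) * W n / 2 \<le> real (card X)"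
          using K by (subst (asm) mult_le_cancel_left_pos) auto
        moreover have "(\<gamma> / (4 * K ^ 2)) ^ (2 * h) * W n / 2 = c0 * unit (4 * h) n"
        proof -
          have "(\<gamma> / (4 * K ^ 2)) ^ (2 * h) = (\<gamma> / 4) ^ (2 * h) / K ^ (4 * h)"
            by (simp add: power_divide power_mult_distrib power_mult[symmetric])
          then show ?thesis by (simp add: c0_def unit_def K_def)
        qed
        ultimately show ?thesis using dX elim(4) by linarith
      qed
      have card_Hv: "real (card Hv) \<le> e / 2 * (c0 / 2) * unit (4 * h) n"
      proof -
        have pts: "points H \<subseteq> {1..n}" "card (points H) \<le> (h + 1) * k n"
          using points_subset[OF nice_ksubsets[OF nice]] card_points_le[OF nice_ksubsets[OF nice]] h by auto
        have "real (card Hv) \<le> Ch * real (n choose k n) / real (k n) ^ (4 * h + 1)"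
          unfolding Ch_def
        proof (rule card_ksubsets_weight[of _ _ _ "{}" 0 "points H"])
          fix A assume A: "A \<in> Hv"
          then have "4 * h + 1 \<le> card (A \<inter> points H)" by (simp add: Hv_def)
          then obtain X where X: "X \<subseteq> A \<inter> points H" "card X = 4 * h + 1"
            by (meson obtain_subset_with_card_n)
          moreover have "X \<inter> points H = X" using X(1) by auto
          ultimately show "\<exists>X\<subseteq>A. X \<subseteq> {} \<union> points H \<and> card X \<le> 4 * h + 1
             \<and> 4 * h + 1 \<le> 2 * card (X \<inter> {}) + card (X \<inter> points H)"
            by (intro exI[of _ X]) auto
        qed (use elim(8,9,10) D1 pts in \<open>auto simp: Hv_def\<close>)
        also have "\<dots> = Ch / real (k n) * unit (4 * h) n" by (simp add: unit_def W_def)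
        also have "\<dots> \<le> e / 2 * (c0 / 2) * unit (4 * h) n"
          using elim(6,7) by (intro mult_right_mono) auto
        finally show ?thesis .
      qed
      have card_B: "real (card B) \<le> e / 2 * (\<mu> h / 4) * unit h n"
      proof -
        have "card B \<le> card (rare n (k n) H Ls)"
          using B_rare by (intro card_mono finite_subset[OF _ finite_ksubsets[of n "k n"]]) (auto simp: rare_def)
        moreover have "real (card (rare n (k n) H Ls)) \<le> e / 2 * (\<mu> h / 4) * unit h n"
          using elim(1) good h l by blast
        ultimately show ?thesis by linarith
      qed
      define a b where "a = (\<mu> h / 4) * unit h n" and "b = (c0 / 2) * unit (4 * h) n"
      have ab: "a > 0" "b > 0" using m elim(5,6) by (auto simp: a_def b_def)
      have weight: "1 / (1 + real (d E)) \<le> (if E \<in> Hv then 1 / b else 1 / a)" if "E \<in> B" for E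
        using heavy[OF that, folded b_def] light[of E, folded a_def] that ab by (auto intro!: frac_le)
      have "measure_pmf.prob (run n (k n) N (H @ Ls)) {Es. set Es \<inter> B \<noteq> {}}
         \<le> (\<Sum>E\<in>B \<inter> candidates n (k n) (H @ Ls). 1 / (1 + real (d E)))"
        unfolding d_def
      proof (rule prob_run_bad_le)
        show "L \<inter> B = {}"
        proof (rule ccontr)
          assume "L \<inter> B \<noteq> {}"
          then obtain A S T where A: "S \<in> hitting H Ls" "S \<subseteq> A" "T \<in> hitting H Ls" "A \<inter> T = {}"
            by (auto simp: L_def B_def bad_sets_def)
          then have "S \<inter> T \<noteq> {}" using int by (simp add: intersecting_def)
          then show False using A by blast
        qed
        show "L \<subseteq> ksubsets n (k n)" by (auto simp: L_def)
        show "A \<inter> E \<noteq> {}" if A: "A \<in> L" and E: "E \<in> set (H @ Ls)" for A E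
        proof (cases "E \<in> set H")
          case False
          then have "E \<in> set Ls" using E by simp
          moreover obtain S where "S \<in> hitting H Ls" "S \<subseteq> A" using A by (auto simp: L_def)
          ultimately have "S \<inter> E \<noteq> {}" "S \<subseteq> A" by (auto simp: hitting_def)
          then show ?thesis by blast
        qed (use A in \<open>simp add: L_def\<close>)
        show "A \<inter> E \<noteq> {}" if A: "A \<in> L" and E: "E \<in> candidates n (k n) (H @ Ls)" "E \<notin> B" for A E
        proof -
          obtain S where S: "S \<in> hitting H Ls" "S \<subseteq> A" using A by (auto simp: L_def)
          then have "E \<inter> S \<noteq> {}" using E by (auto simp: B_def bad_sets_def)
          then show ?thesis using S(2) by blast
        qed
        show "B \<inter> set (H @ Ls) = {}" using BC by (auto simp: C_def candidates_def)
      qed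
      also have "B \<inter> candidates n (k n) (H @ Ls) = B" using BC by (auto simp: C_def)
      also have "(\<Sum>E\<in>B. 1 / (1 + real (d E))) \<le> (\<Sum>E\<in>B. if E \<in> Hv then 1 / b else 1 / a)"
        by (intro sum_mono weight)
      also have "\<dots> = real (card (B \<inter> Hv)) * (1 / b) + real (card (B - Hv)) * (1 / a)"
      proof -
        have "B \<inter> {E. E \<in> Hv} = B \<inter> Hv" "B \<inter> - {E. E \<in> Hv} = B - Hv" by auto
        then show ?thesis using fB by (simp add: sum.If_cases)
      qed
      also have "\<dots> \<le> real (card Hv) * (1 / b) + real (card B) * (1 / a)"
        using ab fB fHv by (intro add_mono mult_right_mono of_nat_mono card_mono) auto
      also have "\<dots> \<le> (e / 2 * b) * (1 / b) + (e / 2 * a) * (1 / a)"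
        using ab card_Hv card_B by (intro add_mono mult_right_mono) (auto simp: a_def b_def mult.assoc)
      also have "\<dots> = e" using ab by simp
      finally show "measure_pmf.prob (run n (k n) N (H @ Ls)) {Es. set Es \<inter> bad_sets n H Ls \<noteq> {}} \<le> e"
        by (simp add: B_def)
    qed
  qed
qed

text \<open>Collects all that is required of a random history: for large \<open>n\<close>, the
  assertions (a) to (c) follow from it deterministically, with \<open>K\<close> as bound for
  \<open>r_1\<close>.\<close>

definition settled :: "nat \<Rightarrow> nat \<Rightarrow> nat set list \<Rightarrow> bool" where
  "settled n K Es \<longleftrightarrow> (\<exists>H Ls Fs. Es = H @ Ls @ Fs \<and> length (H @ Ls) = K \<and> good n (k n) H Ls \<and> Ls \<noteq> []
     \<and> intersecting (hitting H Ls) \<and> set Fs \<subseteq> candidates n (k n) (H @ Ls)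
     \<and> (\<forall>A\<in>set Fs. \<forall>S\<in>hitting H Ls. A \<inter> S \<noteq> {}) \<and> candidates n (k n) Es = {})"

lemma ev_choose_ge: "eventually (\<lambda>n. i \<le> n choose k n) sequentially"
  using ev_W_large[of i 0] by eventually_elim (simp add: W_def)

text \<open>A history finished at time \<open>K\<close> can fail to be settled only through a later
  bad choice, whose probability \<open>ev_exit\<close> bounds for any number of further
  rounds.\<close>

lemma settled_tight:
  assumes "e > 0"
  shows "\<exists>K. eventually (\<lambda>n. measure_pmf.prob (intersecting_process n (k n)) {Es. \<not> settled n K Es} \<le> e) sequentially"
proof -
  have e2: "e / 2 > 0" using assms by simp
  obtain K where K: "eventually (\<lambda>n. measure_pmf.prob (R n K) {Es. \<not> finished n K Es} \<le> e / 2) sequentially"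
    using finished_tight[OF e2] by blast
  have "eventually (\<lambda>n. \<forall>h\<in>{..K}. \<forall>H Ls. good n (k n) H Ls \<longrightarrow> length H = h \<longrightarrow> length Ls = K - h \<longrightarrow> Ls \<noteq> [] \<longrightarrow>
     intersecting (hitting H Ls) \<longrightarrow>
     (\<forall>N. measure_pmf.prob (run n (k n) N (H @ Ls)) {Es. set Es \<inter> bad_sets n H Ls \<noteq> {}} \<le> e / 2)) sequentially"
    by (intro eventually_ball_finite ballI ev_exit[OF e2]) simp
  then have "eventually (\<lambda>n. measure_pmf.prob (intersecting_process n (k n)) {Es. \<not> settled n K Es} \<le> e) sequentially"
    using K ev_choose_ge[of K]
  proof eventually_elim
    case (elim n)
    define N where "N = (n choose k n) - K"
    have proc: "intersecting_process n (k n) = bind_pmf (R n K) (run n (k n) N)"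
      unfolding intersecting_process_eq_run run_add[symmetric] N_def using elim(3) by simp
    have "measure_pmf.prob (bind_pmf (R n K) (run n (k n) N)) {Es. \<not> settled n K Es}
       \<le> measure_pmf.prob (R n K) {Es. \<not> finished n K Es} + e / 2"
    proof (rule prob_bind_pmf_le)
      fix Es assume Es: "Es \<in> set_pmf (R n K)" and fin: "finished n K Es"
      obtain H Ls where HL: "length Es = K" "Es = H @ Ls" "good n (k n) H Ls" "Ls \<noteq> []" "intersecting (hitting H Ls)"
        using fin by (auto simp: finished_def)
      have "measure_pmf.prob (run n (k n) N Es) {Es'. \<not> settled n K Es'}
         \<le> measure_pmf.prob (run n (k n) N Es) {Es'. set Es' \<inter> bad_sets n H Ls \<noteq> {}}"
      proof (intro measure_pmf.finite_measure_mono_AE AE_pmfI impI)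
        fix Es' assume Es': "Es' \<in> set_pmf (run n (k n) N Es)" and ns: "Es' \<in> {Es'. \<not> settled n K Es'}"
        obtain Fs where Fs: "Es' = Es @ Fs" "set Fs \<subseteq> candidates n (k n) Es" using run_extends[OF Es'] by blast
        have "Es' \<in> set_pmf (intersecting_process n (k n))" unfolding proc using Es Es' by auto
        then have stop: "candidates n (k n) Es' = {}" by (rule candidates_final)
        show "Es' \<in> {Es'. set Es' \<inter> bad_sets n H Ls \<noteq> {}}"
        proof (rule ccontr)
          assume "Es' \<notin> {Es'. set Es' \<inter> bad_sets n H Ls \<noteq> {}}"
          then have nb: "set Fs \<inter> bad_sets n H Ls = {}" using Fs(1) by auto
          have "A \<inter> S \<noteq> {}" if "A \<in> set Fs" "S \<in> hitting H Ls" for A S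
            using nb Fs(2) that HL(2) by (auto simp: bad_sets_def)
          then have "settled n K Es'" unfolding settled_def
            using HL Fs stop by (intro exI[of _ H] exI[of _ Ls] exI[of _ Fs]) simp
          then show False using ns by simp
        qed
      qed simp
      also have "\<dots> \<le> e / 2" using elim(1)[rule_format, of "length H" H Ls N] HL by auto
      finally show "measure_pmf.prob (run n (k n) N Es) {Es'. \<not> settled n K Es'} \<le> e / 2" .
    qed (use assms in simp)
    then show ?case unfolding proc using elim(2) by linarith
  qed
  then show ?thesis by blast
qed

text \<open>The lower, the final and the upper family all contain the exact sets over the
  transversals, and what they contain besides is rare.\<close>

lemma ev_settled_consequences:
  assumes "d > 0"
  shows "eventually (\<lambda>n. \<forall>Es. settled n K Es \<longrightarrow> time1 Es \<le> enat K
     \<and> lower_family n (k n) Es \<subseteq> set Es \<and> set Es \<subseteq> upper_family n (k n) Es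
     \<and> real (card (upper_family n (k n) Es - lower_family n (k n) Es)) \<le> d * real (card (lower_family n (k n) Es))
     \<and> (\<forall>S\<in>final_transversals Es. card S \<le> before0 Es)
     \<and> (\<exists>\<epsilon>. \<bar>\<epsilon>\<bar> \<le> d \<and> real (card (set Es)) / W n
          = (1 + \<epsilon>) * (total (before0 Es) (final_transversals Es) / real (k n) ^ before0 Es))) sequentially"
proof -
  \<comment> \<open>The first bound leaves at least half of the total count; the second makes twice
    the error at most \<open>d\<close> times the total.\<close>
  define e1 where "e1 h = min (\<mu> h / 2) (d * \<mu> h / 2)" for h
  have e1: "e1 h > 0" "e1 h \<le> \<mu> h / 2" "e1 h \<le> d * \<mu> h / 2" for h
    using assms \<mu>_pos[of h] by (simp_all add: e1_def)
  have r: "eventually (\<lambda>n. \<forall>h\<in>{..K}. \<forall>H Ls. good n (k n) H Ls \<longrightarrow> length H = h \<longrightarrow> length Ls = K - h \<longrightarrow>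
     real (card (rare n (k n) H Ls)) \<le> e1 h * unit h n) sequentially"
    by (intro eventually_ball_finite ballI ev_rare_small e1(1)) simp
  have x: "eventually (\<lambda>n. \<forall>h\<in>{..K}. \<forall>H Ls. good n (k n) H Ls \<longrightarrow> length H = h \<longrightarrow>
     (total h (hitting H Ls) - e1 h) * unit h n \<le> real (card (\<Union>S\<in>hitting H Ls. exact_sets n (k n) H S))
   \<and> real (card (\<Union>S\<in>hitting H Ls. exact_sets n (k n) H S)) \<le> (total h (hitting H Ls) + e1 h) * unit h n) sequentially"
    by (intro eventually_ball_finite ballI ev_exact_sum e1(1)) simp
  show ?thesis using r x ev_k_ge[of 2] ev_W_pos
  proof eventually_elim
    case (elim n)
    show ?case
    proof (intro allI impI)
      fix Es assume "settled n K Es"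
      then obtain H Ls Fs where st: "Es = H @ Ls @ Fs \<and> length (H @ Ls) = K \<and> good n (k n) H Ls \<and> Ls \<noteq> []
         \<and> intersecting (hitting H Ls) \<and> set Fs \<subseteq> candidates n (k n) (H @ Ls)
         \<and> (\<forall>A\<in>set Fs. \<forall>S\<in>hitting H Ls. A \<inter> S \<noteq> {}) \<and> candidates n (k n) Es = {}"
        unfolding settled_def by (elim exE) (rule that)
      have Es: "Es = H @ Ls @ Fs" using st by (elim conjE)
      have len: "length (H @ Ls) = K" using st by (elim conjE)
      have good: "good n (k n) H Ls" using st by (elim conjE)
      have Ls: "Ls \<noteq> []" using st by (elim conjE)
      have int: "intersecting (hitting H Ls)" using st by (elim conjE)
      have stop: "candidates n (k n) Es = {}" using st by (elim conjE)
      have Fs1: "set Fs \<subseteq> candidates n (k n) (H @ Ls)" using st by (elim conjE)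
      have Fs2: "\<forall>A\<in>set Fs. \<forall>S\<in>hitting H Ls. A \<inter> S \<noteq> {}" using st by (elim conjE)
      note Fs = Fs1 Fs2[rule_format]
      define h where "h = length H"
      define X where "X = (\<Union>S\<in>hitting H Ls. exact_sets n (k n) H S)"
      define T where "T = total h (hitting H Ls)"
      define U where "U = unit h n"
      have hK: "h \<in> {..K}" "length Ls = K - h" using len by (auto simp: h_def)
      have U: "U > 0" using elim(3,4) by (simp add: U_def unit_def)
      have t1: "time1 Es \<le> enat K" "final_transversals Es = hitting H Ls"
        using time1_good[OF good Ls Es int] len by simp_all
      have b0: "before0 Es = h" using before0_good[OF good Ls Es] by (simp add: h_def)
      note between = final_family_between[OF good Ls Es int elim(3) Fs stop]
      have low: "X \<subseteq> lower_family n (k n) Es"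
        unfolding X_def by (rule lower_family_superset[OF good Ls Es int elim(3)])
      have up: "upper_family n (k n) Es \<subseteq> rare n (k n) H Ls \<union> X"
        unfolding X_def by (rule upper_family_subset[OF good Ls Es int elim(3)])
      have rare: "real (card (rare n (k n) H Ls)) \<le> e1 h * U"
        using elim(1)[rule_format, OF hK(1) good h_def[symmetric] hK(2)] unfolding U_def .
      have X: "(T - e1 h) * U \<le> real (card X)" "real (card X) \<le> (T + e1 h) * U"
        using elim(2)[rule_format, OF hK(1) good h_def[symmetric]] unfolding U_def T_def X_def by simp_all
      have T: "\<mu> h \<le> T" "T > 0" using total_bounds(1)[OF good h_def[symmetric]] \<mu>_pos[of h] by (auto simp: T_def)
      have fR: "finite (rare n (k n) H Ls)"
        by (rule finite_subset[OF _ finite_ksubsets[of n "k n"]]) (auto simp: rare_def)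
      have fX: "finite X" unfolding X_def
        by (rule finite_subset[OF _ finite_ksubsets[of n "k n"]]) (auto simp: exact_sets_def)
      have fl: "finite (lower_family n (k n) Es)" using between(1) finite_subset by blast
      have cl: "card X \<le> card (lower_family n (k n) Es)" by (rule card_mono[OF fl low])
      have "upper_family n (k n) Es - lower_family n (k n) Es \<subseteq> rare n (k n) H Ls" using low up by blast
      then have "card (upper_family n (k n) Es - lower_family n (k n) Es) \<le> card (rare n (k n) H Ls)"
        by (rule card_mono[OF fR])
      then have "real (card (upper_family n (k n) Es - lower_family n (k n) Es)) \<le> e1 h * U"
        using rare by linarith
      also have "\<dots> \<le> (d * (\<mu> h / 2)) * U" using e1(3)[of h] U by (intro mult_right_mono) auto
      also have "\<dots> \<le> d * ((T - e1 h) * U)"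
      proof -
        have "\<mu> h / 2 \<le> T - e1 h" using e1(2)[of h] T(1) by linarith
        then have "(\<mu> h / 2) * U \<le> (T - e1 h) * U" using U by (intro mult_right_mono) auto
        then show ?thesis unfolding mult.assoc using assms by (intro mult_left_mono) auto
      qed
      also have "\<dots> \<le> d * real (card (lower_family n (k n) Es))"
        using X(1) cl assms by (intro mult_left_mono) auto
      finally have c1: "real (card (upper_family n (k n) Es - lower_family n (k n) Es))
        \<le> d * real (card (lower_family n (k n) Es))" .
      have "card X \<le> card (set Es)" using low between(1) by (intro card_mono) auto
      then have s1: "(T - e1 h) * U \<le> real (card (set Es))" using X(1) by linarith
      have "card (set Es) \<le> card (rare n (k n) H Ls \<union> X)" using up between(2) fR fX by (intro card_mono) auto
      also have "\<dots> \<le> card (rare n (k n) H Ls) + card X" by (rule card_Un_le)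
      finally have s2: "real (card (set Es)) \<le> (T + 2 * e1 h) * U" using rare X(2) by (simp add: algebra_simps)
      define \<epsilon> where "\<epsilon> = real (card (set Es)) / (T * U) - 1"
      have dT: "e1 h * U \<le> d * (T * U)" "2 * e1 h * U \<le> d * (T * U)"
      proof -
        have "2 * e1 h \<le> d * T" using e1(3)[of h] mult_left_mono[OF T(1), of d] assms by linarith
        then show "2 * e1 h * U \<le> d * (T * U)" using U by (simp add: mult.assoc[symmetric])
        moreover have "e1 h * U \<le> 2 * e1 h * U" using e1(1)[of h] U by simp
        ultimately show "e1 h * U \<le> d * (T * U)" by linarith
      qed
      have TU: "T * U > 0" using T U by simp
      have "\<bar>real (card (set Es)) - T * U\<bar> \<le> d * (T * U)"
      proof -
        have "(T - e1 h) * U = T * U - e1 h * U" "(T + 2 * e1 h) * U = T * U + 2 * e1 h * U"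
          by (simp_all add: algebra_simps)
        then show ?thesis using s1 s2 dT unfolding abs_le_iff by linarith
      qed
      then have eps: "\<bar>\<epsilon>\<bar> \<le> d"
      proof -
        have "\<epsilon> = (real (card (set Es)) - T * U) / (T * U)" using T(2) U by (simp add: \<epsilon>_def diff_divide_distrib)
        then have "\<bar>\<epsilon>\<bar> = \<bar>real (card (set Es)) - T * U\<bar> / (T * U)" using TU by (simp only: abs_divide abs_of_pos)
        then show ?thesis using \<open>\<bar>real (card (set Es)) - T * U\<bar> \<le> d * (T * U)\<close> TU by (simp add: pos_divide_le_eq)
      qed
      have "real (card (set Es)) = (1 + \<epsilon>) * (T * U)" using T(2) U by (simp add: \<epsilon>_def)
      then have "real (card (set Es)) / W n = (1 + \<epsilon>) * (T / real (k n) ^ h)"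
        using elim(4) by (simp add: U_def unit_def)
      moreover have "card S \<le> h" if "S \<in> hitting H Ls" for S
        using card_indep_le[OF good_nice[OF good], of S] hitting_subset that by (fastforce simp: h_def)
      ultimately show "time1 Es \<le> enat K
     \<and> lower_family n (k n) Es \<subseteq> set Es \<and> set Es \<subseteq> upper_family n (k n) Es
     \<and> real (card (upper_family n (k n) Es - lower_family n (k n) Es)) \<le> d * real (card (lower_family n (k n) Es))
     \<and> (\<forall>S\<in>final_transversals Es. card S \<le> before0 Es)
     \<and> (\<exists>\<epsilon>. \<bar>\<epsilon>\<bar> \<le> d \<and> real (card (set Es)) / W n
          = (1 + \<epsilon>) * (total (before0 Es) (final_transversals Es) / real (k n) ^ before0 Es))"
        unfolding t1(2) b0 T_def[symmetric] using t1(1) between c1 eps by blast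
    qed
  qed
qed

text \<open>A nice prefix of length \<open>i\<close> forces \<open>r_0 > i\<close>. For good
  prefixes the converse holds, so the two probabilities differ by at most that of a prefix that is
  not good.\<close>

lemma time0_greater_tendsto:
  "(\<lambda>n. measure_pmf.prob (intersecting_process n (k n)) {Es. time0 Es > enat i}) \<longlonglongrightarrow> nice_limit i"
proof -
  have "(\<lambda>n. measure_pmf.prob (intersecting_process n (k n)) {Es. time0 Es > enat i}
      - measure_pmf.prob (R n i) {Es. nice_state n (k n) i Es}) \<longlonglongrightarrow> 0"
  proof (rule tendsto_sandwich[OF _ _ tendsto_const good_state_tendsto[of i]])
    show "eventually (\<lambda>n. 0 \<le> measure_pmf.prob (intersecting_process n (k n)) {Es. time0 Es > enat i}
      - measure_pmf.prob (R n i) {Es. nice_state n (k n) i Es}) sequentially"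
      using ev_choose_ge[of i]
    proof eventually_elim
      case (elim n)
      have "{Es. nice_state n (k n) i (take i Es)} \<subseteq> {Es. time0 Es > enat i}"
        using time0_greater[of n "k n" i] by (auto simp: nice_state_def)
      from measure_pmf.finite_measure_mono[OF this, of "intersecting_process n (k n)"]
      show ?case unfolding prob_process_take[OF elim] by simp
    qed
    show "eventually (\<lambda>n. measure_pmf.prob (intersecting_process n (k n)) {Es. time0 Es > enat i}
      - measure_pmf.prob (R n i) {Es. nice_state n (k n) i Es}
      \<le> measure_pmf.prob (R n i) {Es. \<not> good_state n (k n) i Es}) sequentially"
      using ev_choose_ge[of i]
    proof eventually_elim
      case (elim n)
      let ?P = "measure_pmf.prob (intersecting_process n (k n))"
      have "{Es. time0 Es > enat i} \<subseteq> {Es. nice_state n (k n) i (take i Es)} \<union> {Es. \<not> good_state n (k n) i (take i Es)}"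
      proof
        fix Es assume t: "Es \<in> {Es. time0 Es > enat i}"
        have "nice_state n (k n) i (take i Es)" if g: "good_state n (k n) i (take i Es)"
        proof -
          obtain H Ls where HL': "length (take i Es) = i" "take i Es = H @ Ls" "good n (k n) H Ls"
            using g unfolding good_state_def by blast
          then have HL: "take i Es = H @ Ls" "good n (k n) H Ls" "length (H @ Ls) = i" by simp_all
          have Es: "Es = H @ Ls @ drop i Es" using HL(1) append_take_drop_id[of i Es] by simp
          have "Ls = []"
          proof (rule ccontr)
            assume Ls: "Ls \<noteq> []"
            have "time0 Es = enat (length H + 1)" by (rule time0_good[OF HL(2) Ls Es])
            moreover have "length H + 1 \<le> i" using HL(3) Ls by (cases Ls) auto
            ultimately show False using t by simp
          qed
          then show ?thesis using HL good_nice[OF HL(2)] by (simp add: nice_state_def)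
        qed
        then show "Es \<in> {Es. nice_state n (k n) i (take i Es)} \<union> {Es. \<not> good_state n (k n) i (take i Es)}" by blast
      qed
      then have "?P {Es. time0 Es > enat i}
        \<le> ?P ({Es. nice_state n (k n) i (take i Es)} \<union> {Es. \<not> good_state n (k n) i (take i Es)})"
        by (intro measure_pmf.finite_measure_mono) auto
      also have "\<dots> \<le> ?P {Es. nice_state n (k n) i (take i Es)} + ?P {Es. \<not> good_state n (k n) i (take i Es)}"
        by (rule measure_Un_le) auto
      finally show ?case
        unfolding prob_process_take[OF elim] using prob_process_take[OF elim, of "\<lambda>Es. \<not> good_state n (k n) i Es"] by simp
    qed
  qed
  from tendsto_add[OF this nice_state_tendsto[of i]] show ?thesis by simp
qed

end

section \<open>Limits and the generating function\<close>

lemma tendsto_1_if_eventually_ge: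
  fixes p :: "nat \<Rightarrow> real"
  assumes "\<And>n. p n \<le> 1" and "\<And>e. e > 0 \<Longrightarrow> eventually (\<lambda>n. 1 - e \<le> p n) sequentially"
  shows "p \<longlonglongrightarrow> 1"
proof (rule order_tendstoI)
  fix a :: real assume "a < 1"
  then have "eventually (\<lambda>n. 1 - (1 - a) / 2 \<le> p n) sequentially" by (intro assms(2)) simp
  then show "eventually (\<lambda>n. a < p n) sequentially"
    using \<open>a < 1\<close> by (elim eventually_mono) (simp add: field_simps)
next
  fix a :: real assume "1 < a"
  then show "eventually (\<lambda>n. p n < a) sequentially"
    using assms(1) by (intro always_eventually) (auto intro: le_less_trans)
qed

text \<open>The time \<open>K\<close> may depend on \<open>e\<close>, whereas for each fixed
  \<open>K\<close> the implication is deterministic as soon as \<open>n\<close> is large.\<close>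

lemma whp_if_eventually_implied:
  assumes tight: "\<And>e. e > 0 \<Longrightarrow> \<exists>K. eventually (\<lambda>n. measure_pmf.prob (M n) {x. \<not> G K n x} \<le> e) sequentially"
    and imp: "\<And>K. eventually (\<lambda>n. \<forall>x. G K n x \<longrightarrow> P n x) sequentially"
  shows "whp M P"
  unfolding whp_def
proof (rule tendsto_1_if_eventually_ge)
  fix e :: real assume "e > 0"
  then obtain K where "eventually (\<lambda>n. measure_pmf.prob (M n) {x. \<not> G K n x} \<le> e) sequentially"
    using tight by blast
  then show "eventually (\<lambda>n. 1 - e \<le> measure_pmf.prob (M n) {x. P n x}) sequentially"
    using imp[of K]
  proof eventually_elim
    case (elim n)
    have "measure_pmf.prob (M n) {x. \<not> P n x} \<le> measure_pmf.prob (M n) {x. \<not> G K n x}"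
      using elim(2) by (intro measure_pmf.finite_measure_mono) auto
    moreover have "measure_pmf.prob (M n) {x. \<not> P n x} = 1 - measure_pmf.prob (M n) {x. P n x}"
    proof -
      have "{x. \<not> P n x} = space (measure_pmf (M n)) - {x. P n x}" by auto
      then show ?thesis using measure_pmf.prob_compl[of "{x. P n x}" "M n"] by simp
    qed
    ultimately show ?case using elim(1) by linarith
  qed
qed simp

text \<open>\<open>f n\<close> is the largest index up to \<open>n\<close> whose threshold has been
  passed at \<open>n\<close>, so it grows as slowly as required.\<close>

lemma eventually_diagonal:
  fixes P :: "nat \<Rightarrow> nat \<Rightarrow> bool"
  assumes "\<And>j. eventually (P j) sequentially"
  obtains f where "filterlim f at_top sequentially" "eventually (\<lambda>n. P (f n) n) sequentially"
proof -
  have "\<forall>j. \<exists>m. \<forall>n\<ge>m. P j n" using assms by (simp add: eventually_sequentially)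
  from choice[OF this] obtain N where N: "\<And>j n. N j \<le> n \<Longrightarrow> P j n" by blast
  \<comment> \<open>The inserted 0 keeps the maximum defined; it is a valid index from
    \<open>N 0\<close> on.\<close>
  define J where "J n = insert 0 {j. j \<le> n \<and> N j \<le> n}" for n
  define f where "f n = Max (J n)" for n
  have fJ: "finite (J n)" for n
    by (rule finite_subset[of _ "{..n}"]) (auto simp: J_def)
  have f_in: "f n \<in> J n" for n unfolding f_def using fJ[of n] by (intro Max_in) (auto simp: J_def)
  have f_ge: "j \<le> f n" if "j \<le> n" "N j \<le> n" for j n
    unfolding f_def using fJ[of n] that by (intro Max_ge) (auto simp: J_def)
  have "filterlim f at_top sequentially" unfolding filterlim_at_top
  proof
    fix j
    show "eventually (\<lambda>n. j \<le> f n) sequentially"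
      using eventually_ge_at_top[of "max j (N j)"] by eventually_elim (simp add: f_ge)
  qed
  moreover have "eventually (\<lambda>n. P (f n) n) sequentially"
    using eventually_ge_at_top[of "N 0"]
  proof eventually_elim
    case (elim n)
    then show ?case using f_in[of n] N by (auto simp: J_def)
  qed
  ultimately show ?thesis by (rule that)
qed

text \<open>A diagonal choice among the tolerances \<open>1 / (j + 1)\<close> turns statements for
  each fixed \<open>d\<close> into one with a null sequence, as the o(1) terms in (c)
  demand.\<close>

lemma whp_vanishing_tolerance:
  assumes "\<And>d. d > 0 \<Longrightarrow> whp M (Q d)"
  obtains \<delta> :: "nat \<Rightarrow> real" where "\<delta> \<longlonglongrightarrow> 0" "whp M (\<lambda>n. Q (\<delta> n) n)"
proof -
  define dj where "dj j = inverse (real (Suc j))" for j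
  have "eventually (\<lambda>n. 1 - dj j \<le> measure_pmf.prob (M n) {x. Q (dj j) n x}) sequentially" for j
  proof -
    have "eventually (\<lambda>n. 1 - dj j < measure_pmf.prob (M n) {x. Q (dj j) n x}) sequentially"
      using assms[of "dj j"] unfolding whp_def by (intro order_tendstoD(1)) (auto simp: dj_def)
    then show ?thesis by (elim eventually_mono) simp
  qed
  from eventually_diagonal[of "\<lambda>j n. 1 - dj j \<le> measure_pmf.prob (M n) {x. Q (dj j) n x}", OF this]
  obtain f where f: "filterlim f at_top sequentially"
    "eventually (\<lambda>n. 1 - dj (f n) \<le> measure_pmf.prob (M n) {x. Q (dj (f n)) n x}) sequentially" by blast
  have "dj \<longlonglongrightarrow> 0" unfolding dj_def by (rule LIMSEQ_inverse_real_of_nat)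
  then have lim: "(\<lambda>n. dj (f n)) \<longlonglongrightarrow> 0" using f(1) by (rule filterlim_compose)
  have "whp M (\<lambda>n. Q (dj (f n)) n)" unfolding whp_def
  proof (rule tendsto_1_if_eventually_ge)
    fix e :: real assume "e > 0"
    then have "eventually (\<lambda>n. dj (f n) < e) sequentially" by (intro order_tendstoD(2)[OF lim])
    then show "eventually (\<lambda>n. 1 - e \<le> measure_pmf.prob (M n) {x. Q (dj (f n)) n x}) sequentially"
      using f(2) by eventually_elim linarith
  qed simp
  with lim show ?thesis by (rule that)
qed

text \<open>The series \<open>G = exp (x + t * x ^ 2 / 2)\<close> satisfies
  \<open>G' = (1 + t * x) * G\<close>. Comparing coefficients gives the recursion of
  \<open>matching_poly\<close>, divided by factorials.\<close>

lemma egf_matching_poly: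
  "egf (matching_poly t) = fps_exp 1 * (fps_compose (fps_exp (t / 2)) (fps_X ^ 2))"
proof -
  define E where "E = fps_compose (fps_exp (t / 2)) (fps_X ^ 2 :: real fps)"
  define G where "G = fps_exp 1 * E"
  have "fps_deriv E = (fps_compose (fps_deriv (fps_exp (t / 2))) (fps_X ^ 2)) * fps_deriv (fps_X ^ 2)"
    unfolding E_def by (rule fps_compose_deriv) simp
  also have "fps_compose (fps_deriv (fps_exp (t / 2))) (fps_X ^ 2) = fps_const (t / 2) * E"
    unfolding E_def by (simp add: fps_compose_mult_distrib)
  also have "fps_const (t / 2) * E * fps_deriv (fps_X ^ 2) = fps_const t * fps_X * E"
  proof -
    have "fps_deriv (fps_X ^ 2 :: real fps) = fps_const 2 * fps_X"
      by (simp add: fps_deriv_power numeral_fps_const)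
    moreover have "fps_const (t / 2) * fps_const 2 = fps_const t" by simp
    moreover have "fps_const (t / 2) * E * (fps_const 2 * fps_X) = (fps_const (t / 2) * fps_const 2) * fps_X * E"
      by (simp only: mult_ac)
    ultimately show ?thesis by (simp only:)
  qed
  finally have dE: "fps_deriv E = fps_const t * fps_X * E" .
  have dG: "fps_deriv G = G + fps_const t * (fps_X * G)"
    unfolding G_def by (simp add: dE algebra_simps)
  have G0: "fps_nth G 0 = 1" by (simp add: G_def E_def)
  have step: "real (Suc i) * fps_nth G (Suc i) = fps_nth G i + t * (if i = 0 then 0 else fps_nth G (i - 1))" for i
    using arg_cong[OF dG, of "\<lambda>F. fps_nth F i"] by simp
  have "fps_nth G h = matching_poly t h / fact h \<and> fps_nth G (Suc h) = matching_poly t (Suc h) / fact (Suc h)" for h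
  proof (induction h)
    case 0
    then show ?case using step[of 0] G0 by simp
  next
    case (Suc h)
    have "real (Suc (Suc h)) * fps_nth G (Suc (Suc h)) = fps_nth G (Suc h) + t * fps_nth G h" using step[of "Suc h"] by simp
    also have "\<dots> = matching_poly t (Suc h) / fact (Suc h) + t * (matching_poly t h / fact h)"
      using Suc by simp
    also have "matching_poly t h / fact h = real (Suc h) * matching_poly t h / fact (Suc h)"
      unfolding fact_Suc by (simp del: of_nat_Suc)
    also have "matching_poly t (Suc h) / fact (Suc h) + t * (real (Suc h) * matching_poly t h / fact (Suc h))
        = matching_poly t (Suc (Suc h)) / fact (Suc h)"
      by (simp add: add_divide_distrib mult_ac del: fact_Suc of_nat_Suc)
    finally have "real (Suc (Suc h)) * fps_nth G (Suc (Suc h)) = matching_poly t (Suc (Suc h)) / fact (Suc h)" .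
    note mult = this
    have "fps_nth G (Suc (Suc h)) = real (Suc (Suc h)) * fps_nth G (Suc (Suc h)) / real (Suc (Suc h))"
      by (simp del: of_nat_Suc)
    also note mult
    also have "matching_poly t (Suc (Suc h)) / fact (Suc h) / real (Suc (Suc h))
        = matching_poly t (Suc (Suc h)) / fact (Suc (Suc h))"
      by (simp only: fact_Suc[of "Suc h"] divide_divide_eq_left mult.commute)
    finally show ?case using Suc by simp
  qed
  then show ?thesis by (simp add: egf_def G_def E_def fps_eq_iff)
qed

theorem theorem2:
  fixes k :: "nat \<Rightarrow> nat" and cs :: "nat \<Rightarrow> real" and c :: real
    and M :: "nat \<Rightarrow> nat set list pmf"
  assumes k_eq: "\<And>n. n \<ge> 1 \<Longrightarrow> real (k n) = cs n * real n powr (1 / 3)"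
    and cs_lim: "cs \<longlonglongrightarrow> c"
    and c_pos: "c > 0"
    and M_def: "\<And>n. M n = intersecting_process n (k n)"
  shows
    "(\<forall>b :: nat \<Rightarrow> real. filterlim b at_top sequentially \<longrightarrow>
        whp M (\<lambda>n Es. time0 Es \<le> time1 Es \<and> ereal_of_enat (time1 Es) \<le> ereal (b n)))
     \<and> whp M (\<lambda>n Es. time1 Es < \<infinity> \<and>
          lower_family n (k n) Es \<subseteq> set Es \<and> set Es \<subseteq> upper_family n (k n) Es)
     \<and> (\<exists>\<delta> \<eta> :: nat \<Rightarrow> real. \<delta> \<longlonglongrightarrow> 0 \<and> \<eta> \<longlonglongrightarrow> 0 \<and>
          whp M (\<lambda>n Es. time1 Es < \<infinity> \<and>
            real (card (upper_family n (k n) Es - lower_family n (k n) Es))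
              \<le> \<delta> n * real (card (lower_family n (k n) Es)) \<and>
            (\<exists>\<epsilon>. \<bar>\<epsilon>\<bar> \<le> \<eta> n \<and>
              real (card (set Es)) / real (n choose k n)
              = (1 + \<epsilon>) *
                ((\<Sum>S\<in>final_transversals Es. c powi (3 * (int (before0 Es) - int (card S))))
                  / real (k n) ^ before0 Es))))
     \<and> (\<exists>L :: nat \<Rightarrow> real.
          (\<forall>i. (\<lambda>n. measure_pmf.prob (M n) {Es. time0 Es = enat (i + 1)}
                    / measure_pmf.prob (M n) {Es. time0 Es > enat (i + 1)}) \<longlonglongrightarrow> L i) \<and>
          egf L = fps_exp 1 * (fps_compose (fps_exp (1 / (2 * c ^ 3))) (fps_X ^ 2) - 1))"
proof -
  have M_eq: "M = (\<lambda>n. intersecting_process n (k n))" using M_def by auto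
  define \<gamma> where "\<gamma> = c ^ 3"
  have \<gamma>: "\<gamma> > 0" using c_pos by (simp add: \<gamma>_def)
  have cube: "(\<lambda>n. real (k n) ^ 3 / real n) \<longlonglongrightarrow> \<gamma>"
  proof -
    have "(\<lambda>n. cs n ^ 3) \<longlonglongrightarrow> \<gamma>" unfolding \<gamma>_def by (intro tendsto_power cs_lim)
    moreover have "eventually (\<lambda>n. cs n ^ 3 = real (k n) ^ 3 / real n) sequentially"
      using eventually_ge_at_top[of 1]
    proof eventually_elim
      case (elim n)
      have "(real n powr (1 / 3)) ^ 3 = real n"
        using elim by (simp add: powr_powr flip: powr_realpow)
      then show ?case using k_eq[OF elim] elim by (simp add: power_mult_distrib)
    qed
    ultimately show ?thesis by (rule Lim_transform_eventually)
  qed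
  have k_top: "filterlim k at_top sequentially"
    unfolding filterlim_at_top
  proof
    fix z :: nat
    have "eventually (\<lambda>n. real (k n) ^ 3 / real n > \<gamma> / 2) sequentially"
      by (rule order_tendstoD(1)[OF cube]) (simp add: \<gamma>)
    then show "eventually (\<lambda>n. z \<le> k n) sequentially"
      using eventually_ge_at_top[of "nat \<lceil>2 * real z ^ 3 / \<gamma>\<rceil>"] eventually_ge_at_top[of 1]
    proof eventually_elim
      case (elim n)
      have "2 * real z ^ 3 / \<gamma> \<le> real n" using elim(2) by (simp add: nat_ceiling_le_eq)
      then have "real z ^ 3 \<le> \<gamma> / 2 * real n" using \<gamma> by (simp add: field_simps)
      also have "\<dots> < real (k n) ^ 3" using elim(1,3) by (simp add: field_simps)
      finally have "real z < real (k n)" by (rule power_less_imp_less_base) simp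
      then show ?case by simp
    qed
  qed
  interpret regime k \<gamma> by unfold_locales (use cube \<gamma> k_top in auto)
  have cons: "\<exists>K. eventually (\<lambda>n. measure_pmf.prob (M n) {Es. \<not> settled n K Es} \<le> e) sequentially" if "e > 0" for e
    using settled_tight[OF that] unfolding M_eq .
  have a: "whp M (\<lambda>n Es. time0 Es \<le> time1 Es \<and> ereal_of_enat (time1 Es) \<le> ereal (b n))"
    if b: "filterlim b at_top sequentially" for b :: "nat \<Rightarrow> real"
  proof (rule whp_if_eventually_implied[OF cons])
    fix K
    have "eventually (\<lambda>n. real K \<le> b n) sequentially" using b by (simp add: filterlim_at_top)
    then show "eventually (\<lambda>n. \<forall>Es. settled n K Es \<longrightarrow>
        time0 Es \<le> time1 Es \<and> ereal_of_enat (time1 Es) \<le> ereal (b n)) sequentially"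
      using ev_settled_consequences[OF zero_less_one, of K]
    proof eventually_elim
      case (elim n)
      have "ereal_of_enat (time1 Es) \<le> ereal (b n)" if "settled n K Es" for Es
      proof -
        have "time1 Es \<le> enat K" using elim(2) that by blast
        then have "ereal_of_enat (time1 Es) \<le> ereal_of_enat (enat K)" by (simp only: ereal_of_enat_le_iff)
        also have "\<dots> \<le> ereal (b n)" using elim(1) by simp
        finally show ?thesis .
      qed
      then show ?case using time0_le_time1 by blast
    qed
  qed
  have b: "whp M (\<lambda>n Es. time1 Es < \<infinity> \<and>
          lower_family n (k n) Es \<subseteq> set Es \<and> set Es \<subseteq> upper_family n (k n) Es)"
  proof (rule whp_if_eventually_implied[OF cons])
    fix K
    show "eventually (\<lambda>n. \<forall>Es. settled n K Es \<longrightarrow> time1 Es < \<infinity> \<and>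
          lower_family n (k n) Es \<subseteq> set Es \<and> set Es \<subseteq> upper_family n (k n) Es) sequentially"
      using ev_settled_consequences[OF zero_less_one, of K]
    proof eventually_elim
      case (elim n)
      show ?case
      proof (intro allI impI)
        fix Es assume "settled n K Es"
        note st = elim[rule_format, OF this]
        have "time1 Es < \<infinity>" by (rule le_less_trans[OF conjunct1[OF st]]) simp
        then show "time1 Es < \<infinity> \<and> lower_family n (k n) Es \<subseteq> set Es \<and> set Es \<subseteq> upper_family n (k n) Es"
          using st by simp
      qed
    qed
  qed
  define Q where "Q d n Es \<longleftrightarrow> time1 Es < \<infinity> \<and>
            real (card (upper_family n (k n) Es - lower_family n (k n) Es))
              \<le> d * real (card (lower_family n (k n) Es)) \<and>
            (\<exists>\<epsilon>. \<bar>\<epsilon>\<bar> \<le> d \<and>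
              real (card (set Es)) / real (n choose k n)
              = (1 + \<epsilon>) *
                ((\<Sum>S\<in>final_transversals Es. c powi (3 * (int (before0 Es) - int (card S))))
                  / real (k n) ^ before0 Es))" for d n Es
  have "whp M (Q d)" if "d > 0" for d
  proof (rule whp_if_eventually_implied[OF cons])
    fix K
    show "eventually (\<lambda>n. \<forall>Es. settled n K Es \<longrightarrow> Q d n Es) sequentially"
      using ev_settled_consequences[OF that, of K]
    proof eventually_elim
      case (elim n)
      show ?case
      proof (intro allI impI)
        fix Es assume "settled n K Es"
        note st = elim[rule_format, OF this]
        have "time1 Es < \<infinity>" by (rule le_less_trans[OF conjunct1[OF st]]) simp
        moreover have "(\<Sum>S\<in>final_transversals Es. c powi (3 * (int (before0 Es) - int (card S))))
            = total (before0 Es) (final_transversals Es)"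
          unfolding total_def
        proof (intro sum.cong refl)
          fix S assume "S \<in> final_transversals Es"
          then have "card S \<le> before0 Es" using st by blast
          then have "3 * (int (before0 Es) - int (card S)) = int (3 * (before0 Es - card S))"
            by (simp add: of_nat_diff)
          then show "c powi (3 * (int (before0 Es) - int (card S))) = \<gamma> ^ (before0 Es - card S)"
            by (simp only: power_int_of_nat \<gamma>_def power_mult)
        qed
        ultimately show "Q d n Es" using st unfolding Q_def W_def by simp
      qed
    qed
  qed
  \<comment> \<open>The same null sequence serves as \<open>\<delta>\<close> and as
    \<open>\<eta>\<close>.\<close>
  then obtain \<delta> :: "nat \<Rightarrow> real" where \<delta>: "\<delta> \<longlonglongrightarrow> 0" "whp M (\<lambda>n. Q (\<delta> n) n)"
    using whp_vanishing_tolerance by blast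
  \<comment> \<open>The probability of \<open>r_0 = i + 1\<close> is a difference of two tail
    probabilities, and \<open>nice_limit i / nice_limit (i + 1)\<close> is the matching polynomial
    at \<open>i\<close>; dividing leaves this value minus 1.\<close>
  define L where "L i = matching_poly (1 / \<gamma>) i - 1" for i
  have L: "(\<lambda>n. measure_pmf.prob (M n) {Es. time0 Es = enat (i + 1)}
       / measure_pmf.prob (M n) {Es. time0 Es > enat (i + 1)}) \<longlonglongrightarrow> L i" for i
  proof -
    have split: "measure_pmf.prob (M n) {Es. time0 Es = enat (i + 1)}
       = measure_pmf.prob (M n) {Es. time0 Es > enat i} - measure_pmf.prob (M n) {Es. time0 Es > enat (i + 1)}" for n
    proof -
      have "{Es. time0 Es = enat (i + 1)} = {Es. time0 Es > enat i} - {Es. time0 Es > enat (i + 1)}"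
      proof (intro set_eqI)
        fix Es
        show "Es \<in> {Es. time0 Es = enat (i + 1)} \<longleftrightarrow> Es \<in> {Es. time0 Es > enat i} - {Es. time0 Es > enat (i + 1)}"
          by (cases "time0 Es") auto
      qed
      moreover have "{Es. time0 Es > enat (i + 1)} \<subseteq> {Es. time0 Es > enat i}"
        using le_less_trans[of "enat i" "enat (i + 1)"] by auto
      ultimately show ?thesis by (simp add: measure_pmf.finite_measure_Diff)
    qed
    have "(\<lambda>n. (measure_pmf.prob (M n) {Es. time0 Es > enat i} - measure_pmf.prob (M n) {Es. time0 Es > enat (i + 1)})
        / measure_pmf.prob (M n) {Es. time0 Es > enat (i + 1)})
       \<longlonglongrightarrow> (nice_limit i - nice_limit (i + 1)) / nice_limit (i + 1)"
      unfolding M_eq using nice_limit_pos[of "i + 1"]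
      by (intro tendsto_divide tendsto_diff time0_greater_tendsto) simp
    moreover have "(nice_limit i - nice_limit (i + 1)) / nice_limit (i + 1) = L i"
    proof -
      have "matching_poly (1 / \<gamma>) i > 0" using matching_poly_ge_1[of "1 / \<gamma>" i] \<gamma> by simp
      moreover have eq: "nice_limit (i + 1) = nice_limit i * (1 / matching_poly (1 / \<gamma>) i)"
        by (simp add: nice_limit_def)
      ultimately show ?thesis using nice_limit_pos[of i] unfolding eq L_def by (simp add: field_simps)
    qed
    ultimately show ?thesis unfolding split by simp
  qed
  \<comment> \<open>The subtracted constant sequence 1 has generating function
    \<open>fps_exp 1\<close>.\<close>
  have "egf L = egf (matching_poly (1 / \<gamma>)) - fps_exp 1"
    by (simp add: egf_def L_def fps_eq_iff diff_divide_distrib)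
  also have "\<dots> = fps_exp 1 * (fps_compose (fps_exp (1 / (2 * c ^ 3))) (fps_X ^ 2) - 1)"
    unfolding egf_matching_poly by (simp add: \<gamma>_def right_diff_distrib mult.commute)
  finally have egf: "egf L = fps_exp 1 * (fps_compose (fps_exp (1 / (2 * c ^ 3))) (fps_X ^ 2) - 1)" .
  show ?thesis
    using a b \<delta> L egf unfolding Q_def by (intro conjI allI impI exI[of _ \<delta>] exI[of _ L]) blast+
qed

end
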